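(* The dual problem $$\sup_{p\in K_\varphi}\Bigl\{-\tfrac12\|\operatorname{div}p\|_{L^2(\Omega)}^2-\int_\Omega f\,\operatorname{div}p\,dx-\int_\Omega\varphi^*(x,|p(x)|)\,dx\Bigr\}$$ admits a maximizer $p\in K_\varphi$. Let $u\in X_\varphi$ be the (unique) minimizer of $\mathcal F$ over $X_\varphi$ and let $p\in K_\varphi$ be a maximizer of the dual problem. Then $$\operatorname{div}p=u-f\quad\text{in }L^2(\Omega),\qquad p(x)\in\partial_z\Phi(x,\nabla u(x))\quad\text{for a.e. }x\in\Omega.$$ If $\nabla u(x)\ne0$, the latter can be written as $$p(x)=a(x)\frac{\nabla u(x)}{|\nabla u(x)|},\qquad a(x)\in\partial_t\varphi(x,|\nabla u(x)|).$$
   Context: $\Omega\subset\mathbb R^N$ is a bounded Lipschitz domain with Lebesgue measure, and $f\in L^2(\Omega)$. Standing assumptions on $\varphi:\Omega\times[0,\infty)\to[0,\infty)$: $x\mapsto\varphi(x,t)$ is measurable for every $t\ge0$; for a.e. $x\in\Omega$ the map $t\mapsto\varphi(x,t)$ is convex, increasing (in the non-strict sense), continuous, and $\varphi(x,0)=0$; $\varphi(\cdot,t)\in L^1(\Omega)$ for every $t\ge0$; there is a constant $C_\Delta$ with $\varphi(x,2t)\le C_\Delta\varphi(x,t)$ for a.e. $x\in\Omega$ and all $t\ge0$; and $\lim_{t\to\infty}\operatorname{ess\,inf}_{x\in\Omega}\varphi(x,t)/t=\infty$. Set $\Phi(x,z):=\varphi(x,|z|)$ for $z\in\mathbb R^N$,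 $\varphi^*(x,s):=\sup_{t\ge0}\{st-\varphi(x,t)\}$ for $s\ge0$, and, for measurable $v:\Omega\to\mathbb R^N$, $\rho_\varphi(v):=\int_\Omega\varphi(x,|v(x)|)\,dx$. $L^{\varphi^*}(\Omega;\mathbb R^N)$ is the set of measurable $p:\Omega\to\mathbb R^N$ with $\int_\Omega\varphi^*(x,\lambda|p(x)|)\,dx<\infty$ for some $\lambda>0$. $X_\varphi:=\{u\in L^2(\Omega)\cap W^{1,1}(\Omega):\rho_\varphi(\nabla u)<\infty\}$ and $\mathcal F(u):=\frac12\|u-f\|_{L^2(\Omega)}^2+\rho_\varphi(\nabla u)$ for $u\in X_\varphi$. With $\operatorname{div}$ understood in the distributional sense, $$K_\varphi:=\Bigl\{p\in L^{\varphi^*}(\Omega;\mathbb R^N):\ \operatorname{div}p\in L^2(\Omega)\text{ and }\int_\Omega p\cdot\nabla u\,dx=-\int_\Omega(\operatorname{div}p)\,u\,dx\ \text{for all }u\in X_\varphi\Bigr\}.$$ $\partial_z\Phi$ and $\partial_t\varphi$ denote the convex subdifferentials with respect to the indicated variable, on $\mathbb R^N$ and for the convex function $t\mapsto\varphi(x,t)$ on $[0,\infty)$, respectively. *)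

theory Defs
  imports "HOL-Analysis.Analysis" "HOL-Probability.Essential_Supremum"
begin

text \<open>Measurable functions on \<open>\<Omega>\<close> are represented by total functions, read modulo equality almost
  everywhere with respect to \<open>lebesgue_on \<Omega>\<close>; their values outside \<open>\<Omega>\<close> are irrelevant.\<close>

subsection \<open>Lipschitz domains\<close>

text \<open>Near every boundary point \<open>z\<close>, in Cartesian coordinates with last axis \<open>e\<close>, the set is the
  part lying strictly above the graph of a Lipschitz function on the hyperplane orthogonal to
  \<open>e\<close>; the point \<open>x - (x \<bullet> e) *\<^sub>R e\<close> is the projection of \<open>x\<close> to that hyperplane.\<close>

definition lipschitz_domain :: "'a::euclidean_space set \<Rightarrow> bool" where
  "lipschitz_domain \<Omega> \<longleftrightarrow> open \<Omega> \<and> connected \<Omega> \<and> \<Omega> \<noteq> {} \<and>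
     (\<forall>z\<in>frontier \<Omega>. \<exists>U e \<gamma> L. open U \<and> z \<in> U \<and> norm e = 1 \<and>
        L-lipschitz_on {y. y \<bullet> e = 0} (\<gamma> :: 'a \<Rightarrow> real) \<and>
        \<Omega> \<inter> U = {x \<in> U. \<gamma> (x - (x \<bullet> e) *\<^sub>R e) < x \<bullet> e})"

subsection \<open>Test functions\<close>

primrec C_diff :: "nat \<Rightarrow> ('a::euclidean_space \<Rightarrow> real) \<Rightarrow> bool" where
  "C_diff 0 \<psi> \<longleftrightarrow> continuous_on UNIV \<psi>"
| "C_diff (Suc k) \<psi> \<longleftrightarrow>
     (\<exists>\<psi>'. (\<forall>x. (\<psi> has_derivative \<psi>' x) (at x)) \<and> (\<forall>i\<in>Basis. C_diff k (\<lambda>x. \<psi>' x i)))"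

definition test_functions :: "'a::euclidean_space set \<Rightarrow> ('a \<Rightarrow> real) set" where
  "test_functions \<Omega> = {\<psi>. (\<forall>k. C_diff k \<psi>) \<and>
     compact (closure {x. \<psi> x \<noteq> 0}) \<and> closure {x. \<psi> x \<noteq> 0} \<subseteq> \<Omega>}"

definition grad :: "('a::euclidean_space \<Rightarrow> real) \<Rightarrow> 'a \<Rightarrow> 'a" where
  "grad \<psi> x = (\<Sum>i\<in>Basis. frechet_derivative \<psi> (at x) i *\<^sub>R i)"

subsection \<open>Distributional gradient and divergence\<close>

definition locally_integrable ::
  "'a::euclidean_space set \<Rightarrow> ('a \<Rightarrow> 'b::{banach, second_countable_topology}) \<Rightarrow> bool" where
  "locally_integrable \<Omega> v \<longleftrightarrow> (\<forall>K. compact K \<and> K \<subseteq> \<Omega> \<longrightarrow> integrable (lebesgue_on K) v)"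

definition has_weak_gradient ::
  "'a::euclidean_space set \<Rightarrow> ('a \<Rightarrow> real) \<Rightarrow> ('a \<Rightarrow> 'a) \<Rightarrow> bool" where
  "has_weak_gradient \<Omega> u g \<longleftrightarrow> locally_integrable \<Omega> u \<and> locally_integrable \<Omega> g \<and>
     (\<forall>\<psi>\<in>test_functions \<Omega>.
        (\<integral>x. u x *\<^sub>R grad \<psi> x \<partial>lebesgue_on \<Omega>) = - (\<integral>x. \<psi> x *\<^sub>R g x \<partial>lebesgue_on \<Omega>))"

definition weak_gradient :: "'a::euclidean_space set \<Rightarrow> ('a \<Rightarrow> real) \<Rightarrow> 'a \<Rightarrow> 'a" where
  "weak_gradient \<Omega> u = (SOME g. has_weak_gradient \<Omega> u g)"

definition has_weak_divergence ::
  "'a::euclidean_space set \<Rightarrow> ('a \<Rightarrow> 'a) \<Rightarrow> ('a \<Rightarrow> real) \<Rightarrow> bool" where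
  "has_weak_divergence \<Omega> p d \<longleftrightarrow> locally_integrable \<Omega> p \<and> locally_integrable \<Omega> d \<and>
     (\<forall>\<psi>\<in>test_functions \<Omega>.
        (\<integral>x. p x \<bullet> grad \<psi> x \<partial>lebesgue_on \<Omega>) = - (\<integral>x. d x * \<psi> x \<partial>lebesgue_on \<Omega>))"

definition weak_divergence :: "'a::euclidean_space set \<Rightarrow> ('a \<Rightarrow> 'a) \<Rightarrow> 'a \<Rightarrow> real" where
  "weak_divergence \<Omega> p = (SOME d. has_weak_divergence \<Omega> p d)"

subsection \<open>Function spaces\<close>

definition L2 :: "'a::euclidean_space set \<Rightarrow> ('a \<Rightarrow> real) set" where
  "L2 \<Omega> = {u \<in> borel_measurable (lebesgue_on \<Omega>). integrable (lebesgue_on \<Omega>) (\<lambda>x. (u x)\<^sup>2)}"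

definition norm_L2 :: "'a::euclidean_space set \<Rightarrow> ('a \<Rightarrow> real) \<Rightarrow> real" where
  "norm_L2 \<Omega> u = sqrt (\<integral>x. (u x)\<^sup>2 \<partial>lebesgue_on \<Omega>)"

definition W11 :: "'a::euclidean_space set \<Rightarrow> ('a \<Rightarrow> real) set" where
  "W11 \<Omega> = {u. integrable (lebesgue_on \<Omega>) u \<and>
     (\<exists>g. has_weak_gradient \<Omega> u g \<and> integrable (lebesgue_on \<Omega>) g)}"

text \<open>The conjugate may be infinite. It is nonnegative whenever \<open>\<phi> x 0 = 0\<close>, so that the
  conversion \<open>e2ennreal\<close> applied to it below does not truncate.\<close>

definition conjugate :: "('a \<Rightarrow> real \<Rightarrow> real) \<Rightarrow> 'a \<Rightarrow> real \<Rightarrow> ereal" where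
  "conjugate \<phi> x s = (SUP t\<in>{0..}. ereal (s * t - \<phi> x t))"

definition modular ::
  "'a::euclidean_space set \<Rightarrow> ('a \<Rightarrow> real \<Rightarrow> real) \<Rightarrow> ('a \<Rightarrow> 'a) \<Rightarrow> ennreal" where
  "modular \<Omega> \<phi> v = (\<integral>\<^sup>+x. ennreal (\<phi> x (norm (v x))) \<partial>lebesgue_on \<Omega>)"

definition conj_modular ::
  "'a::euclidean_space set \<Rightarrow> ('a \<Rightarrow> real \<Rightarrow> real) \<Rightarrow> ('a \<Rightarrow> 'a) \<Rightarrow> ennreal" where
  "conj_modular \<Omega> \<phi> p = (\<integral>\<^sup>+x. e2ennreal (conjugate \<phi> x (norm (p x))) \<partial>lebesgue_on \<Omega>)"

definition L_conj ::
  "'a::euclidean_space set \<Rightarrow> ('a \<Rightarrow> real \<Rightarrow> real) \<Rightarrow> ('a \<Rightarrow> 'a) set" where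
  "L_conj \<Omega> \<phi> = {p \<in> borel_measurable (lebesgue_on \<Omega>).
     \<exists>r>0. conj_modular \<Omega> \<phi> (\<lambda>x. r *\<^sub>R p x) < \<infinity>}"

definition X_space ::
  "'a::euclidean_space set \<Rightarrow> ('a \<Rightarrow> real \<Rightarrow> real) \<Rightarrow> ('a \<Rightarrow> real) set" where
  "X_space \<Omega> \<phi> = {u \<in> L2 \<Omega> \<inter> W11 \<Omega>. modular \<Omega> \<phi> (weak_gradient \<Omega> u) < \<infinity>}"

definition K_space ::
  "'a::euclidean_space set \<Rightarrow> ('a \<Rightarrow> real \<Rightarrow> real) \<Rightarrow> ('a \<Rightarrow> 'a) set" where
  "K_space \<Omega> \<phi> = {p \<in> L_conj \<Omega> \<phi>.
     (\<exists>d\<in>L2 \<Omega>. has_weak_divergence \<Omega> p d) \<and>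
     (\<forall>u\<in>X_space \<Omega> \<phi>. (\<integral>x. p x \<bullet> weak_gradient \<Omega> u x \<partial>lebesgue_on \<Omega>)
        = - (\<integral>x. weak_divergence \<Omega> p x * u x \<partial>lebesgue_on \<Omega>))}"

subsection \<open>Primal and dual functionals, subdifferentials\<close>

definition primal ::
  "'a::euclidean_space set \<Rightarrow> ('a \<Rightarrow> real \<Rightarrow> real) \<Rightarrow> ('a \<Rightarrow> real) \<Rightarrow> ('a \<Rightarrow> real) \<Rightarrow> ennreal" where
  "primal \<Omega> \<phi> f u =
     ennreal (1/2 * (norm_L2 \<Omega> (\<lambda>x. u x - f x))\<^sup>2) + modular \<Omega> \<phi> (weak_gradient \<Omega> u)"

text \<open>The dual functional takes the value \<open>-\<infinity>\<close> where the last integral diverges.\<close>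

definition dual ::
  "'a::euclidean_space set \<Rightarrow> ('a \<Rightarrow> real \<Rightarrow> real) \<Rightarrow> ('a \<Rightarrow> real) \<Rightarrow> ('a \<Rightarrow> 'a) \<Rightarrow> ereal" where
  "dual \<Omega> \<phi> f p =
     ereal (- (1/2) * (norm_L2 \<Omega> (weak_divergence \<Omega> p))\<^sup>2
            - (\<integral>x. f x * weak_divergence \<Omega> p x \<partial>lebesgue_on \<Omega>))
     - enn2ereal (conj_modular \<Omega> \<phi> p)"

definition primal_minimizer ::
  "'a::euclidean_space set \<Rightarrow> ('a \<Rightarrow> real \<Rightarrow> real) \<Rightarrow> ('a \<Rightarrow> real) \<Rightarrow> ('a \<Rightarrow> real) \<Rightarrow> bool" where
  "primal_minimizer \<Omega> \<phi> f u \<longleftrightarrow>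
     u \<in> X_space \<Omega> \<phi> \<and> (\<forall>v\<in>X_space \<Omega> \<phi>. primal \<Omega> \<phi> f u \<le> primal \<Omega> \<phi> f v)"

definition dual_maximizer ::
  "'a::euclidean_space set \<Rightarrow> ('a \<Rightarrow> real \<Rightarrow> real) \<Rightarrow> ('a \<Rightarrow> real) \<Rightarrow> ('a \<Rightarrow> 'a) \<Rightarrow> bool" where
  "dual_maximizer \<Omega> \<phi> f p \<longleftrightarrow>
     p \<in> K_space \<Omega> \<phi> \<and> (\<forall>q\<in>K_space \<Omega> \<phi>. dual \<Omega> \<phi> f q \<le> dual \<Omega> \<phi> f p)"

definition subdifferential :: "'b::real_inner set \<Rightarrow> ('b \<Rightarrow> real) \<Rightarrow> 'b \<Rightarrow> 'b set" where
  "subdifferential S h z = {q. z \<in> S \<and> (\<forall>w\<in>S. h z + q \<bullet> (w - z) \<le> h w)}"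

definition essinf :: "'a measure \<Rightarrow> ('a \<Rightarrow> ereal) \<Rightarrow> ereal" where
  "essinf M h = - esssup M (\<lambda>x. - h x)"

end

theory Submission
  imports Defs
begin

text \<open>
  Pointwise, \<open>\<phi>(x,|z|) + \<phi>\<^sup>*(x,|p|) - p \<bullet> z \<ge> 0\<close>, with equality exactly when \<open>p\<close> is a subgradient at \<open>z\<close>.
  Integrating, the gap between the primal value at \<open>u\<close> and the dual value at \<open>p\<close> is the sum of the
  integral of this expression at \<open>z = \<nabla>u\<close> and half the squared \<open>L\<^sup>2\<close>-norm of \<open>u - f - div p\<close>. So everything
  follows once some \<open>p\<close> with \<open>div p = u - f\<close> and \<open>p(x) \<in> \<partial>\<^sub>z\<Phi>(x,\<nabla>u(x))\<close> is found for a minimizer \<open>u\<close>.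
  Minimality of \<open>u\<close> gives, for each direction \<open>v\<close>, a measurable selection \<open>p\<close> of the subdifferential with
  \<open>\<integral> p \<bullet> \<nabla>v + \<integral> (u - f) v \<ge> 0\<close>; a finite-dimensional minimax argument makes finitely many of these
  expressions small at once, and a compactness argument in the convex set of selections makes all of
  them vanish. Testing against all of \<open>X\<^sub>\<phi>\<close>, rather than against smooth functions, means that no density
  result is needed.
\<close>

section \<open>Smooth test functions\<close>

text \<open>No dual space and no weak topology enters. Doubling makes this possible: a subgradient
  \<open>p\<close> at \<open>g\<close> satisfies \<open>\<bar>p x \<bullet> h x\<bar> \<le> \<phi> x
  (norm (g x) + norm (h x))\<close>, and doubling makes the right side integrable as soon as both
  modulars are finite. This majorant does not depend on \<open>p\<close>, so almost everywhere
  convergence of selections lets every tested equation pass to the limit. The compactness required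
  shrinks to extracting an almost everywhere convergent sequence from a convex set, which is done by
  minimizing a strictly convex integral. The same device produces the primal minimizer: the energy
  need not be strictly convex in the gradient, so the strictly convex integral selects among its
  near-minimizers, and superlinear growth supplies the equi-integrability. The delicate point is the
  order of quantifiers: minimality yields a selection for each direction separately, whereas one
  field must serve all directions. The minimax argument exchanges the two for finitely many
  directions at a time.\<close>

lemma C_diff_continuous: "C_diff k \<psi> \<Longrightarrow> continuous_on UNIV \<psi>"
proof (cases k)
  case (Suc m)
  assume "C_diff k \<psi>"
  with Suc obtain \<psi>' where "\<And>x. (\<psi> has_derivative \<psi>' x) (at x)" by auto
  then show ?thesis
    by (meson continuous_at_imp_continuous_on has_derivative_continuous)
qed auto

lemma C_diff_SucD: "C_diff (Suc k) \<psi> \<Longrightarrow> C_diff k \<psi>"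
proof (induction k arbitrary: \<psi>)
  case 0
  then show ?case using C_diff_continuous[of "Suc 0"] by simp
next
  case (Suc k)
  then obtain \<psi>' where "\<And>x. (\<psi> has_derivative \<psi>' x) (at x)"
    "\<And>i. i \<in> Basis \<Longrightarrow> C_diff (Suc k) (\<lambda>x. \<psi>' x i)"
    unfolding C_diff.simps(2)[of "Suc k"] by blast
  with Suc.IH show ?case unfolding C_diff.simps(2)[of k] by blast
qed

lemma C_diff_const: "C_diff k (\<lambda>x. c)"
  by (induction k arbitrary: c) (auto intro!: exI[of _ "\<lambda>x h. 0"])

lemma C_diff_add: "C_diff k f \<Longrightarrow> C_diff k g \<Longrightarrow> C_diff k (\<lambda>x. f x + g x)"
proof (induction k arbitrary: f g)
  case 0
  then show ?case by (auto intro: continuous_intros)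
next
  case (Suc k)
  obtain f' where f': "\<And>x. (f has_derivative f' x) (at x)"
    "\<And>i. i \<in> Basis \<Longrightarrow> C_diff k (\<lambda>x. f' x i)" using Suc.prems(1) by auto
  obtain g' where g': "\<And>x. (g has_derivative g' x) (at x)"
    "\<And>i. i \<in> Basis \<Longrightarrow> C_diff k (\<lambda>x. g' x i)" using Suc.prems(2) by auto
  have "((\<lambda>x. f x + g x) has_derivative (\<lambda>h. f' x h + g' x h)) (at x)" for x
    by (intro has_derivative_add f' g')
  with f' g' Suc.IH show ?case
    by (auto intro!: exI[of _ "\<lambda>x h. f' x h + g' x h"])
qed

lemma C_diff_mult: "C_diff k f \<Longrightarrow> C_diff k g \<Longrightarrow> C_diff k (\<lambda>x. f x * g x)"
proof (induction k arbitrary: f g)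
  case 0
  then show ?case by (auto intro: continuous_intros)
next
  case (Suc k)
  obtain f' where f': "\<And>x. (f has_derivative f' x) (at x)"
    "\<And>i. i \<in> Basis \<Longrightarrow> C_diff k (\<lambda>x. f' x i)" using Suc.prems(1) by auto
  obtain g' where g': "\<And>x. (g has_derivative g' x) (at x)"
    "\<And>i. i \<in> Basis \<Longrightarrow> C_diff k (\<lambda>x. g' x i)" using Suc.prems(2) by auto
  have "((\<lambda>x. f x * g x) has_derivative (\<lambda>h. f x * g' x h + f' x h * g x)) (at x)" for x
    by (intro has_derivative_mult f' g')
  with f' g' Suc.IH Suc.prems[THEN C_diff_SucD] show ?case
    by (auto intro!: exI[of _ "\<lambda>x h. f x * g' x h + f' x h * g x"] C_diff_add)
qed

lemma C_diff_prod: "(\<And>i. i \<in> I \<Longrightarrow> C_diff k (f i)) \<Longrightarrow> C_diff k (\<lambda>x. \<Prod>i\<in>I. f i x)"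
  by (induction I rule: infinite_finite_induct) (auto intro: C_diff_const C_diff_mult)

text \<open>Products of functions \<open>exp (- 1 / (k s))\<close> of the distances to the faces of a box are test functions,
  and as \<open>k \<rightarrow> \<infinity>\<close> they increase to the indicator of the box. The extra factors \<open>(1 / t) ^ n\<close> make the
  family closed under differentiation, up to linear combinations.\<close>

definition flat_step :: "nat \<Rightarrow> real \<Rightarrow> real" where
  "flat_step n t = (if t > 0 then (1 / t) ^ n * exp (- (1 / t)) else 0)"

lemma flat_step_tendsto_0: "(flat_step n \<longlongrightarrow> 0) (at_right 0)"
proof -
  have "((\<lambda>t::real. (inverse t) ^ n / exp (inverse t)) \<longlongrightarrow> 0) (at_right 0)"
    by (rule filterlim_compose[OF tendsto_power_div_exp_0 filterlim_inverse_at_top_right])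
  moreover have "\<forall>\<^sub>F t in at_right 0. (inverse t) ^ n / exp (inverse t) = flat_step n t"
    unfolding eventually_at_right_field
    by (intro exI[of _ 1]) (auto simp: flat_step_def exp_minus field_simps)
  ultimately show ?thesis by (rule Lim_transform_eventually)
qed

lemma flat_step_deriv:
  "(flat_step n has_real_derivative (flat_step (n + 2) t - real n * flat_step (n + 1) t)) (at t)"
proof -
  consider "t > 0" | "t < 0" | "t = 0" by linarith
  then show ?thesis
  proof cases
    case 1
    have inv: "((\<lambda>t. 1 / t) has_real_derivative - ((1 / t) ^ 2)) (at t)"
      using 1 by (auto intro!: derivative_eq_intros simp: power2_eq_square)
    have "((\<lambda>t. (1 / t) ^ n * exp (- (1 / t))) has_real_derivative
        (1 / t) ^ n * (exp (- (1 / t)) * (1 / t) ^ 2)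
          + (real n * (1 / t) ^ (n - 1) * (- ((1 / t) ^ 2))) * exp (- (1 / t))) (at t)"
      using DERIV_mult[OF DERIV_power[OF inv, of n] DERIV_chain2[OF DERIV_exp DERIV_minus[OF inv]]]
      by (simp add: ac_simps)
    also have "(1 / t) ^ n * (exp (- (1 / t)) * (1 / t) ^ 2)
          + (real n * (1 / t) ^ (n - 1) * (- ((1 / t) ^ 2))) * exp (- (1 / t))
        = flat_step (n + 2) t - real n * flat_step (n + 1) t"
      using 1 by (cases n) (simp_all add: flat_step_def power_add power2_eq_square algebra_simps add_divide_distrib)
    finally have "((\<lambda>t. (1 / t) ^ n * exp (- (1 / t))) has_real_derivative
        (flat_step (n + 2) t - real n * flat_step (n + 1) t)) (at t)" .
    moreover have "\<forall>\<^sub>F x in nhds t. flat_step n x = (1 / x) ^ n * exp (- (1 / x))"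
      using eventually_nhds_in_open[of "{0<..}" t] 1
      by (auto elim!: eventually_mono simp: flat_step_def)
    ultimately show ?thesis by (subst DERIV_cong_ev[OF refl _ refl])
  next
    case 2
    have "\<forall>\<^sub>F x in nhds t. flat_step n x = 0"
      using eventually_nhds_in_open[of "{..<0}" t] 2
      by (auto elim!: eventually_mono simp: flat_step_def)
    then have "(flat_step n has_real_derivative 0) (at t)"
      by (subst DERIV_cong_ev[OF refl _ refl]) auto
    with 2 show ?thesis by (simp add: flat_step_def)
  next
    case 3
    \<comment> \<open>From the right the difference quotient at \<open>0\<close> is
      \<open>flat_step (Suc n)\<close> itself, so the limit already known is also the
      derivative.\<close>
    have "((\<lambda>h. flat_step n h / h) \<longlongrightarrow> 0) (at_right 0)"
      by (rule Lim_transform_eventually[OF flat_step_tendsto_0[of "Suc n"]])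
        (auto simp: eventually_at_right_field flat_step_def intro!: exI[of _ 1])
    moreover have "((\<lambda>h. flat_step n h / h) \<longlongrightarrow> 0) (at_left 0)"
      by (rule Lim_transform_eventually[OF tendsto_const])
        (auto simp: eventually_at_left_field flat_step_def intro!: exI[of _ "-1"])
    ultimately have "((\<lambda>h. flat_step n h / h) \<longlongrightarrow> 0) (at 0)"
      by (simp add: filterlim_at_split)
    with 3 show ?thesis by (simp add: DERIV_def flat_step_def)
  qed
qed

text \<open>The affine argument covers both faces of a box orthogonal to an axis. The exponent
  \<open>n\<close> stays arbitrary in the induction because each derivative raises it.\<close>

lemma C_diff_flat_step: "C_diff k (\<lambda>x. flat_step n (x \<bullet> e + c))"
proof (induction k arbitrary: n)
  case 0
  have "continuous_on UNIV (flat_step n)"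
    by (meson DERIV_isCont continuous_at_imp_continuous_on flat_step_deriv)
  then have "continuous_on UNIV (flat_step n \<circ> (\<lambda>x. x \<bullet> e + c))"
    by (intro continuous_on_compose continuous_intros) (auto intro: continuous_on_subset)
  then show ?case by (simp add: o_def)
next
  case (Suc k)
  let ?D = "\<lambda>x h. (flat_step (n + 2) (x \<bullet> e + c) - real n * flat_step (n + 1) (x \<bullet> e + c)) * (h \<bullet> e)"
  have "((\<lambda>x. flat_step n (x \<bullet> e + c)) has_derivative ?D x) (at x)" for x
  proof -
    have "((\<lambda>x. x \<bullet> e + c) has_derivative (\<lambda>h. h \<bullet> e)) (at x)"
      by (auto intro!: derivative_eq_intros)
    from has_derivative_compose[OF this flat_step_deriv[unfolded has_field_derivative_def]]
    show ?thesis by simp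
  qed
  moreover have "C_diff k (\<lambda>x. (flat_step (n + 2) (x \<bullet> e + c)
      + (- real n) * flat_step (n + 1) (x \<bullet> e + c)) * (i \<bullet> e))" for i
    by (intro C_diff_mult C_diff_add C_diff_const Suc.IH)
  ultimately show ?case by (auto intro!: exI[of _ ?D])
qed

section \<open>Integrals against test functions\<close>

lemma test_function_facts:
  assumes "\<psi> \<in> test_functions \<Omega>"
  obtains K B where "compact K" "K \<subseteq> \<Omega>" "continuous_on UNIV \<psi>" "continuous_on UNIV (grad \<psi>)"
    "\<And>x. x \<notin> K \<Longrightarrow> \<psi> x = 0 \<and> grad \<psi> x = 0" "\<And>x. \<bar>\<psi> x\<bar> \<le> B" "\<And>x. norm (grad \<psi> x) \<le> B"
    "\<And>x. (\<psi> has_derivative (\<lambda>h. grad \<psi> x \<bullet> h)) (at x)"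
proof -
  define K where "K = closure {x. \<psi> x \<noteq> 0}"
  have K: "compact K" "K \<subseteq> \<Omega>" and C: "\<And>k. C_diff k \<psi>"
    using assms by (auto simp: test_functions_def K_def)
  from C[of "Suc 0"] obtain \<psi>' where \<psi>': "\<And>x. (\<psi> has_derivative \<psi>' x) (at x)"
    "\<And>i. i \<in> Basis \<Longrightarrow> continuous_on UNIV (\<lambda>x. \<psi>' x i)" by auto
  have grad: "grad \<psi> x = (\<Sum>i\<in>Basis. \<psi>' x i *\<^sub>R i)" for x
    using frechet_derivative_at[OF \<psi>'(1)[of x]] by (simp add: grad_def)
  have D: "(\<psi> has_derivative (\<lambda>h. grad \<psi> x \<bullet> h)) (at x)" for x
  proof -
    interpret linear "\<psi>' x" using \<psi>'(1) by (rule has_derivative_linear)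
    have "\<psi>' x h = grad \<psi> x \<bullet> h" for h
    proof -
      have "\<psi>' x h = \<psi>' x (\<Sum>i\<in>Basis. (h \<bullet> i) *\<^sub>R i)" by (simp add: euclidean_representation)
      also have "\<dots> = (\<Sum>i\<in>Basis. (h \<bullet> i) * \<psi>' x i)" by (simp add: sum scale)
      also have "\<dots> = grad \<psi> x \<bullet> h"
        by (simp add: grad inner_sum_left inner_commute[of h] mult.commute)
      finally show ?thesis .
    qed
    then have "\<psi>' x = (\<lambda>h. grad \<psi> x \<bullet> h)" by auto
    with \<psi>'(1)[of x] show ?thesis by simp
  qed
  have cont: "continuous_on UNIV \<psi>" "continuous_on UNIV (grad \<psi>)"
    using C[of 0] \<psi>'(2) unfolding grad by (auto intro!: continuous_intros)
  have zero: "\<psi> x = 0 \<and> grad \<psi> x = 0" if "x \<notin> K" for x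
  proof -
    have nz: "\<psi> y = 0" if "y \<in> - K" for y
      using that closure_subset[of "{x. \<psi> x \<noteq> 0}"] by (auto simp: K_def)
    have open_K: "open (- K)" unfolding K_def by (intro open_Compl closed_closure)
    have "(\<psi> has_derivative (\<lambda>h. 0)) (at x)"
    proof (rule has_derivative_transform_within_open[OF _ open_K])
      show "((\<lambda>_. 0::real) has_derivative (\<lambda>h. 0)) (at x)" by simp
    qed (simp_all add: nz that)
    then have "grad \<psi> x \<bullet> grad \<psi> x = 0"
      using fun_cong[OF has_derivative_unique[OF _ D], of "\<lambda>h. 0" x "grad \<psi> x"] by simp
    moreover have "\<psi> x = 0" using nz that by simp
    ultimately show ?thesis by simp
  qed
  have "bounded (\<psi> ` K)" "bounded (grad \<psi> ` K)"
    using cont K(1) by (meson compact_continuous_image compact_imp_bounded continuous_on_subset subset_UNIV)+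
  then obtain B1 B2 where "\<And>x. x \<in> K \<Longrightarrow> norm (\<psi> x) \<le> B1" "\<And>x. x \<in> K \<Longrightarrow> norm (grad \<psi> x) \<le> B2"
    unfolding bounded_iff by auto
  \<comment> \<open>The \<open>0\<close> serves the points outside \<open>K\<close>, where both
    functions vanish; for empty \<open>K\<close> the bounds \<open>B1\<close> and \<open>B2\<close>
    could be negative.\<close>
  then have "\<bar>\<psi> x\<bar> \<le> max 0 (max B1 B2)" "norm (grad \<psi> x) \<le> max 0 (max B1 B2)" for x
    using zero[of x] by (cases "x \<in> K"; force simp: le_max_iff_disj)+
  then show thesis using that K cont zero D by blast
qed

text \<open>Local integrability controls \<open>v\<close> on compact subsets only; since
  \<open>F\<close> vanishes off \<open>K\<close>, extension by zero carries the estimate from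
  \<open>K\<close> to \<Omega>.\<close>

lemma locally_integrable_mult_supported:
  fixes v :: "'a::euclidean_space \<Rightarrow> 'b::euclidean_space" and F :: "'a \<Rightarrow> 'c::euclidean_space"
  assumes v: "locally_integrable \<Omega> v" and \<Omega>: "open \<Omega>" and K: "compact K" "K \<subseteq> \<Omega>"
    and F: "F \<in> borel_measurable (lebesgue_on K)"
    and bd: "\<And>x. x \<in> K \<Longrightarrow> norm (F x) \<le> B * norm (v x)"
    and zero: "\<And>x. x \<notin> K \<Longrightarrow> F x = 0"
  shows "integrable (lebesgue_on \<Omega>) F"
proof -
  have "integrable (lebesgue_on K) v" using v K by (simp add: locally_integrable_def)
  then have "integrable (lebesgue_on K) F"
    by (intro Bochner_Integration.integrable_bound[of _ "\<lambda>x. B *\<^sub>R v x" F] F integrable_scaleR_right AE_I2)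
      (use bd in \<open>auto intro!: order_trans[OF _ mult_right_mono[OF abs_ge_self]]\<close>)
  then have "integrable lebesgue (\<lambda>x. if x \<in> K then F x else 0)"
    using K Lebesgue_Measure.integrable_restrict_UNIV[of K F] fmeasurableD[OF lmeasurable_compact[of K]] by simp
  also have "(\<lambda>x. if x \<in> K then F x else 0) = (\<lambda>x. if x \<in> \<Omega> then F x else 0)"
    by (rule ext) (use K zero in auto)
  finally show ?thesis
    using \<Omega> by (subst (asm) Lebesgue_Measure.integrable_restrict_UNIV) auto
qed

lemma continuous_on_borel_measurable_lebesgue_on:
  fixes f :: "'a::euclidean_space \<Rightarrow> 'b::euclidean_space"
  assumes "continuous_on UNIV f"
  shows "f \<in> borel_measurable (lebesgue_on S)"
proof -
  have "f \<in> borel_measurable lebesgue"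
    using borel_measurable_continuous_onI[OF assms] by (intro measurable_completion) simp
  then show ?thesis by (rule measurable_restrict_space1)
qed

lemma integrable_test_mult:
  fixes v :: "'a::euclidean_space \<Rightarrow> 'b::euclidean_space"
  assumes v: "locally_integrable \<Omega> v" and \<Omega>: "open \<Omega>" and \<psi>: "\<psi> \<in> test_functions \<Omega>"
  shows "integrable (lebesgue_on \<Omega>) (\<lambda>x. \<psi> x *\<^sub>R v x)"
proof -
  obtain K B where K: "compact K" "K \<subseteq> \<Omega>" "continuous_on UNIV \<psi>" "\<And>x. x \<notin> K \<Longrightarrow> \<psi> x = 0" 
     "\<And>x. \<bar>\<psi> x\<bar> \<le> B"
    using test_function_facts[OF \<psi>] by metis
  show ?thesis
  proof (rule locally_integrable_mult_supported[OF v \<Omega> K(1,2), where B = B])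
    have "v \<in> borel_measurable (lebesgue_on K)"
      using v K(1,2) unfolding locally_integrable_def by (metis borel_measurable_integrable)
    moreover have "\<psi> \<in> borel_measurable (lebesgue_on K)"
      by (rule continuous_on_borel_measurable_lebesgue_on[OF K(3)])
    ultimately show "(\<lambda>x. \<psi> x *\<^sub>R v x) \<in> borel_measurable (lebesgue_on K)" by measurable
  qed (use K in \<open>auto intro!: mult_right_mono\<close>)
qed

lemma integrable_mult_grad_test:
  fixes v :: "'a::euclidean_space \<Rightarrow> real"
  assumes v: "locally_integrable \<Omega> v" and \<Omega>: "open \<Omega>" and \<psi>: "\<psi> \<in> test_functions \<Omega>"
  shows "integrable (lebesgue_on \<Omega>) (\<lambda>x. v x *\<^sub>R grad \<psi> x)"
proof -
  obtain K B where K: "compact K" "K \<subseteq> \<Omega>" "continuous_on UNIV (grad \<psi>)"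
     "\<And>x. x \<notin> K \<Longrightarrow> grad \<psi> x = 0" "\<And>x. norm (grad \<psi> x) \<le> B"
    using test_function_facts[OF \<psi>] by metis
  show ?thesis
  proof (rule locally_integrable_mult_supported[OF v \<Omega> K(1,2), where B = B])
    have "v \<in> borel_measurable (lebesgue_on K)"
      using v K(1,2) unfolding locally_integrable_def by (metis borel_measurable_integrable)
    moreover have "grad \<psi> \<in> borel_measurable (lebesgue_on K)"
      by (rule continuous_on_borel_measurable_lebesgue_on[OF K(3)])
    ultimately show "(\<lambda>x. v x *\<^sub>R grad \<psi> x) \<in> borel_measurable (lebesgue_on K)" by measurable
  qed (use K in \<open>auto intro!: mult_left_mono simp: mult.commute[of B]\<close>)
qed

lemma box_test_function:
  fixes a b :: "'a::euclidean_space"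
  assumes "cbox a b \<subseteq> \<Omega>" "0 < c"
  defines "\<psi> \<equiv> \<lambda>x. \<Prod>i\<in>Basis. flat_step 0 (c * (x \<bullet> i - a \<bullet> i)) * flat_step 0 (c * (b \<bullet> i - x \<bullet> i))"
  shows "\<psi> \<in> test_functions \<Omega>"
proof -
  have "C_diff k (\<lambda>x. \<Prod>i\<in>Basis. flat_step 0 (x \<bullet> (c *\<^sub>R i) + (- (c * (a \<bullet> i))))
      * flat_step 0 (x \<bullet> ((- c) *\<^sub>R i) + c * (b \<bullet> i)))" for k
    by (intro C_diff_prod C_diff_mult C_diff_flat_step)
  then have "C_diff k \<psi>" for k
    unfolding \<psi>_def by (simp add: algebra_simps)
  moreover have "{x. \<psi> x \<noteq> 0} \<subseteq> box a b"
    using assms(2) by (auto simp: \<psi>_def flat_step_def mem_box zero_less_mult_iff split: if_splits)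
  then have "{x. \<psi> x \<noteq> 0} \<subseteq> cbox a b"
    using box_subset_cbox by blast
  then have "closure {x. \<psi> x \<noteq> 0} \<subseteq> cbox a b"
    by (intro closure_minimal) auto
  moreover from this have "compact (closure {x. \<psi> x \<noteq> 0})"
    by (meson bounded_cbox bounded_subset closed_closure compact_eq_bounded_closed)
  ultimately show ?thesis
    using assms(1) by (auto simp: test_functions_def)
qed

lemma flat_step_0_tendsto_indicator:
  "(\<lambda>n. flat_step 0 (real (Suc n) * t)) \<longlonglongrightarrow> (if 0 < t then 1 else 0)"
proof (cases "0 < t")
  case True
  have "(\<lambda>n. exp (- (inverse (real (Suc n)) * (1 / t)))) \<longlonglongrightarrow> exp (- (0 * (1 / t)))"
    by (intro tendsto_intros LIMSEQ_inverse_real_of_nat)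
  with True show ?thesis
    by (simp add: flat_step_def divide_inverse)
next
  case False
  then show ?thesis
    by (auto simp: flat_step_def zero_less_mult_iff)
qed

lemma flat_step_0_bounds: "0 \<le> flat_step 0 t" "flat_step 0 t \<le> 1"
  by (auto simp: flat_step_def)

lemma box_integral_zero:
  fixes v :: "'a::euclidean_space \<Rightarrow> 'b::euclidean_space"
  assumes v: "locally_integrable \<Omega> v" and \<Omega>: "open \<Omega>"
    and zero: "\<And>\<psi>. \<psi> \<in> test_functions \<Omega> \<Longrightarrow> (\<integral>x. \<psi> x *\<^sub>R v x \<partial>lebesgue_on \<Omega>) = 0"
    and ab: "cbox a b \<subseteq> \<Omega>"
  shows "(\<integral>x. indicat_real (box a b) x *\<^sub>R v x \<partial>lebesgue_on \<Omega>) = 0"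
proof -
  define \<psi> where "\<psi> n x = (\<Prod>i\<in>Basis. flat_step 0 (real (Suc n) * (x \<bullet> i - a \<bullet> i))
      * flat_step 0 (real (Suc n) * (b \<bullet> i - x \<bullet> i)))" for n and x :: 'a
  have test: "\<psi> n \<in> test_functions \<Omega>" for n
    using box_test_function[OF ab, of "real (Suc n)"] by (simp add: \<psi>_def[abs_def])
  have lim: "(\<lambda>n. \<psi> n x) \<longlonglongrightarrow> indicat_real (box a b) x" for x
  proof -
    have "(\<lambda>n. \<psi> n x) \<longlonglongrightarrow> (\<Prod>i\<in>Basis. (if 0 < x \<bullet> i - a \<bullet> i then 1 else 0)
        * (if 0 < b \<bullet> i - x \<bullet> i then 1 else 0))"
      unfolding \<psi>_def by (intro tendsto_intros flat_step_0_tendsto_indicator)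
    also have "(\<Prod>i\<in>Basis. (if 0 < x \<bullet> i - a \<bullet> i then 1 else 0)
        * (if 0 < b \<bullet> i - x \<bullet> i then 1 else (0::real))) = indicat_real (box a b) x"
    proof (cases "x \<in> box a b")
      case False
      then obtain i where "i \<in> Basis" "\<not> (a \<bullet> i < x \<bullet> i \<and> x \<bullet> i < b \<bullet> i)"
        by (auto simp: mem_box)
      with False show ?thesis by (auto intro!: prod_zero bexI[of _ i])
    qed (auto simp: mem_box)
    finally show ?thesis .
  qed
  have le: "\<psi> n x \<le> indicat_real (box a b) x" "0 \<le> \<psi> n x" for n x
  proof -
    show nn: "0 \<le> \<psi> n x" unfolding \<psi>_def by (intro prod_nonneg mult_nonneg_nonneg flat_step_0_bounds)
    have "\<psi> n x \<le> 1" unfolding \<psi>_def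
      by (intro prod_le_1 conjI mult_le_one mult_nonneg_nonneg flat_step_0_bounds)
    moreover have "\<psi> n x = 0" if nb: "x \<notin> box a b"
    proof -
      obtain i where "i \<in> Basis" "\<not> (a \<bullet> i < x \<bullet> i \<and> x \<bullet> i < b \<bullet> i)"
        using nb unfolding mem_box by blast
      then show ?thesis unfolding \<psi>_def
        by (auto intro!: prod_zero bexI[of _ i] simp: flat_step_def zero_less_mult_iff)
    qed
    ultimately show "\<psi> n x \<le> indicat_real (box a b) x" by (auto simp: indicator_def)
  qed
  \<comment> \<open>The majorant for dominated convergence is cut off at the closed box, because
    \<open>v\<close> is known to be integrable on compact sets only.\<close>
  have int: "integrable (lebesgue_on \<Omega>) (\<lambda>x. indicat_real (cbox a b) x *\<^sub>R v x)"
  proof (rule locally_integrable_mult_supported[OF v \<Omega> compact_cbox ab, where B = 1])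
    have "v \<in> borel_measurable (lebesgue_on (cbox a b))"
      using v ab compact_cbox unfolding locally_integrable_def by (metis borel_measurable_integrable)
    moreover have "indicat_real (cbox a b) \<in> borel_measurable (lebesgue_on (cbox a b))"
      by (intro measurable_restrict_space1 borel_measurable_indicator) auto
    ultimately show "(\<lambda>x. indicat_real (cbox a b) x *\<^sub>R v x) \<in> borel_measurable (lebesgue_on (cbox a b))"
      by measurable
  qed auto
  have meas: "(\<lambda>x. indicat_real (box a b) x *\<^sub>R v x) \<in> borel_measurable (lebesgue_on \<Omega>)"
  proof -
    have "indicat_real (box a b) \<in> borel_measurable (lebesgue_on \<Omega>)"
      by (intro measurable_restrict_space1 borel_measurable_indicator) auto
    with int have "(\<lambda>x. indicat_real (box a b) x *\<^sub>R indicat_real (cbox a b) x *\<^sub>R v x)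
        \<in> borel_measurable (lebesgue_on \<Omega>)" by measurable
    also have "(\<lambda>x. indicat_real (box a b) x *\<^sub>R indicat_real (cbox a b) x *\<^sub>R v x)
        = (\<lambda>x. indicat_real (box a b) x *\<^sub>R v x)"
      using box_subset_cbox[of a b] by (auto simp: indicator_def fun_eq_iff)
    finally show ?thesis .
  qed
  have "(\<lambda>n. \<integral>x. \<psi> n x *\<^sub>R v x \<partial>lebesgue_on \<Omega>)
      \<longlonglongrightarrow> (\<integral>x. indicat_real (box a b) x *\<^sub>R v x \<partial>lebesgue_on \<Omega>)"
  proof (rule integral_dominated_convergence)
    show "integrable (lebesgue_on \<Omega>) (\<lambda>x. norm (indicat_real (cbox a b) x *\<^sub>R v x))"
      using int by (rule integrable_norm)
    show "(\<lambda>x. \<psi> n x *\<^sub>R v x) \<in> borel_measurable (lebesgue_on \<Omega>)" for n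
      using integrable_test_mult[OF v \<Omega> test] by auto
    show "AE x in lebesgue_on \<Omega>. norm (\<psi> n x *\<^sub>R v x) \<le> norm (indicat_real (cbox a b) x *\<^sub>R v x)" for n
    proof (rule AE_I2)
      fix x
      have "indicat_real (box a b) x \<le> indicat_real (cbox a b) x"
        using box_subset_cbox[of a b] by (auto simp: indicator_def)
      with le[of n x] have "\<bar>\<psi> n x\<bar> \<le> indicat_real (cbox a b) x" by linarith
      then show "norm (\<psi> n x *\<^sub>R v x) \<le> norm (indicat_real (cbox a b) x *\<^sub>R v x)"
        by (simp add: mult_right_mono)
    qed
  qed (use meas lim in \<open>auto intro!: AE_I2 tendsto_intros\<close>)
  then show ?thesis by (simp add: zero[OF test] LIMSEQ_const_iff)
qed

lemma sigma_finite_measure_lebesgue: "sigma_finite_measure lebesgue"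
proof
  obtain A :: "'a set set" where "countable A" "A \<subseteq> sets lborel" "\<Union>A = space lborel"
    "\<forall>a\<in>A. emeasure lborel a \<noteq> \<infinity>"
    using lborel.sigma_finite_countable by blast
  then show "\<exists>A::'a set set. countable A \<and> A \<subseteq> sets lebesgue \<and> \<Union>A = space lebesgue
      \<and> (\<forall>a\<in>A. emeasure lebesgue a \<noteq> \<infinity>)"
    by (intro exI[of _ A]) (auto simp: subset_iff)
qed

section \<open>Uniqueness of weak gradients and divergences\<close>

text \<open>Open boxes are closed under intersection and generate the Borel sets, so Dynkin's
  argument extends the vanishing of the integrals to all Borel sets. Support in one box makes the
  integral over the whole space a box integral, which the complement step needs.\<close>

lemma AE_zero_if_box_integrals_zero:
  fixes w :: "'a::euclidean_space \<Rightarrow> 'b::euclidean_space"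
  assumes int: "integrable lebesgue w" and supp: "\<And>x. x \<notin> box c e \<Longrightarrow> w x = 0"
    and box: "\<And>a b. set_lebesgue_integral lebesgue (box a b) w = 0"
  shows "AE x in lebesgue. w x = 0"
proof (rule sigma_finite_measure.density_zero[OF sigma_finite_measure_lebesgue int])
  have total: "integral\<^sup>L lebesgue w = 0"
  proof -
    have "(\<lambda>x. indicat_real (box c e) x *\<^sub>R w x) = w"
      using supp by (auto simp: indicator_def fun_eq_iff)
    then show ?thesis using box[of c e] by (simp add: set_lebesgue_integral_def)
  qed
  have si: "set_integrable lebesgue A w" if "A \<in> sets lebesgue" for A
    using int that unfolding set_integrable_def by (rule integrable_mult_indicator[rotated])
  let ?E = "range (\<lambda>(a, b). box a b::'a set)"
  have borel: "set_lebesgue_integral lebesgue A w = 0" if A: "A \<in> sets borel" for A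
  proof -
    have "Int_stable ?E"
      by (auto simp: Int_stable_def box_Int_box)
    moreover have "?E \<subseteq> Pow UNIV" by auto
    moreover have "A \<in> sigma_sets UNIV ?E" using A by (simp add: borel_eq_box)
    ultimately show ?thesis
    proof (induction rule: sigma_sets_induct_disjoint)
      case (basic A)
      then show ?case using box by auto
    next
      case empty
      show ?case by (simp add: set_lebesgue_integral_def)
    next
      case (compl A)
      then have A: "A \<in> sets lebesgue" by (metis borel_eq_box sets_completionI_sets sets_lborel sets_measure_of Pow_UNIV subset_UNIV)
      have "(\<lambda>x. indicat_real (UNIV - A) x *\<^sub>R w x) = (\<lambda>x. w x - indicat_real A x *\<^sub>R w x)"
        by (auto simp: indicator_def)
      then show ?case
        using compl.IH si[OF A] int total
        by (simp add: set_lebesgue_integral_def set_integrable_def)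
    next
      case (union A)
      have A: "A i \<in> sets lebesgue" for i
      proof -
        have "A i \<in> sets borel" using union.hyps(2) by (auto simp: borel_eq_box)
        then show ?thesis by simp
      qed
      have "set_lebesgue_integral lebesgue (\<Union>i. A i) w = (\<Sum>i. set_lebesgue_integral lebesgue (A i) w)"
      proof (rule lebesgue_integral_countable_add[OF A])
        show "A i \<inter> A j = {}" if "i \<noteq> j" for i j
          using union.hyps(1) that by (simp add: disjoint_family_on_def)
        show "set_integrable lebesgue (\<Union>i. A i) w"
          using A by (intro si) auto
      qed
      with union.IH show ?case by simp
    qed
  qed
  show "set_lebesgue_integral lebesgue A w = 0" if A: "A \<in> sets lebesgue" for A
  proof -
    \<comment> \<open>A Lebesgue set differs from a Borel set by a null set, which no integral
      sees.\<close>
    obtain S N N' where S: "A = S \<union> N" "N \<subseteq> N'" "N' \<in> null_sets lborel" "S \<in> sets lborel"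
      using A by (rule sets_completionE)
    have "AE x in lebesgue. x \<notin> N'"
      using S(3) by (intro AE_not_in null_sets_completionI)
    then have "AE x in lebesgue. indicat_real A x *\<^sub>R w x = indicat_real S x *\<^sub>R w x"
      by eventually_elim (use S in \<open>auto simp: indicator_def\<close>)
    moreover have "S \<in> sets lebesgue" using S(4) by simp
    ultimately have "set_lebesgue_integral lebesgue A w = set_lebesgue_integral lebesgue S w"
      unfolding set_lebesgue_integral_def using si[of A] si[of S] A
      by (intro integral_cong_AE) (auto simp: set_integrable_def)
    with borel S(4) show ?thesis by simp
  qed
qed

text \<open>Localization: countably many closed boxes fill \<Omega>. On each of them
  \<open>v\<close> is cut off at the open box; since boxes meet in boxes, all box integrals of the
  result reduce to integrals covered by \<open>box_integral_zero\<close>. The faces lost in passing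
  to the open box are null.\<close>

theorem fundamental_lemma_variations:
  fixes v :: "'a::euclidean_space \<Rightarrow> 'b::euclidean_space"
  assumes v: "locally_integrable \<Omega> v" and \<Omega>: "open \<Omega>"
    and zero: "\<And>\<psi>. \<psi> \<in> test_functions \<Omega> \<Longrightarrow> (\<integral>x. \<psi> x *\<^sub>R v x \<partial>lebesgue_on \<Omega>) = 0"
  shows "AE x in lebesgue_on \<Omega>. v x = 0"
proof -
  have \<Omega>m: "\<Omega> \<inter> space lebesgue \<in> sets lebesgue" using \<Omega> by auto
  have cbox: "AE x in lebesgue. x \<in> cbox c e \<longrightarrow> v x = 0" if ce: "cbox c e \<subseteq> \<Omega>" for c e
  proof -
    define w where "w x = indicat_real (box c e) x *\<^sub>R v x" for x
    have "integrable (lebesgue_on (cbox c e)) v"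
      using v ce compact_cbox unfolding locally_integrable_def by blast
    then have "integrable lebesgue (\<lambda>x. indicat_real (cbox c e) x *\<^sub>R v x)"
      by (subst (asm) integrable_restrict_space) auto
    then have "integrable lebesgue (\<lambda>x. indicat_real (box c e) x *\<^sub>R indicat_real (cbox c e) x *\<^sub>R v x)"
      by (rule integrable_mult_indicator[rotated]) simp
    also have "(\<lambda>x. indicat_real (box c e) x *\<^sub>R indicat_real (cbox c e) x *\<^sub>R v x) = w"
      using box_subset_cbox[of c e] by (auto simp: w_def indicator_def fun_eq_iff)
    finally have int: "integrable lebesgue w" .
    have "AE x in lebesgue. w x = 0"
    proof (rule AE_zero_if_box_integrals_zero[OF int])
      show "w x = 0" if "x \<notin> box c e" for x using that by (simp add: w_def)
      show "set_lebesgue_integral lebesgue (box a b) w = 0" for a b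
      proof -
        obtain p q where pq: "box a b \<inter> box c e = box p q" "cbox a b \<inter> cbox c e = cbox p q"
          using box_Int_box[of a b c e] Int_interval[of a b c e] by blast
        have sub: "cbox p q \<subseteq> \<Omega>" using pq(2) ce by blast
        have "set_lebesgue_integral lebesgue (box a b) w
            = (\<integral>x. indicat_real \<Omega> x *\<^sub>R indicat_real (box p q) x *\<^sub>R v x \<partial>lebesgue)"
          unfolding set_lebesgue_integral_def
        proof (rule Bochner_Integration.integral_cong[OF refl])
          fix x
          show "indicat_real (box a b) x *\<^sub>R w x
              = indicat_real \<Omega> x *\<^sub>R indicat_real (box p q) x *\<^sub>R v x"
            using sub box_subset_cbox[of p q]
            unfolding w_def pq(1)[symmetric] by (auto simp: indicator_def)
        qed
        also have "\<dots> = (\<integral>x. indicat_real (box p q) x *\<^sub>R v x \<partial>lebesgue_on \<Omega>)"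
          by (rule integral_restrict_space[OF \<Omega>m, symmetric])
        also have "\<dots> = 0"
          by (rule box_integral_zero[OF v \<Omega> zero sub])
        finally show ?thesis .
      qed
    qed
    moreover have "AE x in lebesgue. x \<notin> cbox c e - box c e"
      using negligible_frontier_interval[of c e] by (intro AE_not_in) (simp add: negligible_iff_null_sets)
    ultimately show ?thesis
      by eventually_elim (auto simp: w_def indicator_def split: if_splits)
  qed
  obtain D where D: "countable D" "D \<subseteq> Pow \<Omega>" "\<And>X. X \<in> D \<Longrightarrow> \<exists>a b. X = cbox a b" "\<Union>D = \<Omega>"
    by (rule open_countable_Union_open_cbox[OF \<Omega>]) blast
  have "AE x in lebesgue. \<forall>X\<in>D. x \<in> X \<longrightarrow> v x = 0"
    using D(1)
  proof (rule AE_ball_countable[THEN iffD2], intro ballI)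
    fix X assume X: "X \<in> D"
    then obtain a b where "X = cbox a b" using D(3) by blast
    with cbox[of a b] X D(2) show "AE x in lebesgue. x \<in> X \<longrightarrow> v x = 0" by blast
  qed
  then show ?thesis
    using D(4) by (subst AE_restrict_space_iff[OF \<Omega>m]) (auto elim!: eventually_mono)
qed

text \<open>Completeness of Lebesgue measure. It transfers measurability to the representatives
  picked by \<open>SOME\<close>, which are only known almost everywhere.\<close>

lemma borel_measurable_lebesgue_on_AE:
  fixes f :: "'a::euclidean_space \<Rightarrow> 'b::euclidean_space"
  assumes S: "S \<in> sets lebesgue" and f: "f \<in> borel_measurable (lebesgue_on S)"
    and ae: "AE x in lebesgue_on S. f x = g x"
  shows "g \<in> borel_measurable (lebesgue_on S)"
proof -
  have "AE x in lebesgue. x \<in> S \<longrightarrow> f x = g x"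
    using ae S by (subst (asm) AE_restrict_space_iff) auto
  then have "AE x in lebesgue. (if x \<in> S then f x else 0) = (if x \<in> S then g x else 0)"
    by eventually_elim auto
  from borel_measurable_AE[OF borel_measurable_if_I[OF f S] this] show ?thesis
    by (rule borel_measurable_if_D)
qed

lemma locally_integrable_diff:
  "locally_integrable \<Omega> f \<Longrightarrow> locally_integrable \<Omega> g \<Longrightarrow> locally_integrable \<Omega> (\<lambda>x. f x - g x)"
  by (simp add: locally_integrable_def)

lemma integrable_imp_locally_integrable:
  fixes f :: "'a::euclidean_space \<Rightarrow> 'b::euclidean_space"
  assumes "integrable (lebesgue_on \<Omega>) f" "open \<Omega>"
  shows "locally_integrable \<Omega> f"
  unfolding locally_integrable_def
proof (intro allI impI)
  fix K assume K: "compact K \<and> K \<subseteq> \<Omega>"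
  then have Km: "K \<in> sets lebesgue" by (auto intro: fmeasurableD lmeasurable_compact)
  have "integrable lebesgue (\<lambda>x. indicat_real K x *\<^sub>R indicat_real \<Omega> x *\<^sub>R f x)"
  proof (rule integrable_mult_indicator[OF Km])
    show "integrable lebesgue (\<lambda>x. indicat_real \<Omega> x *\<^sub>R f x)"
      using assms by (subst (asm) integrable_restrict_space) auto
  qed
  also have "(\<lambda>x. indicat_real K x *\<^sub>R indicat_real \<Omega> x *\<^sub>R f x) = (\<lambda>x. indicat_real K x *\<^sub>R f x)"
    using K by (auto simp: indicator_def fun_eq_iff)
  finally show "integrable (lebesgue_on K) f"
    using Km by (subst integrable_restrict_space) auto
qed

lemma weak_gradient_unique:
  assumes "open \<Omega>" and g: "has_weak_gradient \<Omega> u g" and h: "has_weak_gradient \<Omega> u h"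
  shows "AE x in lebesgue_on \<Omega>. g x = h x"
proof -
  have loc: "locally_integrable \<Omega> g" "locally_integrable \<Omega> h"
    using g h by (auto simp: has_weak_gradient_def)
  have "AE x in lebesgue_on \<Omega>. g x - h x = 0"
  proof (rule fundamental_lemma_variations[OF locally_integrable_diff[OF loc] \<open>open \<Omega>\<close>])
    fix \<psi> assume \<psi>: "\<psi> \<in> test_functions \<Omega>"
    have "(\<integral>x. \<psi> x *\<^sub>R g x \<partial>lebesgue_on \<Omega>) = (\<integral>x. \<psi> x *\<^sub>R h x \<partial>lebesgue_on \<Omega>)"
      using g h \<psi> by (simp add: has_weak_gradient_def)
    then show "(\<integral>x. \<psi> x *\<^sub>R (g x - h x) \<partial>lebesgue_on \<Omega>) = 0"
      using integrable_test_mult[OF loc(1) \<open>open \<Omega>\<close> \<psi>] integrable_test_mult[OF loc(2) \<open>open \<Omega>\<close> \<psi>]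
      by (simp add: scaleR_diff_right)
  qed
  then show ?thesis by eventually_elim simp
qed

lemma weak_divergence_unique:
  assumes "open \<Omega>" and g: "has_weak_divergence \<Omega> p g" and h: "has_weak_divergence \<Omega> p h"
  shows "AE x in lebesgue_on \<Omega>. g x = h x"
proof -
  have loc: "locally_integrable \<Omega> g" "locally_integrable \<Omega> h"
    using g h by (auto simp: has_weak_divergence_def)
  have "AE x in lebesgue_on \<Omega>. g x - h x = 0"
  proof (rule fundamental_lemma_variations[OF locally_integrable_diff[OF loc] \<open>open \<Omega>\<close>])
    fix \<psi> assume \<psi>: "\<psi> \<in> test_functions \<Omega>"
    have "(\<integral>x. g x * \<psi> x \<partial>lebesgue_on \<Omega>) = (\<integral>x. h x * \<psi> x \<partial>lebesgue_on \<Omega>)"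
      using g h \<psi> by (simp add: has_weak_divergence_def)
    then show "(\<integral>x. \<psi> x *\<^sub>R (g x - h x) \<partial>lebesgue_on \<Omega>) = 0"
      using integrable_test_mult[OF loc(1) \<open>open \<Omega>\<close> \<psi>] integrable_test_mult[OF loc(2) \<open>open \<Omega>\<close> \<psi>]
      by (simp add: right_diff_distrib mult.commute)
  qed
  then show ?thesis by eventually_elim simp
qed

text \<open>By uniqueness the representative picked by \<open>SOME\<close> may be exchanged for any
  convenient one.\<close>

lemma weak_gradient_eq_AE:
  assumes "open \<Omega>" "has_weak_gradient \<Omega> u g"
  shows "AE x in lebesgue_on \<Omega>. weak_gradient \<Omega> u x = g x"
proof -
  have "has_weak_gradient \<Omega> u (weak_gradient \<Omega> u)"
    unfolding weak_gradient_def by (rule someI[of "has_weak_gradient \<Omega> u", OF assms(2)])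
  from weak_gradient_unique[OF assms(1) this assms(2)] show ?thesis .
qed

lemma weak_divergence_eq_AE:
  assumes "open \<Omega>" "has_weak_divergence \<Omega> p d"
  shows "AE x in lebesgue_on \<Omega>. weak_divergence \<Omega> p x = d x"
proof -
  have "has_weak_divergence \<Omega> p (weak_divergence \<Omega> p)"
    unfolding weak_divergence_def by (rule someI[of "has_weak_divergence \<Omega> p", OF assms(2)])
  from weak_divergence_unique[OF assms(1) this assms(2)] show ?thesis .
qed

section \<open>Almost everywhere convergence from a strictly convex functional\<close>

text \<open>This strictly convex function of linear growth replaces weak compactness: two near-minimizers of
  \<open>\<integral> bracket (p x)\<close> over a convex set have a small integrated midpoint gap, which controls
  \<open>\<integral> sqrt (norm (p x - q x))\<close>.\<close>

definition bracket :: "'b::real_inner \<Rightarrow> real" where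
  "bracket z = sqrt (1 + (norm z)\<^sup>2)"

definition bracket_gap :: "'b::real_inner \<Rightarrow> 'b \<Rightarrow> real" where
  "bracket_gap a b = (bracket a + bracket b) / 2 - bracket ((1/2) *\<^sub>R (a + b))"

lemma bracket_bounds: "1 \<le> bracket z" "norm z \<le> bracket z" "bracket z \<le> 1 + norm z"
proof -
  show "1 \<le> bracket z" "norm z \<le> bracket z"
    by (auto simp: bracket_def intro: real_le_rsqrt)
  show "bracket z \<le> 1 + norm z"
    unfolding bracket_def by (rule real_le_lsqrt) (auto simp: power2_eq_square algebra_simps)
qed

lemma bracket_squared: "(bracket z)\<^sup>2 = 1 + (norm z)\<^sup>2"
  by (simp add: bracket_def)

lemma borel_measurable_bracket [measurable]: "bracket \<in> borel_measurable borel"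
  unfolding bracket_def by measurable

text \<open>Strict convexity with a rate. Write \<open>A\<close>, \<open>B\<close>, \<open>m\<close>
  for the brackets at the ends and at the midpoint, and \<open>d\<close> for the distance. The
  parallelogram law turns the gap times \<open>(A + B) / 2 + m\<close> into
  \<open>(d\<^sup>2 - (A - B)\<^sup>2) / 4\<close>, so it remains to see that
  \<open>(A - B)\<^sup>2\<close> falls short of \<open>d\<^sup>2\<close> by at least
  \<open>2 * d\<^sup>2 / (A + B)\<^sup>2\<close>.\<close>

lemma bracket_gap_lower_bound:
  fixes a b :: "'b::real_inner"
  shows "(norm (a - b))\<^sup>2 \<le> 2 * bracket_gap a b * (bracket a + bracket b) ^ 3" "0 \<le> bracket_gap a b"
proof -
  define A B m d \<alpha> \<beta> where "A = bracket a" "B = bracket b" "m = bracket ((1/2) *\<^sub>R (a + b))" "d = norm (a - b)"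
    "\<alpha> = norm a" "\<beta> = norm b"
  note defs = this
  have bounds: "1 \<le> A" "1 \<le> B" "1 \<le> m" "0 \<le> d" "0 \<le> \<alpha>" "0 \<le> \<beta>" "\<alpha> \<le> A" "\<beta> \<le> B"
    using bracket_bounds by (auto simp: defs)
  have sq: "A\<^sup>2 = 1 + \<alpha>\<^sup>2" "B\<^sup>2 = 1 + \<beta>\<^sup>2" by (auto simp: defs bracket_squared)
  have "(norm (a + b))\<^sup>2 = 2 * \<alpha>\<^sup>2 + 2 * \<beta>\<^sup>2 - d\<^sup>2"
    by (simp add: defs power2_norm_eq_inner inner_simps inner_commute algebra_simps)
  then have m2: "m\<^sup>2 = (A\<^sup>2 + B\<^sup>2) / 2 - d\<^sup>2 / 4"
    unfolding defs(3) bracket_squared norm_scaleR power_mult_distrib sq by (simp add: power2_eq_square field_simps)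
  have "\<bar>\<alpha> - \<beta>\<bar> \<le> d" by (simp add: defs norm_triangle_ineq3)
  then have ab: "(\<alpha> - \<beta>)\<^sup>2 \<le> d\<^sup>2" by (simp add: abs_le_square_iff[symmetric] bounds)
  have AB: "(A - B) * (A + B) = (\<alpha> - \<beta>) * (\<alpha> + \<beta>)"
    using sq by (simp add: algebra_simps power2_eq_square)
  \<comment> \<open>The \<open>- 2\<close> obtained from this comes from the \<open>1\<close> under
    the root of \<open>bracket\<close>; without it the final estimate would only say that the gap is
    nonnegative.\<close>
  have "\<alpha> * \<beta> \<le> A * B" using bounds by (intro mult_mono) auto
  then have S: "(\<alpha> + \<beta>)\<^sup>2 \<le> (A + B)\<^sup>2 - 2"
    using sq by (simp add: power2_eq_square algebra_simps)
  have "((A - B) * (A + B))\<^sup>2 \<le> d\<^sup>2 * ((A + B)\<^sup>2 - 2)"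
    unfolding AB power_mult_distrib using ab S by (intro mult_mono) auto
  then have key: "2 * d\<^sup>2 \<le> (d\<^sup>2 - (A - B)\<^sup>2) * (A + B)\<^sup>2"
    unfolding power_mult_distrib by (simp only: left_diff_distrib right_diff_distrib)
  define g where "g = (A + B) / 2 - m"
  have g: "g * ((A + B) / 2 + m) = (d\<^sup>2 - (A - B)\<^sup>2) / 4"
    using m2 by (simp add: g_def power2_eq_square field_simps)
  have "0 \<le> (d\<^sup>2 - (A - B)\<^sup>2) * (A + B)\<^sup>2" using key by (smt (verit) zero_le_power2)
  then have "0 \<le> d\<^sup>2 - (A - B)\<^sup>2" using bounds by (simp add: zero_le_mult_iff)
  then have "0 \<le> g * ((A + B) / 2 + m)" using g by simp
  moreover have "0 < (A + B) / 2 + m" using bounds by argo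
  ultimately have g0: "0 \<le> g" by (metis mult_neg_pos not_le)
  then show "0 \<le> bracket_gap a b" by (simp add: bracket_gap_def g_def defs)
  have "(d\<^sup>2 - (A - B)\<^sup>2) / 4 \<le> g * (A + B)"
    using g0 unfolding g[symmetric] by (intro mult_left_mono) (auto simp: g_def field_simps)
  then have "(d\<^sup>2 - (A - B)\<^sup>2) / 4 * (A + B)\<^sup>2 \<le> g * (A + B) * (A + B)\<^sup>2"
    by (intro mult_right_mono) auto
  with key have "d\<^sup>2 \<le> 2 * g * (A + B) ^ 3"
    by (simp add: power3_eq_cube power2_eq_square algebra_simps)
  then show "(norm (a - b))\<^sup>2 \<le> 2 * bracket_gap a b * (bracket a + bracket b) ^ 3"
    by (simp add: bracket_gap_def g_def defs)
qed

text \<open>A weighted Young inequality for \<open>s ^ 4 \<le> x * y ^ 3\<close>: either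
  \<open>s \<le> \<tau> * y\<close>, or \<open>y\<close> is smaller than \<open>s / \<tau>\<close>
  and cancelling \<open>s ^ 3\<close> leaves \<open>s \<le> x / \<tau> ^ 3\<close>. Taking the
  square root of the distance makes the bound linear in the gap and in the brackets, so it can be
  integrated.\<close>

lemma sqrt_dist_le_bracket_gap:
  fixes a b :: "'b::real_inner"
  assumes "0 < \<tau>"
  shows "sqrt (norm (a - b)) \<le> \<tau> * (bracket a + bracket b) + 2 * bracket_gap a b / \<tau> ^ 3"
proof -
  define s x y where "s = sqrt (norm (a - b))" "x = 2 * bracket_gap a b" "y = bracket a + bracket b"
  note defs = this
  have nn: "0 \<le> s" "0 \<le> x" "0 \<le> y"
    using bracket_gap_lower_bound(2)[of a b] bracket_bounds(1)[of a] bracket_bounds(1)[of b] by (auto simp: defs)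
  have "s ^ 4 = (s\<^sup>2)\<^sup>2" by (simp flip: power_mult)
  also have "\<dots> = (norm (a - b))\<^sup>2" by (simp add: defs)
  also have "\<dots> \<le> x * y ^ 3" using bracket_gap_lower_bound(1)[of a b] by (simp add: defs)
  finally have s4: "s ^ 4 \<le> x * y ^ 3" .
  show ?thesis
  proof (cases "s \<le> \<tau> * y")
    case True
    with nn assms show ?thesis by (simp add: defs[symmetric] add_increasing2)
  next
    case False
    then have "0 < s" using nn assms by (smt (verit) mult_nonneg_nonneg)
    have "x * (\<tau> * y) ^ 3 \<le> x * s ^ 3"
      using False nn assms by (intro mult_left_mono power_mono) auto
    moreover have "s * s ^ 3 * \<tau> ^ 3 \<le> x * y ^ 3 * \<tau> ^ 3"
      using s4 assms by (intro mult_right_mono) (auto simp: power_Suc[symmetric] simp del: power_Suc)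
    ultimately have "(s * \<tau> ^ 3) * s ^ 3 \<le> x * s ^ 3"
      by (simp add: power_mult_distrib algebra_simps)
    then have "s * \<tau> ^ 3 \<le> x" using \<open>0 < s\<close> by simp
    then have "s \<le> x / \<tau> ^ 3" using assms by (simp add: pos_le_divide_eq)
    moreover have "0 \<le> \<tau> * y" using nn assms by simp
    ultimately show ?thesis by (simp add: defs)
  qed
qed

lemma summable_of_summable_sqrt:
  fixes z :: "nat \<Rightarrow> 'b::banach"
  assumes "summable (\<lambda>k. sqrt (norm (z k)))"
  shows "summable z"
proof (rule summable_comparison_test_ev[OF _ assms])
  have "\<forall>\<^sub>F k in sequentially. sqrt (norm (z k)) < 1"
    using summable_LIMSEQ_zero[OF assms] by (rule order_tendstoD) simp
  then show "\<forall>\<^sub>F k in sequentially. norm (z k) \<le> sqrt (norm (z k))"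
  proof eventually_elim
    case (elim k)
    then have "sqrt (norm (z k)) * sqrt (norm (z k)) \<le> sqrt (norm (z k)) * 1"
      by (intro mult_left_mono) auto
    then show ?case by simp
  qed
qed

context
  fixes M :: "'a measure" and B :: real
begin

lemma integral_sqrt_dist_le:
  fixes a b :: "'a \<Rightarrow> 'b::euclidean_space"
  assumes [measurable]: "a \<in> borel_measurable M" "b \<in> borel_measurable M"
    and a: "integrable M (\<lambda>x. bracket (a x))" "(\<integral>x. bracket (a x) \<partial>M) \<le> B"
    and b: "integrable M (\<lambda>x. bracket (b x))" "(\<integral>x. bracket (b x) \<partial>M) \<le> B"
  shows "integrable M (\<lambda>x. bracket_gap (a x) (b x))"
    and "integrable M (\<lambda>x. sqrt (norm (a x - b x)))"
    and "\<And>\<tau>. 0 < \<tau> \<Longrightarrow> (\<integral>x. sqrt (norm (a x - b x)) \<partial>M)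
            \<le> 2 * \<tau> * B + 2 * (\<integral>x. bracket_gap (a x) (b x) \<partial>M) / \<tau> ^ 3"
proof -
  have gap_le: "bracket_gap u v \<le> (bracket u + bracket v) / 2" for u v :: 'b
    using bracket_bounds(1)[of "(1/2) *\<^sub>R (u + v)"] unfolding bracket_gap_def by linarith
  show gap: "integrable M (\<lambda>x. bracket_gap (a x) (b x))"
  proof (rule Bochner_Integration.integrable_bound)
    show "integrable M (\<lambda>x. (bracket (a x) + bracket (b x)) / 2)" using a b by simp
    show "(\<lambda>x. bracket_gap (a x) (b x)) \<in> borel_measurable M" unfolding bracket_gap_def by measurable
    have "\<bar>bracket_gap u v\<bar> \<le> \<bar>(bracket u + bracket v) / 2\<bar>" for u v :: 'b
      using gap_le[of u v] bracket_gap_lower_bound(2)[of u v] by linarith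
    then show "AE x in M. norm (bracket_gap (a x) (b x)) \<le> norm ((bracket (a x) + bracket (b x)) / 2)"
      by simp
  qed
  have bound: "integrable M (\<lambda>x. \<tau> * (bracket (a x) + bracket (b x)) + 2 * bracket_gap (a x) (b x) / \<tau> ^ 3)" for \<tau>
    using a b gap by auto
  show sq: "integrable M (\<lambda>x. sqrt (norm (a x - b x)))"
    by (rule Bochner_Integration.integrable_bound[OF bound[of 1]])
      (use sqrt_dist_le_bracket_gap[of 1] in \<open>auto intro!: AE_I2 order_trans[OF _ abs_ge_self]\<close>)
  show "(\<integral>x. sqrt (norm (a x - b x)) \<partial>M)
            \<le> 2 * \<tau> * B + 2 * (\<integral>x. bracket_gap (a x) (b x) \<partial>M) / \<tau> ^ 3" if "0 < \<tau>" for \<tau>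
  proof -
    have "(\<integral>x. sqrt (norm (a x - b x)) \<partial>M)
        \<le> (\<integral>x. \<tau> * (bracket (a x) + bracket (b x)) + 2 * bracket_gap (a x) (b x) / \<tau> ^ 3 \<partial>M)"
      by (rule integral_mono[OF sq bound]) (rule sqrt_dist_le_bracket_gap[OF that])
    also have "\<dots> = \<tau> * ((\<integral>x. bracket (a x) \<partial>M) + (\<integral>x. bracket (b x) \<partial>M))
        + 2 * (\<integral>x. bracket_gap (a x) (b x) \<partial>M) / \<tau> ^ 3"
      using a b gap by simp
    also have "\<dots> \<le> \<tau> * (B + B) + 2 * (\<integral>x. bracket_gap (a x) (b x) \<partial>M) / \<tau> ^ 3"
      using a b that by (intro add_right_mono mult_left_mono add_mono) auto
    finally show ?thesis by simp
  qed
qed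

lemma integral_sqrt_dist_small:
  assumes "0 < \<epsilon>"
  obtains \<delta> where "0 < \<delta>"
    "\<And>a b :: 'a \<Rightarrow> 'b::euclidean_space. a \<in> borel_measurable M \<Longrightarrow> b \<in> borel_measurable M \<Longrightarrow>
      integrable M (\<lambda>x. bracket (a x)) \<Longrightarrow> (\<integral>x. bracket (a x) \<partial>M) \<le> B \<Longrightarrow>
      integrable M (\<lambda>x. bracket (b x)) \<Longrightarrow> (\<integral>x. bracket (b x) \<partial>M) \<le> B \<Longrightarrow>
      (\<integral>x. bracket_gap (a x) (b x) \<partial>M) < \<delta> \<Longrightarrow> (\<integral>x. sqrt (norm (a x - b x)) \<partial>M) < \<epsilon>"
proof
  \<comment> \<open>\<tau> makes the bracket term at most \<open>\<epsilon> / 2\<close>, and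
    \<delta> then does the same for the gap term. The \<open>+ 1\<close> keeps the denominator
    positive.\<close>
  define \<tau> where "\<tau> = \<epsilon> / (4 * (\<bar>B\<bar> + 1))"
  define \<delta> where "\<delta> = \<epsilon> * \<tau> ^ 3 / 4"
  have \<tau>: "0 < \<tau>" using assms by (simp add: \<tau>_def)
  show "0 < \<delta>" using assms \<tau> by (simp add: \<delta>_def)
  fix a b :: "'a \<Rightarrow> 'b"
  assume *: "a \<in> borel_measurable M" "b \<in> borel_measurable M"
      "integrable M (\<lambda>x. bracket (a x))" "(\<integral>x. bracket (a x) \<partial>M) \<le> B"
      "integrable M (\<lambda>x. bracket (b x))" "(\<integral>x. bracket (b x) \<partial>M) \<le> B"
    and gap: "(\<integral>x. bracket_gap (a x) (b x) \<partial>M) < \<delta>"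
  have "2 * \<tau> * B \<le> 2 * \<tau> * (\<bar>B\<bar> + 1)" using \<tau> by simp
  also have "\<dots> = \<epsilon> / 2" by (simp add: \<tau>_def field_simps add_nonneg_eq_0_iff)
  finally have 1: "2 * \<tau> * B \<le> \<epsilon> / 2" .
  have "2 * (\<integral>x. bracket_gap (a x) (b x) \<partial>M) / \<tau> ^ 3 < 2 * \<delta> / \<tau> ^ 3"
    using gap \<tau> by (simp add: divide_strict_right_mono)
  also have "\<dots> = \<epsilon> / 2" using \<tau> by (simp add: \<delta>_def)
  finally show "(\<integral>x. sqrt (norm (a x - b x)) \<partial>M) < \<epsilon>"
    using integral_sqrt_dist_le(3)[OF * \<tau>] 1 by linarith
qed

text \<open>As in the completeness proof for \<open>L1\<close>, along a fast subsequence the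
  integrals of the square roots of the increments are summable. So the square roots are summable at
  almost every point, hence the increments are too.\<close>

lemma gap_Cauchy_AE_subsequence:
  fixes w :: "nat \<Rightarrow> 'a \<Rightarrow> 'b::euclidean_space"
  assumes w [measurable]: "\<And>n. w n \<in> borel_measurable M"
    and int: "\<And>n. integrable M (\<lambda>x. bracket (w n x))" "\<And>n. (\<integral>x. bracket (w n x) \<partial>M) \<le> B"
    and Cauchy: "\<And>\<epsilon>. 0 < \<epsilon> \<Longrightarrow> \<exists>N. \<forall>m\<ge>N. \<forall>n\<ge>N. (\<integral>x. bracket_gap (w m x) (w n x) \<partial>M) < \<epsilon>"
  obtains r v where "strict_mono (r :: nat \<Rightarrow> nat)" "v \<in> borel_measurable M"
    "AE x in M. (\<lambda>k. w (r k) x) \<longlonglongrightarrow> v x"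
proof -
  define D where "D m n = (\<integral>x. sqrt (norm (w m x - w n x)) \<partial>M)" for m n
  have "\<exists>N. \<forall>m\<ge>N. \<forall>n\<ge>N. D m n < (1/2) ^ k" for k
  proof -
    obtain \<delta> where "0 < \<delta>" and \<delta>: "\<And>m n. (\<integral>x. bracket_gap (w m x) (w n x) \<partial>M) < \<delta> \<Longrightarrow> D m n < (1/2) ^ k"
    proof (rule integral_sqrt_dist_small[where 'b = 'b and \<epsilon> = "(1/2) ^ k"])
      fix \<delta> :: real
      assume "0 < \<delta>" and \<delta>: "\<And>a b :: 'a \<Rightarrow> 'b. a \<in> borel_measurable M \<Longrightarrow> b \<in> borel_measurable M \<Longrightarrow>
        integrable M (\<lambda>x. bracket (a x)) \<Longrightarrow> (\<integral>x. bracket (a x) \<partial>M) \<le> B \<Longrightarrow>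
        integrable M (\<lambda>x. bracket (b x)) \<Longrightarrow> (\<integral>x. bracket (b x) \<partial>M) \<le> B \<Longrightarrow>
        (\<integral>x. bracket_gap (a x) (b x) \<partial>M) < \<delta> \<Longrightarrow> (\<integral>x. sqrt (norm (a x - b x)) \<partial>M) < (1/2) ^ k"
      show ?thesis
        by (rule that[OF \<open>0 < \<delta>\<close>]) (unfold D_def, intro \<delta> w int)
    qed simp
    with Cauchy[OF \<open>0 < \<delta>\<close>] show ?thesis by blast
  qed
  then obtain N where N: "\<And>k m n. N k \<le> m \<Longrightarrow> N k \<le> n \<Longrightarrow> D m n < (1/2) ^ k" by metis
  \<comment> \<open>The sum puts \<open>r k\<close> beyond \<open>N k\<close>, and the summand
    \<open>k\<close> makes \<open>r\<close> strictly increasing.\<close>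
  define r where "r k = (\<Sum>i\<le>k. N i) + k" for k
  have r: "strict_mono r" by (simp add: strict_mono_Suc_iff r_def)
  have rN: "N k \<le> r k" for k
    using member_le_sum[of k "{..k}" N] by (simp add: r_def trans_le_add1)
  define z where "z k x = w (r (Suc k)) x - w (r k) x" for k x
  have [measurable]: "z k \<in> borel_measurable M" for k by (simp add: z_def[abs_def])
  have Dz: "(\<integral>\<^sup>+x. ennreal (sqrt (norm (z k x))) \<partial>M) \<le> ennreal ((1/2) ^ k)" for k
  proof -
    have "D (r (Suc k)) (r k) < (1/2) ^ k"
      using rN[of k] strict_monoD[OF r, of k "Suc k"] by (intro N) auto
    then show ?thesis
      using integral_sqrt_dist_le(2)[OF w w int(1) int(2) int(1) int(2), of "r (Suc k)" "r k"]
      by (subst nn_integral_eq_integral) (auto simp: z_def D_def intro!: ennreal_leI)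
  qed
  have "(\<integral>\<^sup>+x. (\<Sum>k. ennreal (sqrt (norm (z k x)))) \<partial>M)
      = (\<Sum>k. \<integral>\<^sup>+x. ennreal (sqrt (norm (z k x))) \<partial>M)"
    by (rule nn_integral_suminf) simp
  also have "\<dots> \<le> (\<Sum>k. ennreal ((1/2) ^ k))"
    by (intro suminf_le Dz) auto
  also have "\<dots> < \<infinity>"
    using summable_geometric[of "1/2 :: real"] by (simp add: suminf_ennreal2 less_top[symmetric])
  finally have "AE x in M. (\<Sum>k. ennreal (sqrt (norm (z k x)))) \<noteq> \<infinity>"
    by (intro nn_integral_PInf_AE) auto
  then have conv: "AE x in M. convergent (\<lambda>k. w (r k) x)"
  proof eventually_elim
    case (elim x)
    then have "summable (\<lambda>k. sqrt (norm (z k x)))"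
      by (intro summable_suminf_not_top) auto
    then have "summable (\<lambda>k. z k x)" by (rule summable_of_summable_sqrt)
    then have "convergent (\<lambda>n. \<Sum>k<n. z k x)" by (simp add: summable_iff_convergent)
    then have "convergent (\<lambda>n. w (r n) x - w (r 0) x)"
      by (simp add: z_def sum_lessThan_telescope[of "\<lambda>k. w (r k) x"])
    then have "convergent (\<lambda>n. w (r n) x - w (r 0) x + w (r 0) x)"
      by (intro convergent_add convergent_const)
    then show ?case by simp
  qed
  show thesis
  proof (rule that[OF r])
    show "(\<lambda>x. lim (\<lambda>k. w (r k) x)) \<in> borel_measurable M" by measurable
    show "AE x in M. (\<lambda>k. w (r k) x) \<longlonglongrightarrow> lim (\<lambda>k. w (r k) x)"
      using conv by eventually_elim (simp add: convergent_LIMSEQ_iff)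
  qed
qed

text \<open>Lets a second family of near-minimizers inherit the limit of the first.\<close>

lemma gap_null_AE_subsequence:
  fixes a b :: "nat \<Rightarrow> 'a \<Rightarrow> 'b::euclidean_space"
  assumes [measurable]: "\<And>n. a n \<in> borel_measurable M" "\<And>n. b n \<in> borel_measurable M"
    and int: "\<And>n. integrable M (\<lambda>x. bracket (a n x))" "\<And>n. (\<integral>x. bracket (a n x) \<partial>M) \<le> B"
      "\<And>n. integrable M (\<lambda>x. bracket (b n x))" "\<And>n. (\<integral>x. bracket (b n x) \<partial>M) \<le> B"
    and lim: "(\<lambda>n. \<integral>x. bracket_gap (a n x) (b n x) \<partial>M) \<longlonglongrightarrow> 0"
  obtains r where "strict_mono (r :: nat \<Rightarrow> nat)" "AE x in M. (\<lambda>k. a (r k) x - b (r k) x) \<longlonglongrightarrow> 0"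
proof -
  define D where "D n = (\<integral>x. sqrt (norm (a n x - b n x)) \<partial>M)" for n
  have D0: "0 \<le> D n" for n unfolding D_def by (rule Bochner_Integration.integral_nonneg) simp
  have "D \<longlonglongrightarrow> 0"
  proof (rule order_tendstoI)
    fix e :: real assume "0 < e"
    obtain \<delta> where "0 < \<delta>" and \<delta>: "\<And>n. (\<integral>x. bracket_gap (a n x) (b n x) \<partial>M) < \<delta> \<Longrightarrow> D n < e"
    proof (rule integral_sqrt_dist_small[OF \<open>0 < e\<close>, where 'b = 'b])
      fix \<delta> :: real
      assume "0 < \<delta>" and \<delta>: "\<And>a b :: 'a \<Rightarrow> 'b. a \<in> borel_measurable M \<Longrightarrow> b \<in> borel_measurable M \<Longrightarrow>
        integrable M (\<lambda>x. bracket (a x)) \<Longrightarrow> (\<integral>x. bracket (a x) \<partial>M) \<le> B \<Longrightarrow>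
        integrable M (\<lambda>x. bracket (b x)) \<Longrightarrow> (\<integral>x. bracket (b x) \<partial>M) \<le> B \<Longrightarrow>
        (\<integral>x. bracket_gap (a x) (b x) \<partial>M) < \<delta> \<Longrightarrow> (\<integral>x. sqrt (norm (a x - b x)) \<partial>M) < e"
      show ?thesis
        by (rule that[OF \<open>0 < \<delta>\<close>]) (unfold D_def, intro \<delta> assms(1,2) int)
    qed
    show "\<forall>\<^sub>F n in sequentially. D n < e"
      using order_tendstoD(2)[OF lim \<open>0 < \<delta>\<close>] by eventually_elim (rule \<delta>)
  next
    fix e :: real assume "e < 0"
    then show "\<forall>\<^sub>F n in sequentially. e < D n"
      using D0 by (intro always_eventually allI) (rule less_le_trans)
  qed
  then have "\<exists>r::nat\<Rightarrow>nat. strict_mono r \<and> (AE x in M. (\<lambda>k. sqrt (norm (a (r k) x - b (r k) x))) \<longlonglongrightarrow> 0)"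
    using integral_sqrt_dist_le(2)[OF assms(1,2) int] unfolding D_def
    by (intro tendsto_L1_AE_subseq) auto
  then obtain r :: "nat \<Rightarrow> nat" where r: "strict_mono r"
    "AE x in M. (\<lambda>k. sqrt (norm (a (r k) x - b (r k) x))) \<longlonglongrightarrow> 0" by blast
  have "AE x in M. (\<lambda>k. a (r k) x - b (r k) x) \<longlonglongrightarrow> 0"
    using r(2)
  proof eventually_elim
    case (elim x)
    from tendsto_power[OF this, of 2] show ?case by (simp add: tendsto_norm_zero_iff)
  qed
  with r(1) show thesis by (rule that)
qed

end

section \<open>Test functions have their classical gradients as weak gradients\<close>

lemma integral_gradient_zero:
  fixes \<zeta> :: "'a::euclidean_space \<Rightarrow> real"
  assumes D: "\<And>x. (\<zeta> has_derivative (\<lambda>h. G x \<bullet> h)) (at x)"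
    and G: "continuous_on UNIV G" and K: "compact K"
    and zero: "\<And>x. x \<notin> K \<Longrightarrow> \<zeta> x = 0" "\<And>x. x \<notin> K \<Longrightarrow> G x = 0"
  shows "integrable lborel G" "integral\<^sup>L lborel G = 0"
proof -
  have \<zeta>: "continuous_on UNIV \<zeta>"
    by (meson D continuous_at_imp_continuous_on has_derivative_continuous)
  then have [measurable]: "\<zeta> \<in> borel_measurable borel" by (rule borel_measurable_continuous_onI)
  from G have [measurable]: "G \<in> borel_measurable borel" by (rule borel_measurable_continuous_onI)
  have "integrable lborel (\<lambda>x. indicat_real K x *\<^sub>R G x)"
    using K by (rule borel_integrable_compact) (rule continuous_on_subset[OF G], simp)
  also have "(\<lambda>x. indicat_real K x *\<^sub>R G x) = G"
    using zero by (auto simp: indicator_def fun_eq_iff)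
  finally show intG: "integrable lborel G" .
  have "integrable lborel (\<lambda>x. indicat_real K x *\<^sub>R \<zeta> x)"
    using K by (rule borel_integrable_compact) (rule continuous_on_subset[OF \<zeta>], simp)
  also have "(\<lambda>x. indicat_real K x *\<^sub>R \<zeta> x) = \<zeta>"
    using zero by (auto simp: indicator_def fun_eq_iff)
  finally have int\<zeta>: "integrable lborel \<zeta>" .
  have "bounded (G ` K)"
    using K by (intro compact_imp_bounded compact_continuous_image continuous_on_subset[OF G]) auto
  then obtain B0 where B0: "\<And>x. x \<in> K \<Longrightarrow> norm (G x) \<le> B0" unfolding bounded_iff by auto
  define B where "B = max 0 B0"
  have B: "norm (G x) \<le> B" for x
    using B0[of x] zero(2)[of x] by (cases "x \<in> K") (auto simp: B_def)
  have lip: "\<bar>\<zeta> (x + h) - \<zeta> x\<bar> \<le> B * norm h" for x h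
  proof -
    have "norm (\<zeta> (x + h) - \<zeta> x) \<le> B * norm ((x + h) - x)"
    proof (rule differentiable_bound[of UNIV \<zeta> "\<lambda>x h. G x \<bullet> h"])
      show "onorm ((\<bullet>) (G y)) \<le> B" for y
        using B[of y] by (intro onorm_bound) (auto simp: B_def intro: order_trans[OF Cauchy_Schwarz_ineq2 mult_right_mono])
    qed (use D in auto)
    then show ?thesis by simp
  qed
  \<comment> \<open>By translation invariance every difference quotient in direction
    \<open>e\<close> has integral \<open>0\<close>, and the quotients converge to the directional
    derivative under a common majorant.\<close>
  have e0: "(\<integral>x. G x \<bullet> e \<partial>lborel) = 0" for e
  proof -
    define t where "t n = inverse (real (Suc n))" for n
    have t: "0 < t n" "t n \<le> 1" for n by (auto simp: t_def field_simps)
    define q where "q n x = (\<zeta> (t n *\<^sub>R e + x) - \<zeta> x) / t n" for n x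
    have shift: "integrable lborel (\<lambda>x. \<zeta> (c + x))" "(\<integral>x. \<zeta> (c + x) \<partial>lborel) = integral\<^sup>L lborel \<zeta>" for c
    proof -
      have "integrable (distr lborel borel ((+) c)) \<zeta>"
        using int\<zeta> by (simp add: lborel_distr_plus)
      then show "integrable lborel (\<lambda>x. \<zeta> (c + x))"
        by (subst (asm) integrable_distr_eq) auto
      have "(\<integral>x. \<zeta> (c + x) \<partial>lborel) = integral\<^sup>L (distr lborel borel ((+) c)) \<zeta>"
        by (subst integral_distr) auto
      then show "(\<integral>x. \<zeta> (c + x) \<partial>lborel) = integral\<^sup>L lborel \<zeta>"
        by (simp add: lborel_distr_plus)
    qed
    have q0: "integral\<^sup>L lborel (q n) = 0" for n
      using shift[of "t n *\<^sub>R e"] int\<zeta> by (simp add: q_def[abs_def])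
    \<comment> \<open>As all step sizes are at most \<open>1\<close>, every quotient is supported in
      this neighbourhood of \<open>K\<close>, where the Lipschitz constant bounds it.\<close>
    define K' where "K' = {x + y | x y. x \<in> K \<and> y \<in> cball 0 (norm e)}"
    have K': "compact K'" unfolding K'_def by (intro compact_sums K compact_cball)
    have "(\<lambda>n. integral\<^sup>L lborel (q n)) \<longlonglongrightarrow> (\<integral>x. G x \<bullet> e \<partial>lborel)"
    proof (rule integral_dominated_convergence)
      show "(\<lambda>x. G x \<bullet> e) \<in> borel_measurable lborel" by simp
      show "q n \<in> borel_measurable lborel" for n unfolding q_def by measurable
      show "integrable lborel (\<lambda>x. indicat_real K' x *\<^sub>R (B * norm e))"
        by (intro borel_integrable_compact K' continuous_intros)
      show "AE x in lborel. (\<lambda>n. q n x) \<longlonglongrightarrow> G x \<bullet> e"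
      proof (rule AE_I2)
        fix x
        have "((\<lambda>s. \<zeta> (x + s *\<^sub>R e)) has_real_derivative G x \<bullet> e) (at 0)"
        proof -
          have "((\<lambda>s. x + s *\<^sub>R e) has_derivative (\<lambda>s. s *\<^sub>R e)) (at 0)"
            by (auto intro!: derivative_eq_intros)
          from has_derivative_compose[OF this, of \<zeta> "\<lambda>h. G x \<bullet> h"] D[of x] show ?thesis
            by (simp add: has_field_derivative_def mult_commute_abs)
        qed
        then have "((\<lambda>s. (\<zeta> (x + s *\<^sub>R e) - \<zeta> x) / s) \<longlongrightarrow> G x \<bullet> e) (at 0)"
          by (simp add: DERIV_def)
        moreover have "filterlim t (at 0) sequentially"
          unfolding filterlim_at t_def
            by (auto intro: LIMSEQ_inverse_real_of_nat simp del: of_nat_Suc)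
        ultimately have "(\<lambda>n. (\<zeta> (x + t n *\<^sub>R e) - \<zeta> x) / t n) \<longlonglongrightarrow> G x \<bullet> e"
          by (rule filterlim_compose)
        then show "(\<lambda>n. q n x) \<longlonglongrightarrow> G x \<bullet> e" by (simp add: q_def add.commute)
      qed
      show "AE x in lborel. norm (q n x) \<le> indicat_real K' x *\<^sub>R (B * norm e)" for n
      proof (rule AE_I2)
        fix x
        show "norm (q n x) \<le> indicat_real K' x *\<^sub>R (B * norm e)"
        proof (cases "x \<in> K'")
          case True
          have "\<bar>\<zeta> (t n *\<^sub>R e + x) - \<zeta> x\<bar> \<le> B * norm (t n *\<^sub>R e)"
            using lip[of x "t n *\<^sub>R e"] by (simp add: add.commute)
          with True t[of n] show ?thesis by (simp add: q_def field_simps)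
        next
          case False
          have "x \<notin> K" using False by (auto simp: K'_def intro: exI[of _ 0])
          moreover have "t n *\<^sub>R e + x \<notin> K"
          proof
            assume "t n *\<^sub>R e + x \<in> K"
            then have "(t n *\<^sub>R e + x) + (- t n) *\<^sub>R e \<in> K'"
              unfolding K'_def using t[of n]
              by (intro CollectI exI[of _ "t n *\<^sub>R e + x"] exI[of _ "(- t n) *\<^sub>R e"])
                (auto simp: mult_left_le_one_le)
            with False show False by simp
          qed
          ultimately show ?thesis by (simp add: q_def zero False)
        qed
      qed
    qed
    then show ?thesis by (simp add: q0 LIMSEQ_const_iff)
  qed
  \<comment> \<open>The integral of \<open>G\<close> itself is used as the direction, so its squared
    norm is \<open>0\<close>.\<close>
  have "integral\<^sup>L lborel G \<bullet> integral\<^sup>L lborel G = (\<integral>x. G x \<bullet> integral\<^sup>L lborel G \<partial>lborel)"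
    using intG by simp
  then show "integral\<^sup>L lborel G = 0" using e0 by simp
qed

lemma continuous_imp_locally_integrable:
  fixes f :: "'a::euclidean_space \<Rightarrow> 'b::euclidean_space"
  assumes "continuous_on UNIV f"
  shows "locally_integrable \<Omega> f"
  unfolding locally_integrable_def
proof (intro allI impI)
  fix C :: "'a set" assume C: "compact C \<and> C \<subseteq> \<Omega>"
  then have int: "integrable lborel (\<lambda>x. indicat_real C x *\<^sub>R f x)"
    by (intro borel_integrable_compact continuous_on_subset[OF assms]) auto
  then have "integrable lebesgue (\<lambda>x. indicat_real C x *\<^sub>R f x)"
    by (subst integrable_completion) auto
  moreover have "C \<in> sets lebesgue" using C by (auto intro: fmeasurableD lmeasurable_compact)
  ultimately show "integrable (lebesgue_on C) f" by (subst integrable_restrict_space) auto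
qed

text \<open>The product rule: the gradient of \<open>\<eta> x * \<psi> x\<close> has compact support
  and integrates to zero. This places test functions in the primal space, so an equation tested
  against that space also holds in the distributional sense.\<close>

lemma has_weak_gradient_test_function:
  assumes "open \<Omega>" and \<eta>: "\<eta> \<in> test_functions \<Omega>"
  shows "has_weak_gradient \<Omega> \<eta> (grad \<eta>)"
proof -
  obtain K where K: "continuous_on UNIV \<eta>" "continuous_on UNIV (grad \<eta>)"
    and D\<eta>: "\<And>x. (\<eta> has_derivative (\<lambda>h. grad \<eta> x \<bullet> h)) (at x)"
    using test_function_facts[OF \<eta>] by metis
  note loc = continuous_imp_locally_integrable
  show ?thesis
    unfolding has_weak_gradient_def
  proof (intro conjI ballI loc K)
    fix \<psi> assume \<psi>: "\<psi> \<in> test_functions \<Omega>"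
    obtain C where C: "compact C" "C \<subseteq> \<Omega>" "continuous_on UNIV \<psi>" "continuous_on UNIV (grad \<psi>)"
      "\<And>x. x \<notin> C \<Longrightarrow> \<psi> x = 0 \<and> grad \<psi> x = 0" 
      and D\<psi>: "\<And>x. (\<psi> has_derivative (\<lambda>h. grad \<psi> x \<bullet> h)) (at x)"
      using test_function_facts[OF \<psi>] by metis
    let ?G = "\<lambda>x. \<eta> x *\<^sub>R grad \<psi> x + \<psi> x *\<^sub>R grad \<eta> x"
    have cont: "continuous_on UNIV ?G" using K C by (intro continuous_intros)
    have "((\<lambda>x. \<eta> x * \<psi> x) has_derivative (\<lambda>h. ?G x \<bullet> h)) (at x)" for x
      using has_derivative_mult[OF D\<eta> D\<psi>, of x] by (simp add: inner_add_left mult.commute)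
    from integral_gradient_zero[OF this cont C(1)] have "integral\<^sup>L lborel ?G = 0"
      using C(5) by simp
    moreover have "(\<integral>x. ?G x \<partial>lebesgue_on \<Omega>) = (\<integral>x. ?G x \<partial>lebesgue)"
    proof -
      have "(\<lambda>x. indicat_real \<Omega> x *\<^sub>R ?G x) = ?G"
        using C(2) C(5) by (fastforce simp: indicator_def fun_eq_iff)
      then show ?thesis using \<open>open \<Omega>\<close> by (subst integral_restrict_space) auto
    qed
    moreover have "(\<integral>x. ?G x \<partial>lebesgue) = (\<integral>x. ?G x \<partial>lborel)"
      using borel_measurable_continuous_onI[OF cont] by (intro integral_completion) simp
    ultimately have "(\<integral>x. ?G x \<partial>lebesgue_on \<Omega>) = 0" by simp
    moreover have "integrable (lebesgue_on \<Omega>) (\<lambda>x. \<eta> x *\<^sub>R grad \<psi> x)"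
      by (intro integrable_mult_grad_test loc K assms \<psi>)
    moreover have "integrable (lebesgue_on \<Omega>) (\<lambda>x. \<psi> x *\<^sub>R grad \<eta> x)"
      by (intro integrable_test_mult loc K assms \<psi>)
    ultimately show "(\<integral>x. \<eta> x *\<^sub>R grad \<psi> x \<partial>lebesgue_on \<Omega>) = - (\<integral>x. \<psi> x *\<^sub>R grad \<eta> x \<partial>lebesgue_on \<Omega>)"
      by (simp add: add_eq_0_iff2)
  qed
qed

section \<open>Near-minimizers over decreasing midpoint-convex sets\<close>

lemma integral_bracket_gap:
  fixes a b :: "'a \<Rightarrow> 'b::euclidean_space"
  assumes [measurable]: "a \<in> borel_measurable M" "b \<in> borel_measurable M"
    and a: "integrable M (\<lambda>x. bracket (a x))" and b: "integrable M (\<lambda>x. bracket (b x))"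
  shows "(\<integral>x. bracket_gap (a x) (b x) \<partial>M)
      = ((\<integral>x. bracket (a x) \<partial>M) + (\<integral>x. bracket (b x) \<partial>M)) / 2 - (\<integral>x. bracket ((1/2) *\<^sub>R (a x + b x)) \<partial>M)"
proof -
  have "integrable M (\<lambda>x. bracket ((1/2) *\<^sub>R (a x + b x)))"
  proof (rule Bochner_Integration.integrable_bound)
    show "integrable M (\<lambda>x. (bracket (a x) + bracket (b x)) / 2)" using a b by simp
    have "\<bar>bracket ((1/2) *\<^sub>R (u + v))\<bar> \<le> \<bar>(bracket u + bracket v) / 2\<bar>" for u v :: 'b
      using bracket_gap_lower_bound(2)[of u v] bracket_bounds(1)[of "(1/2) *\<^sub>R (u + v)"]
      unfolding bracket_gap_def by linarith
    then show "AE x in M. norm (bracket ((1/2) *\<^sub>R (a x + b x))) \<le> norm ((bracket (a x) + bracket (b x)) / 2)"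
      by simp
  qed measurable
  with a b show ?thesis by (simp add: bracket_gap_def)
qed

text \<open>The infima over \<open>P n\<close> increase to a finite \<open>s\<close>. For
  \<open>m\<close> and \<open>n\<close> beyond \<open>N\<close>, the midpoint of \<open>p m\<close>
  and \<open>p n\<close> lies in \<open>P N\<close> and costs at least \<open>j N\<close>, while
  both ends cost at most \<open>s + 1 / real (Suc N)\<close>; hence the gap integral is at most
  \<open>s - j N + 1 / real (Suc N)\<close>. Nothing is claimed about membership of the limit
  \<open>w\<close>, which each application settles by its own closedness argument.\<close>

lemma bracket_near_minimizers:
  fixes P :: "nat \<Rightarrow> ('a \<Rightarrow> 'b::euclidean_space) set" and M :: "'a measure"
  defines "J \<equiv> \<lambda>a. \<integral>x. bracket (a x) \<partial>M"
  assumes ne: "\<And>n. P n \<noteq> {}" and dec: "\<And>n. P (Suc n) \<subseteq> P n"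
    and mid: "\<And>n a b. a \<in> P n \<Longrightarrow> b \<in> P n \<Longrightarrow> (\<lambda>x. (1/2) *\<^sub>R (a x + b x)) \<in> P n"
    and meas: "\<And>a. a \<in> P 0 \<Longrightarrow> a \<in> borel_measurable M"
    and int: "\<And>a. a \<in> P 0 \<Longrightarrow> integrable M (\<lambda>x. bracket (a x))"
    and bound: "\<And>a. a \<in> P 0 \<Longrightarrow> J a \<le> B"
  obtains p r w where "\<And>n. p n \<in> P n" "\<And>n. J (p n) < Inf (J ` P n) + 1 / real (Suc n)"
    "strict_mono (r :: nat \<Rightarrow> nat)" "w \<in> borel_measurable M" "AE x in M. (\<lambda>k. p (r k) x) \<longlonglongrightarrow> w x"
proof -
  define j where "j n = Inf (J ` P n)" for n
  have J0: "0 \<le> J a" for a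
    unfolding J_def using bracket_bounds(1) by (intro Bochner_Integration.integral_nonneg) (rule order_trans[OF zero_le_one])
  then have bdd: "bdd_below (J ` P n)" for n by (intro bdd_belowI2[of _ 0])
  have sub: "P n \<subseteq> P m" if "m \<le> n" for m n
    using lift_Suc_antimono_le[of P, OF dec that] .
  have jJ: "j n \<le> J a" if "a \<in> P n" for n a
    unfolding j_def using that bdd by (intro cInf_lower) auto
  have "\<exists>a\<in>P n. J a < j n + 1 / real (Suc n)" for n
    using cInf_lessD[of "J ` P n" "j n + 1 / real (Suc n)"] ne[of n] by (auto simp: j_def)
  then obtain p where p: "\<And>n. p n \<in> P n" "\<And>n. J (p n) < j n + 1 / real (Suc n)" by metis
  have p0: "p n \<in> P 0" for n using p(1) sub[of 0 n] by auto
  have "incseq j"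
    unfolding incseq_def j_def using ne sub bdd by (auto intro!: cInf_superset_mono image_mono)
  moreover have "j n \<le> B" for n using jJ[OF p(1)] bound[OF p0] by (rule order_trans)
  ultimately obtain s where s: "j \<longlonglongrightarrow> s" "\<And>n. j n \<le> s"
    using incseq_convergent by blast
  have "\<exists>N. \<forall>m\<ge>N. \<forall>n\<ge>N. (\<integral>x. bracket_gap (p m x) (p n x) \<partial>M) < \<epsilon>" if "0 < \<epsilon>" for \<epsilon>
  proof -
    have "(\<lambda>N. s - j N + 1 / real (Suc N)) \<longlonglongrightarrow> s - s + 0"
      by (intro tendsto_intros s LIMSEQ_Suc[OF lim_1_over_n])
    then have "\<forall>\<^sub>F N in sequentially. s - j N + 1 / real (Suc N) < \<epsilon>"
      using that by (auto dest: order_tendstoD)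
    then obtain N where N: "s - j N + 1 / real (Suc N) < \<epsilon>"
      by (auto simp: eventually_sequentially)
    show ?thesis
    proof (intro exI allI impI)
      fix m n assume mn: "N \<le> m" "N \<le> n"
      have J: "J (p k) \<le> s + 1 / real (Suc N)" if "N \<le> k" for k
      proof -
        have "1 / real (Suc k) \<le> 1 / real (Suc N)" using that by (simp add: frac_le)
        with p(2)[of k] s(2)[of k] show ?thesis by linarith
      qed
      have "(\<lambda>x. (1/2) *\<^sub>R (p m x + p n x)) \<in> P N"
        using mn sub p(1) by (intro mid) auto
      from jJ[OF this] have "j N \<le> (\<integral>x. bracket ((1/2) *\<^sub>R (p m x + p n x)) \<partial>M)" by (simp add: J_def)
      then show "(\<integral>x. bracket_gap (p m x) (p n x) \<partial>M) < \<epsilon>"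
        using J[OF mn(1)] J[OF mn(2)] N meas int p0 by (subst integral_bracket_gap) (auto simp: J_def add_divide_distrib)
    qed
  qed
  then obtain r v where "strict_mono (r :: nat \<Rightarrow> nat)" "v \<in> borel_measurable M"
    "AE x in M. (\<lambda>k. p (r k) x) \<longlonglongrightarrow> v x"
    using gap_Cauchy_AE_subsequence[of p M B] meas int bound p0 unfolding J_def by blast
  with p show thesis unfolding j_def by (rule that)
qed

text \<open>Vitali's theorem with equi-integrability expressed by \<open>coercive\<close>: up to a
  fixed integrable \<open>b\<close>, all functions are small multiples of functions with bounded
  integrals. The part below \<open>2 * \<bar>b x\<bar>\<close> converges by domination, the excess
  is uniformly small.\<close>

lemma L1_limit_of_coercive_bound:
  fixes w :: "nat \<Rightarrow> 'a \<Rightarrow> 'b::euclidean_space"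
  assumes [measurable]: "\<And>n. w n \<in> borel_measurable M" "v \<in> borel_measurable M"
    and lim: "AE x in M. (\<lambda>n. w n x) \<longlonglongrightarrow> v x"
    and a: "\<And>n. integrable M (a n)" "\<And>n. (\<integral>x. a n x \<partial>M) \<le> B" "\<And>n x. 0 \<le> a n x"
    and c: "integrable M c" "(\<integral>x. c x \<partial>M) \<le> B" "\<And>x. 0 \<le> c x"
    and coercive: "\<And>\<epsilon>. 0 < \<epsilon> \<Longrightarrow> \<exists>b. integrable M b \<and>
      (AE x in M. (\<forall>n. norm (w n x) \<le> \<epsilon> * a n x + b x) \<and> norm (v x) \<le> \<epsilon> * c x + b x)"
  shows "\<And>n. integrable M (w n)" "integrable M v" "(\<lambda>n. \<integral>x. norm (w n x - v x) \<partial>M) \<longlonglongrightarrow> 0"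
proof -
  obtain b where b: "integrable M b" and ab: "AE x in M. (\<forall>n. norm (w n x) \<le> 1 * a n x + b x) \<and> norm (v x) \<le> 1 * c x + b x"
    using coercive[of 1] by auto
  show iw: "integrable M (w n)" for n
  proof (rule Bochner_Integration.integrable_bound)
    show "integrable M (\<lambda>x. a n x + b x)" using a b by simp
    show "AE x in M. norm (w n x) \<le> norm (a n x + b x)"
      using ab by eventually_elim (auto intro: order_trans[OF _ abs_ge_self])
  qed simp
  show iv: "integrable M v"
  proof (rule Bochner_Integration.integrable_bound)
    show "integrable M (\<lambda>x. c x + b x)" using c b by simp
    show "AE x in M. norm (v x) \<le> norm (c x + b x)"
      using ab by eventually_elim (simp add: order_trans[OF _ abs_ge_self])
  qed simp
  show "(\<lambda>n. \<integral>x. norm (w n x - v x) \<partial>M) \<longlonglongrightarrow> 0"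
  proof (rule order_tendstoI)
    fix e :: real assume "e < 0"
    moreover have "0 \<le> (\<integral>x. norm (w n x - v x) \<partial>M)" for n
      by (rule Bochner_Integration.integral_nonneg) simp
    ultimately show "\<forall>\<^sub>F n in sequentially. e < (\<integral>x. norm (w n x - v x) \<partial>M)"
      by (intro always_eventually allI) (rule less_le_trans)
  next
    fix e :: real assume e: "0 < e"
    \<comment> \<open>The excess integrates to at most \<open>\<epsilon> * (B + B)\<close>, which
      this choice keeps below \<open>e / 2\<close>.\<close>
    define \<epsilon> where "\<epsilon> = e / (4 * (\<bar>B\<bar> + 1))"
    have \<epsilon>: "0 < \<epsilon>" using e by (simp add: \<epsilon>_def)
    obtain b where b: "integrable M b" and ab: "AE x in M. (\<forall>n. norm (w n x) \<le> \<epsilon> * a n x + b x) \<and> norm (v x) \<le> \<epsilon> * c x + b x"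
      using coercive[OF \<epsilon>] by auto
    define m where "m n x = min (norm (w n x - v x)) (2 * \<bar>b x\<bar>)" for n x
    have [measurable]: "b \<in> borel_measurable M" using b by auto
    have im: "integrable M (m n)" for n
      by (rule Bochner_Integration.integrable_bound[of _ "\<lambda>x. 2 * \<bar>b x\<bar>"]) (use b in \<open>auto simp: m_def[abs_def]\<close>)
    have "(\<lambda>n. integral\<^sup>L M (m n)) \<longlonglongrightarrow> (\<integral>x. 0 \<partial>M)"
    proof (rule integral_dominated_convergence)
      show "integrable M (\<lambda>x. 2 * \<bar>b x\<bar>)" using b by auto
      show "AE x in M. (\<lambda>n. m n x) \<longlonglongrightarrow> 0"
        using lim
      proof eventually_elim
        case (elim x)
        have "(\<lambda>n. m n x) \<longlonglongrightarrow> min (norm (v x - v x)) (2 * \<bar>b x\<bar>)"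
          unfolding m_def by (intro tendsto_intros elim)
        then show ?case by simp
      qed
      show "m n \<in> borel_measurable M" for n using im by (rule borel_measurable_integrable)
    qed (auto simp: m_def)
    then have "\<forall>\<^sub>F n in sequentially. integral\<^sup>L M (m n) < e / 2"
      using e by (auto dest: order_tendstoD(2)[of _ _ _ "e/2"])
    then show "\<forall>\<^sub>F n in sequentially. (\<integral>x. norm (w n x - v x) \<partial>M) < e"
    proof eventually_elim
      case (elim n)
      have "(\<integral>x. norm (w n x - v x) \<partial>M) \<le> (\<integral>x. m n x + \<epsilon> * (a n x + c x) \<partial>M)"
      proof (rule integral_mono_AE)
        show "integrable M (\<lambda>x. norm (w n x - v x))" using iw iv by auto
        show "integrable M (\<lambda>x. m n x + \<epsilon> * (a n x + c x))" using im a c by auto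
        show "AE x in M. norm (w n x - v x) \<le> m n x + \<epsilon> * (a n x + c x)"
          using ab
        proof eventually_elim
          case (elim x)
          then have "norm (w n x) \<le> \<epsilon> * a n x + b x" "norm (v x) \<le> \<epsilon> * c x + b x"
              "0 \<le> norm (w n x)" "0 \<le> norm (v x)" by auto
          moreover have "norm (w n x - v x) \<le> norm (w n x) + norm (v x)"
            by (rule norm_triangle_ineq4)
          moreover have "\<epsilon> * (a n x + c x) = \<epsilon> * a n x + \<epsilon> * c x" by (rule distrib_left)
          moreover have "0 \<le> \<epsilon> * a n x" "0 \<le> \<epsilon> * c x" using \<epsilon> a(3) c(3) by auto
          ultimately show ?case unfolding m_def by linarith
        qed
      qed
      also have "\<dots> = integral\<^sup>L M (m n) + \<epsilon> * (integral\<^sup>L M (a n) + integral\<^sup>L M c)"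
        using im a c by simp
      also have "\<epsilon> * (integral\<^sup>L M (a n) + integral\<^sup>L M c) \<le> \<epsilon> * (2 * (\<bar>B\<bar> + 1))"
        using \<epsilon> a(2)[of n] c(2) by (intro mult_left_mono) auto
      also have "\<epsilon> * (2 * (\<bar>B\<bar> + 1)) = e / 2" by (simp add: \<epsilon>_def field_simps add_nonneg_eq_0_iff)
      finally show ?case using elim by linarith
    qed
  qed
qed

section \<open>Convex functions of one variable\<close>

text \<open>The right derivative, taken along one fixed sequence so that it depends measurably on
  parameters. For convex nondecreasing \<open>h\<close> the quotients decrease and are nonnegative,
  so \<open>lim\<close> is a genuine limit.\<close>

definition right_slope :: "(real \<Rightarrow> real) \<Rightarrow> real \<Rightarrow> real" where
  "right_slope h t = lim (\<lambda>n. (h (t + inverse (real (Suc n))) - h t) * real (Suc n))"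

text \<open>Chord slopes from \<open>t\<close> increase with the other endpoint, so the limit from
  the right lies below every chord slope to the right and above every one to the left. This gives a
  supporting line at \<open>t\<close>, also for \<open>t = 0\<close>.\<close>

lemma right_slope:
  assumes h: "convex_on {0..} h" "mono_on {0..} h" and t: "0 \<le> t"
  shows "0 \<le> right_slope h t" "\<And>y. 0 \<le> y \<Longrightarrow> h t + right_slope h t * (y - t) \<le> h y"
proof -
  define q where "q n = (h (t + inverse (real (Suc n))) - h t) * real (Suc n)" for n
  define \<sigma> where "\<sigma> y = (h y - h t) / (y - t)" for y
  have q\<sigma>: "q n = \<sigma> (t + inverse (real (Suc n)))" for n
    by (simp add: q_def \<sigma>_def field_simps)
  have \<sigma>_mono: "\<sigma> y \<le> \<sigma> z" if "t < y" "y \<le> z" for y z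
  proof (cases "y = z")
    case False
    with that have "(h t - h y) / (t - y) \<le> (h t - h z) / (t - z)"
      using t by (intro convex_on_slope_le(1)[OF h(1)]) auto
    then show ?thesis
      unfolding \<sigma>_def by (metis minus_diff_eq minus_divide_divide)
  qed auto
  have \<sigma>_left: "\<sigma> y \<le> \<sigma> z" if "0 \<le> y" "y < t" "t < z" for y z
  proof -
    have "(h y - h t) / (y - t) \<le> (h y - h z) / (y - z)" "(h y - h z) / (y - z) \<le> (h t - h z) / (t - z)"
      using that t by (intro convex_on_slope_le[OF h(1)]; auto)+
    then show ?thesis
      unfolding \<sigma>_def by (metis minus_diff_eq minus_divide_divide order_trans)
  qed
  have q0: "0 \<le> q n" for n
    using mono_onD[OF h(2), of t "t + inverse (real (Suc n))"] t by (simp add: q_def)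
  have "decseq q"
    unfolding decseq_Suc_iff q\<sigma> by (intro allI \<sigma>_mono) (auto simp: field_simps)
  then obtain L where L: "q \<longlonglongrightarrow> L" "\<And>n. L \<le> q n"
    using decseq_convergent[of q 0] q0 by auto
  have RL: "right_slope h t = L"
    unfolding right_slope_def q_def[symmetric] by (rule limI[OF L(1)])
  show "0 \<le> right_slope h t"
    unfolding RL using L(1) q0 by (intro LIMSEQ_le_const) auto
  fix y :: real assume y: "0 \<le> y"
  consider "y = t" | "t < y" | "y < t" by linarith
  then show "h t + right_slope h t * (y - t) \<le> h y"
  proof cases
    case 2
    have "(\<lambda>n. t + inverse (real (Suc n))) \<longlonglongrightarrow> t + 0"
      by (intro tendsto_intros LIMSEQ_inverse_real_of_nat)
    then have "\<forall>\<^sub>F n in sequentially. t + inverse (real (Suc n)) < y"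
      using 2 by (auto dest: order_tendstoD)
    then obtain n where "t + inverse (real (Suc n)) < y" by (auto simp: eventually_sequentially)
    then have "L \<le> \<sigma> y" using L(2)[of n] unfolding q\<sigma>
      by (smt (verit) \<sigma>_mono inverse_positive_iff_positive of_nat_0_less_iff zero_less_Suc)
    with 2 show ?thesis by (simp add: RL \<sigma>_def pos_le_divide_eq)
  next
    case 3
    have "\<sigma> y \<le> q n" for n unfolding q\<sigma> using 3 y by (intro \<sigma>_left) auto
    then have "\<sigma> y \<le> L" using L(1) by (intro LIMSEQ_le_const) auto
    with 3 show ?thesis by (simp add: RL \<sigma>_def neg_divide_le_eq)
  qed auto
qed

text \<open>Add the supporting inequality at \<open>s\<close>, evaluated at \<open>t\<close>, to the
  one at \<open>t\<close>, evaluated at \<open>s\<close>.\<close>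

lemma right_slope_mono:
  assumes h: "convex_on {0..} h" "mono_on {0..} h" and "0 \<le> s" "s \<le> t"
  shows "right_slope h s \<le> right_slope h t"
proof (cases "s = t")
  case False
  have "h s + right_slope h s * (t - s) \<le> h t" "h t + right_slope h t * (s - t) \<le> h s"
    using assms by (auto intro!: right_slope(2))
  then have "0 \<le> (right_slope h t - right_slope h s) * (t - s)"
    by (simp add: algebra_simps)
  with False assms show ?thesis by (simp add: zero_le_mult_iff)
qed auto

lemma Fatou_limit:
  fixes a :: "nat \<Rightarrow> 'a \<Rightarrow> real"
  assumes a: "\<And>n. integrable M (a n)" "\<And>n x. 0 \<le> a n x" "\<And>n. integral\<^sup>L M (a n) \<le> b n"
    and b: "b \<longlonglongrightarrow> L" and lim: "AE x in M. (\<lambda>n. a n x) \<longlonglongrightarrow> c x"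
    and c: "c \<in> borel_measurable M" "\<And>x. 0 \<le> c x"
  shows "integrable M c" "integral\<^sup>L M c \<le> L"
proof -
  have [measurable]: "a n \<in> borel_measurable M" for n using a(1) by auto
  have "(\<integral>\<^sup>+x. ennreal (c x) \<partial>M) = (\<integral>\<^sup>+x. liminf (\<lambda>n. ennreal (a n x)) \<partial>M)"
  proof (rule nn_integral_cong_AE)
    show "AE x in M. ennreal (c x) = liminf (\<lambda>n. ennreal (a n x))"
      using lim
    proof eventually_elim
      case (elim x)
      from tendsto_ennrealI[OF this] show ?case
        by (rule lim_imp_Liminf[OF trivial_limit_sequentially, symmetric])
    qed
  qed
  also have "\<dots> \<le> liminf (\<lambda>n. \<integral>\<^sup>+x. ennreal (a n x) \<partial>M)"
    by (rule nn_integral_liminf) simp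
  also have "\<dots> \<le> liminf (\<lambda>n. ennreal (b n))"
    using a by (intro Liminf_mono always_eventually allI) (simp add: nn_integral_eq_integral ennreal_leI)
  also have "\<dots> = ennreal L"
    by (rule lim_imp_Liminf[OF trivial_limit_sequentially tendsto_ennrealI[OF b]])
  finally have le: "(\<integral>\<^sup>+x. ennreal (c x) \<partial>M) \<le> ennreal L" .
  show int: "integrable M c"
    using c le by (intro integrableI_nonneg) (auto simp: le_less_trans[OF _ ennreal_less_top])
  have "0 \<le> L"
  proof (rule LIMSEQ_le_const[OF b])
    have "0 \<le> integral\<^sup>L M (a n)" for n using a(2) by (intro Bochner_Integration.integral_nonneg)
    with a(3) show "\<exists>N. \<forall>n\<ge>N. 0 \<le> b n" by (meson order_trans)
  qed
  with le show "integral\<^sup>L M c \<le> L"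
    using nn_integral_eq_integral[OF int] c by simp
qed

section \<open>The energy and its minimizer\<close>

text \<open>The pointwise conditions are required at every point, so that later arguments carry no
  exceptional set; the theorem reaches this form by redefining \<phi> on a null set. Superlinearity
  appears as affine lower bounds of arbitrary slope, each with a constant independent of the
  point.\<close>

locale phi_growth =
  fixes \<Omega> :: "'a::euclidean_space set" and \<phi> :: "'a \<Rightarrow> real \<Rightarrow> real" and f :: "'a \<Rightarrow> real" and C :: real
  assumes bounded_dom: "bounded \<Omega>" and open_dom: "open \<Omega>" and f_L2: "f \<in> L2 \<Omega>"
    and phi_convex: "\<And>x. convex_on {0..} (\<phi> x)" and phi_mono: "\<And>x. mono_on {0..} (\<phi> x)"
    and phi_cont: "\<And>x. continuous_on {0..} (\<phi> x)" and phi_0: "\<And>x. \<phi> x 0 = 0"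
    and phi_meas: "\<And>t. 0 \<le> t \<Longrightarrow> (\<lambda>x. \<phi> x t) \<in> borel_measurable (lebesgue_on \<Omega>)"
    and phi_int: "\<And>t. 0 \<le> t \<Longrightarrow> integrable (lebesgue_on \<Omega>) (\<lambda>x. \<phi> x t)"
    and C_nonneg: "0 \<le> C" and doubling: "\<And>x t. 0 \<le> t \<Longrightarrow> \<phi> x (2 * t) \<le> C * \<phi> x t"
    and superlinear: "\<And>m. 0 < m \<Longrightarrow> \<exists>T. AE x in lebesgue_on \<Omega>. \<forall>t\<ge>0. m * t \<le> \<phi> x t + T"
begin

abbreviation "M \<equiv> lebesgue_on \<Omega>"

lemma dom_sets: "\<Omega> \<in> sets lebesgue" using open_dom by auto

sublocale finite_measure M
  using bounded_dom open_dom by (intro finite_measure_lebesgue_on lmeasurable_open)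

section \<open>Monotonicity, doubling and measurability of compositions\<close>

lemma phi_le: "0 \<le> s \<Longrightarrow> s \<le> t \<Longrightarrow> \<phi> x s \<le> \<phi> x t"
  using mono_onD[OF phi_mono] by auto

lemma phi_nonneg: "0 \<le> t \<Longrightarrow> 0 \<le> \<phi> x t"
  using phi_le[of 0 t x] by (simp add: phi_0)

lemma phi_add: "0 \<le> s \<Longrightarrow> 0 \<le> t \<Longrightarrow> \<phi> x (s + t) \<le> \<phi> x (2 * s) + \<phi> x (2 * t)"
  using phi_le[of "s + t" "2 * s" x] phi_le[of "s + t" "2 * t" x] phi_nonneg[of "2 * s" x] phi_nonneg[of "2 * t" x]
  by (cases "s \<le> t") auto

lemma phi_scale: "\<exists>K\<ge>0. \<forall>x t. 0 \<le> t \<longrightarrow> \<phi> x (c * t) \<le> K * \<phi> x t" if "0 \<le> c"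
proof -
  obtain n where n: "c \<le> 2 ^ n" using real_arch_pow[of 2 c] by (auto intro: less_imp_le)
  have "\<phi> x (2 ^ n * t) \<le> C ^ n * \<phi> x t" if "0 \<le> t" for x t
  proof (induction n)
    case (Suc n)
    have "\<phi> x (2 ^ Suc n * t) \<le> C * \<phi> x (2 ^ n * t)"
      using doubling[of "2 ^ n * t" x] that by (simp add: mult.assoc)
    also have "\<dots> \<le> C * (C ^ n * \<phi> x t)" using Suc C_nonneg by (intro mult_left_mono) auto
    finally show ?case by (simp add: mult.assoc)
  qed simp
  moreover have "\<phi> x (c * t) \<le> \<phi> x (2 ^ n * t)" if "0 \<le> t" for x t
    using n that \<open>0 \<le> c\<close> by (intro phi_le mult_right_mono) auto
  ultimately have "\<phi> x (c * t) \<le> C ^ n * \<phi> x t" if "0 \<le> t" for x t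
    using that order_trans by blast
  then show ?thesis using C_nonneg by (intro exI[of _ "C ^ n"]) auto
qed

text \<open>The sublevel set is a countable union over rational \<open>q \<ge> v x\<close>:
  monotonicity passes from \<open>q\<close> down to \<open>v x\<close>, and continuity provides such
  a \<open>q\<close> slightly above \<open>v x\<close>.\<close>

lemma phi_comp_measurable:
  assumes v: "v \<in> borel_measurable M" and "\<And>x. 0 \<le> v x"
  shows "(\<lambda>x. \<phi> x (v x)) \<in> borel_measurable M"
  unfolding borel_measurable_iff_less
proof
  fix a
  have eq: "\<phi> x (v x) < a \<longleftrightarrow> (\<exists>q\<in>\<rat> \<inter> {0..}. v x \<le> q \<and> \<phi> x q < a)" for x
  proof
    assume lt: "\<phi> x (v x) < a"
    have "continuous (at (v x) within {0..}) (\<phi> x)"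
      using phi_cont[of x] assms(2)[of x] by (simp add: continuous_on_eq_continuous_within)
    then have "(\<phi> x \<longlongrightarrow> \<phi> x (v x)) (at (v x) within {0..})" by (simp add: continuous_within)
    then have "\<forall>\<^sub>F t in at (v x) within {0..}. \<phi> x t < a"
      using lt by (rule order_tendstoD)
    then obtain d where d: "0 < d" "\<And>t. 0 \<le> t \<Longrightarrow> t \<noteq> v x \<Longrightarrow> dist t (v x) < d \<Longrightarrow> \<phi> x t < a"
      by (auto simp: eventually_at)
    obtain q where q: "q \<in> \<rat>" "v x < q" "q < v x + d"
      using Rats_dense_in_real[of "v x" "v x + d"] d(1) by auto
    then have "\<phi> x q < a" using assms(2)[of x] by (intro d) (auto simp: dist_real_def)
    with q assms(2)[of x] show "\<exists>q\<in>\<rat> \<inter> {0..}. v x \<le> q \<and> \<phi> x q < a" by (auto intro!: bexI[of _ q])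
  next
    assume "\<exists>q\<in>\<rat> \<inter> {0..}. v x \<le> q \<and> \<phi> x q < a"
    then obtain q where "v x \<le> q" "\<phi> x q < a" by blast
    from phi_le[OF assms(2) this(1)] this(2) show "\<phi> x (v x) < a" by (rule le_less_trans)
  qed
  note v [measurable]
  have sets: "{x \<in> space M. v x \<le> q \<and> \<phi> x q < a} \<in> sets M" if "q \<in> \<rat> \<inter> {0..}" for q
  proof -
    have [measurable]: "(\<lambda>x. \<phi> x q) \<in> borel_measurable M" using that by (intro phi_meas) auto
    show ?thesis by measurable
  qed
  have "{x \<in> space M. \<phi> x (v x) < a} = (\<Union>q\<in>\<rat> \<inter> {0..}. {x \<in> space M. v x \<le> q \<and> \<phi> x q < a})"
    by (auto simp: eq)
  also have "\<dots> \<in> sets M"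
    by (rule sets.countable_UN''[OF countable_Int1[OF countable_rat] sets])
  finally show "{x \<in> space M. \<phi> x (v x) < a} \<in> sets M" .
qed

lemma phi_norm_measurable:
  fixes v :: "'a \<Rightarrow> 'b::euclidean_space"
  shows "v \<in> borel_measurable M \<Longrightarrow> (\<lambda>x. \<phi> x (norm (v x))) \<in> borel_measurable M"
  by (intro phi_comp_measurable) auto

lemma integrable_phi_scale:
  fixes v :: "'a \<Rightarrow> 'b::euclidean_space"
  assumes v [measurable]: "v \<in> borel_measurable M" and int: "integrable M (\<lambda>x. \<phi> x (norm (v x)))" and "0 \<le> c"
  shows "integrable M (\<lambda>x. \<phi> x (c * norm (v x)))"
proof -
  obtain K where K: "\<And>x t. 0 \<le> t \<Longrightarrow> \<phi> x (c * t) \<le> K * \<phi> x t" using phi_scale[OF \<open>0 \<le> c\<close>] by blast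
  show ?thesis
  proof (rule Bochner_Integration.integrable_bound)
    show "integrable M (\<lambda>x. K * \<phi> x (norm (v x)))" using int by simp
    show "(\<lambda>x. \<phi> x (c * norm (v x))) \<in> borel_measurable M"
      using \<open>0 \<le> c\<close> by (intro phi_comp_measurable) auto
    show "AE x in M. norm (\<phi> x (c * norm (v x))) \<le> norm (K * \<phi> x (norm (v x)))"
      using K \<open>0 \<le> c\<close> by (intro AE_I2) (auto simp: phi_nonneg intro: order_trans[OF _ abs_ge_self])
  qed
qed

lemma integrable_phi_add:
  fixes v w :: "'a \<Rightarrow> 'b::euclidean_space"
  assumes v [measurable]: "v \<in> borel_measurable M" "integrable M (\<lambda>x. \<phi> x (norm (v x)))"
    and w [measurable]: "w \<in> borel_measurable M" "integrable M (\<lambda>x. \<phi> x (norm (w x)))"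
  shows "integrable M (\<lambda>x. \<phi> x (norm (v x) + norm (w x)))"
    and "integrable M (\<lambda>x. \<phi> x (norm (v x + w x)))"
proof -
  show 1: "integrable M (\<lambda>x. \<phi> x (norm (v x) + norm (w x)))"
  proof (rule Bochner_Integration.integrable_bound)
    show "integrable M (\<lambda>x. \<phi> x (2 * norm (v x)) + \<phi> x (2 * norm (w x)))"
      using v w by (intro Bochner_Integration.integrable_add integrable_phi_scale) auto
    show "(\<lambda>x. \<phi> x (norm (v x) + norm (w x))) \<in> borel_measurable M"
      by (intro phi_comp_measurable) auto
    show "AE x in M. norm (\<phi> x (norm (v x) + norm (w x))) \<le> norm (\<phi> x (2 * norm (v x)) + \<phi> x (2 * norm (w x)))"
      by (intro AE_I2) (auto simp: phi_nonneg phi_add)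
  qed
  show "integrable M (\<lambda>x. \<phi> x (norm (v x + w x)))"
    by (rule Bochner_Integration.integrable_bound[OF 1 phi_norm_measurable])
      (auto intro!: AE_I2 phi_le simp: phi_nonneg norm_triangle_ineq)
qed

lemma phi_norm_convex:
  fixes a b :: "'b::real_normed_vector"
  assumes "0 \<le> t" "t \<le> 1"
  shows "\<phi> x (norm ((1 - t) *\<^sub>R a + t *\<^sub>R b)) \<le> (1 - t) * \<phi> x (norm a) + t * \<phi> x (norm b)"
proof -
  have "norm ((1 - t) *\<^sub>R a + t *\<^sub>R b) \<le> (1 - t) * norm a + t * norm b"
    using norm_triangle_ineq[of "(1 - t) *\<^sub>R a" "t *\<^sub>R b"] assms by simp
  then have "\<phi> x (norm ((1 - t) *\<^sub>R a + t *\<^sub>R b)) \<le> \<phi> x ((1 - t) * norm a + t * norm b)"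
    by (intro phi_le) auto
  also have "\<dots> \<le> (1 - t) * \<phi> x (norm a) + t * \<phi> x (norm b)"
    using convex_onD[OF phi_convex, of t "norm a" "norm b" x] assms by simp
  finally show ?thesis .
qed

lemma continuous_phi_norm: "continuous_on UNIV (\<lambda>z. \<phi> x (norm z))"
  by (rule continuous_on_compose2[OF phi_cont continuous_on_norm_id]) auto

text \<open>Membership in the primal space with an explicit representative of the gradient, which
  keeps sums and limits free of the choice in \<open>weak_gradient\<close>.\<close>

definition adm :: "('a \<Rightarrow> real) \<Rightarrow> ('a \<Rightarrow> 'a) \<Rightarrow> bool" where
  "adm u g \<longleftrightarrow> has_weak_gradient \<Omega> u g \<and> integrable M u \<and> integrable M g \<and>
     integrable M (\<lambda>x. (u x)\<^sup>2) \<and> integrable M (\<lambda>x. \<phi> x (norm (g x)))"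

text \<open>Function and gradient form one vector in a product space, so the convergence results for
  \<open>bracket\<close> apply to both at once.\<close>

definition density :: "'a \<Rightarrow> real \<times> 'a \<Rightarrow> real" where
  "density x w = (fst w - f x)\<^sup>2 / 2 + \<phi> x (norm (snd w))"

lemma density_nonneg: "0 \<le> density x w"
  by (simp add: density_def phi_nonneg)

definition energy :: "('a \<Rightarrow> real) \<Rightarrow> ('a \<Rightarrow> 'a) \<Rightarrow> real" where
  "energy u g = (\<integral>x. density x (u x, g x) \<partial>M)"

lemma f_facts: "f \<in> borel_measurable M" "integrable M (\<lambda>x. (f x)\<^sup>2)" "integrable M f"
proof -
  show 1: "f \<in> borel_measurable M" "integrable M (\<lambda>x. (f x)\<^sup>2)" using f_L2 by (auto simp: L2_def)
  show "integrable M f" using 1 by (rule square_integrable_imp_integrable)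
qed

lemma integrable_square_add:
  fixes u v :: "'a \<Rightarrow> real"
  assumes u [measurable]: "u \<in> borel_measurable M" "integrable M (\<lambda>x. (u x)\<^sup>2)"
    and v [measurable]: "v \<in> borel_measurable M" "integrable M (\<lambda>x. (v x)\<^sup>2)"
  shows "integrable M (\<lambda>x. u x * v x)" "integrable M (\<lambda>x. (u x + v x)\<^sup>2)" "integrable M (\<lambda>x. (u x - v x)\<^sup>2)"
proof -
  show uv: "integrable M (\<lambda>x. u x * v x)"
  proof (rule Bochner_Integration.integrable_bound)
    show "integrable M (\<lambda>x. (u x)\<^sup>2 + (v x)\<^sup>2)" using u v by simp
    have "\<bar>u x * v x\<bar> \<le> (u x)\<^sup>2 + (v x)\<^sup>2" for x
    proof -
      have "2 * (\<bar>u x\<bar> * \<bar>v x\<bar>) \<le> (u x)\<^sup>2 + (v x)\<^sup>2"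
        using sum_squares_bound[of "\<bar>u x\<bar>" "\<bar>v x\<bar>"] by (simp add: mult.assoc)
      moreover have "0 \<le> \<bar>u x\<bar> * \<bar>v x\<bar>" by simp
      ultimately show ?thesis unfolding abs_mult by linarith
    qed
    then show "AE x in M. norm (u x * v x) \<le> norm ((u x)\<^sup>2 + (v x)\<^sup>2)" by simp
  qed measurable
  show "integrable M (\<lambda>x. (u x + v x)\<^sup>2)" "integrable M (\<lambda>x. (u x - v x)\<^sup>2)"
    using u v uv by (auto simp: power2_sum power2_diff mult.assoc)
qed

lemma admD:
  assumes "adm u g"
  shows "u \<in> borel_measurable M" "g \<in> borel_measurable M" "integrable M u" "integrable M g"
    "integrable M (\<lambda>x. (u x)\<^sup>2)" "integrable M (\<lambda>x. \<phi> x (norm (g x)))" "has_weak_gradient \<Omega> u g"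
    "integrable M (\<lambda>x. (u x - f x)\<^sup>2)"
    "integrable M (\<lambda>x. density x (u x, g x))"
proof -
  show u: "u \<in> borel_measurable M" and "g \<in> borel_measurable M" and "integrable M u" and "integrable M g"
    and u2: "integrable M (\<lambda>x. (u x)\<^sup>2)" and g: "integrable M (\<lambda>x. \<phi> x (norm (g x)))"
    and "has_weak_gradient \<Omega> u g"
    using assms by (auto simp: adm_def)
  show "integrable M (\<lambda>x. (u x - f x)\<^sup>2)"
    by (rule integrable_square_add(3)[OF u u2 f_facts(1,2)])
  with g show "integrable M (\<lambda>x. density x (u x, g x))"
    by (simp add: density_def)
qed

lemma energy_eq:
  assumes "adm u g"
  shows "energy u g = (\<integral>x. (u x - f x)\<^sup>2 \<partial>M) / 2 + (\<integral>x. \<phi> x (norm (g x)) \<partial>M)"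
  using admD[OF assms] by (simp add: energy_def density_def)

lemma energy_nonneg: "0 \<le> energy u g"
  unfolding energy_def by (intro Bochner_Integration.integral_nonneg density_nonneg)

lemma has_weak_gradient_add:
  assumes "has_weak_gradient \<Omega> u g" "has_weak_gradient \<Omega> v h"
  shows "has_weak_gradient \<Omega> (\<lambda>x. a * u x + b * v x) (\<lambda>x. a *\<^sub>R g x + b *\<^sub>R h x)"
proof -
  have loc: "locally_integrable \<Omega> u" "locally_integrable \<Omega> v" "locally_integrable \<Omega> g" "locally_integrable \<Omega> h"
    using assms by (auto simp: has_weak_gradient_def)
  show ?thesis
    unfolding has_weak_gradient_def
  proof (intro conjI ballI)
    show "locally_integrable \<Omega> (\<lambda>x. a * u x + b * v x)" "locally_integrable \<Omega> (\<lambda>x. a *\<^sub>R g x + b *\<^sub>R h x)"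
      using loc by (auto simp: locally_integrable_def)
    fix \<psi> assume \<psi>: "\<psi> \<in> test_functions \<Omega>"
    note I = integrable_mult_grad_test[OF loc(1) open_dom \<psi>] integrable_mult_grad_test[OF loc(2) open_dom \<psi>]
      integrable_test_mult[OF loc(3) open_dom \<psi>] integrable_test_mult[OF loc(4) open_dom \<psi>]
    have "(\<integral>x. (a * u x + b * v x) *\<^sub>R grad \<psi> x \<partial>M)
        = (\<integral>x. a *\<^sub>R (u x *\<^sub>R grad \<psi> x) + b *\<^sub>R (v x *\<^sub>R grad \<psi> x) \<partial>M)"
      by (simp add: scaleR_add_left)
    also have "\<dots> = a *\<^sub>R (\<integral>x. u x *\<^sub>R grad \<psi> x \<partial>M) + b *\<^sub>R (\<integral>x. v x *\<^sub>R grad \<psi> x \<partial>M)"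
      using I by (simp del: scaleR_scaleR)
    also have "\<dots> = - (a *\<^sub>R (\<integral>x. \<psi> x *\<^sub>R g x \<partial>M) + b *\<^sub>R (\<integral>x. \<psi> x *\<^sub>R h x \<partial>M))"
      using assms \<psi> by (simp add: has_weak_gradient_def)
    also have "a *\<^sub>R (\<integral>x. \<psi> x *\<^sub>R g x \<partial>M) + b *\<^sub>R (\<integral>x. \<psi> x *\<^sub>R h x \<partial>M)
        = (\<integral>x. a *\<^sub>R (\<psi> x *\<^sub>R g x) + b *\<^sub>R (\<psi> x *\<^sub>R h x) \<partial>M)"
      using I by (simp del: scaleR_scaleR)
    also have "\<dots> = (\<integral>x. \<psi> x *\<^sub>R (a *\<^sub>R g x + b *\<^sub>R h x) \<partial>M)"
      by (simp add: scaleR_add_right mult.commute)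
    finally show "(\<integral>x. (a * u x + b * v x) *\<^sub>R grad \<psi> x \<partial>M)
        = - (\<integral>x. \<psi> x *\<^sub>R (a *\<^sub>R g x + b *\<^sub>R h x) \<partial>M)" .
  qed
qed

lemma adm_add:
  assumes u: "adm u g" and v: "adm v h"
  shows "adm (\<lambda>x. a * u x + b * v x) (\<lambda>x. a *\<^sub>R g x + b *\<^sub>R h x)"
  unfolding adm_def
proof (intro conjI)
  note U = admD[OF u] and V = admD[OF v]
  show "has_weak_gradient \<Omega> (\<lambda>x. a * u x + b * v x) (\<lambda>x. a *\<^sub>R g x + b *\<^sub>R h x)"
    using U V by (intro has_weak_gradient_add) auto
  show "integrable M (\<lambda>x. a * u x + b * v x)" "integrable M (\<lambda>x. a *\<^sub>R g x + b *\<^sub>R h x)"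
    using U V by auto
  show "integrable M (\<lambda>x. (a * u x + b * v x)\<^sup>2)"
    using U V by (intro integrable_square_add) (auto simp: power_mult_distrib)
  show "integrable M (\<lambda>x. \<phi> x (norm (a *\<^sub>R g x + b *\<^sub>R h x)))"
    using U V by (intro integrable_phi_add) (auto intro: integrable_phi_scale)
qed

text \<open>A bounded gradient has finite modular because \<open>\<phi> x B\<close> is integrable
  for each constant \<open>B\<close>.\<close>

lemma adm_test_function:
  assumes "\<psi> \<in> test_functions \<Omega>"
  shows "adm \<psi> (grad \<psi>)"
proof -
  obtain K B where K: "continuous_on UNIV \<psi>" "continuous_on UNIV (grad \<psi>)" 
    and B: "\<And>x. \<bar>\<psi> x\<bar> \<le> B" "\<And>x. norm (grad \<psi> x) \<le> B"
    using test_function_facts[OF assms] by metis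
  have [measurable]: "\<psi> \<in> borel_measurable M" "grad \<psi> \<in> borel_measurable M"
    using K by (auto intro: continuous_on_borel_measurable_lebesgue_on)
  have "0 \<le> B" using B(1) abs_ge_zero order_trans by blast
  show ?thesis
    unfolding adm_def
  proof (intro conjI has_weak_gradient_test_function open_dom assms)
    show "integrable M \<psi>" "integrable M (grad \<psi>)"
      using B by (auto intro!: integrable_const_bound[of _ B])
    show "integrable M (\<lambda>x. (\<psi> x)\<^sup>2)"
      using B(1) \<open>0 \<le> B\<close> by (intro integrable_const_bound[of _ "B\<^sup>2"]) (auto simp: abs_le_square_iff[symmetric])
    show "integrable M (\<lambda>x. \<phi> x (norm (grad \<psi> x)))"
      by (rule Bochner_Integration.integrable_bound[OF phi_int[OF \<open>0 \<le> B\<close>] phi_norm_measurable])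
        (use B \<open>0 \<le> B\<close> in \<open>auto intro!: AE_I2 phi_le simp: phi_nonneg\<close>)
  qed
qed

lemma adm_zero: "adm (\<lambda>x. 0) (\<lambda>x. 0)"
  using open_dom by (auto simp: adm_def has_weak_gradient_def phi_0 locally_integrable_def)

lemma X_space_iff: "u \<in> X_space \<Omega> \<phi> \<longleftrightarrow> adm u (weak_gradient \<Omega> u)"
  and adm_imp_X: "adm u g \<Longrightarrow> u \<in> X_space \<Omega> \<phi> \<and> (AE x in M. weak_gradient \<Omega> u x = g x)"
proof -
  have AE: "AE x in M. weak_gradient \<Omega> u x = g x" if "has_weak_gradient \<Omega> u g" for u g
    using open_dom that by (rule weak_gradient_eq_AE)
  have X: "u \<in> X_space \<Omega> \<phi>" if "adm u g" for u g
  proof -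
    note U = admD[OF that]
    have "modular \<Omega> \<phi> (weak_gradient \<Omega> u) = (\<integral>\<^sup>+x. ennreal (\<phi> x (norm (g x))) \<partial>M)"
      unfolding modular_def
    proof (rule nn_integral_cong_AE)
      show "AE x in M. ennreal (\<phi> x (norm (weak_gradient \<Omega> u x))) = ennreal (\<phi> x (norm (g x)))"
        using AE[OF U(7)] by eventually_elim simp
    qed
    also have "\<dots> < \<infinity>"
      using U(6) by (subst nn_integral_eq_integral) (auto simp: phi_nonneg)
    finally show ?thesis
      using U by (auto simp: X_space_def L2_def W11_def)
  qed
  show "u \<in> X_space \<Omega> \<phi> \<and> (AE x in M. weak_gradient \<Omega> u x = g x)" if "adm u g"
    using X[OF that] AE admD(7)[OF that] by auto
  show "u \<in> X_space \<Omega> \<phi> \<longleftrightarrow> adm u (weak_gradient \<Omega> u)"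
  proof
    assume u: "u \<in> X_space \<Omega> \<phi>"
    then obtain g where g: "has_weak_gradient \<Omega> u g" "integrable M g" "integrable M u" "integrable M (\<lambda>x. (u x)\<^sup>2)"
      by (auto simp: X_space_def W11_def L2_def)
    have "has_weak_gradient \<Omega> u (weak_gradient \<Omega> u)"
      unfolding weak_gradient_def by (rule someI[of "has_weak_gradient \<Omega> u", OF g(1)])
    moreover have m: "weak_gradient \<Omega> u \<in> borel_measurable M"
    proof (rule borel_measurable_lebesgue_on_AE[OF dom_sets])
      show "g \<in> borel_measurable M" using g(2) by (rule borel_measurable_integrable)
      show "AE x in M. g x = weak_gradient \<Omega> u x" using AE[OF g(1)] by eventually_elim simp
    qed
    moreover have "integrable M (weak_gradient \<Omega> u)"
      using integrable_cong_AE[OF m borel_measurable_integrable[OF g(2)] AE[OF g(1)]] g(2) by simp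
    moreover have "integrable M (\<lambda>x. \<phi> x (norm (weak_gradient \<Omega> u x)))"
      using u m by (intro integrableI_nonneg phi_norm_measurable)
        (auto simp: X_space_def modular_def phi_nonneg)
    ultimately show "adm u (weak_gradient \<Omega> u)" using g by (simp add: adm_def)
  qed (rule X)
qed

lemma primal_eq:
  assumes "u \<in> X_space \<Omega> \<phi>"
  shows "primal \<Omega> \<phi> f u = ennreal (energy u (weak_gradient \<Omega> u))"
proof -
  have adm: "adm u (weak_gradient \<Omega> u)" using assms by (simp add: X_space_iff)
  note U = admD[OF this]
  have "modular \<Omega> \<phi> (weak_gradient \<Omega> u) = ennreal (\<integral>x. \<phi> x (norm (weak_gradient \<Omega> u x)) \<partial>M)"
    unfolding modular_def using U(6) by (intro nn_integral_eq_integral) (auto simp: phi_nonneg)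
  moreover have "0 \<le> (\<integral>x. \<phi> x (norm (weak_gradient \<Omega> u x)) \<partial>M)"
    by (intro Bochner_Integration.integral_nonneg) (simp add: phi_nonneg)
  ultimately show ?thesis
    unfolding primal_def norm_L2_def energy_eq[OF adm]
    by (subst real_sqrt_pow2) (auto simp flip: ennreal_plus)
qed

lemma energy_cong_AE:
  assumes "adm u g" "adm u h" "AE x in M. g x = h x"
  shows "energy u g = energy u h"
  unfolding energy_def using assms admD(9)
  by (intro integral_cong_AE) (auto intro: borel_measurable_integrable)

end

lemma tendsto_integral_dominated_L1:
  fixes w :: "nat \<Rightarrow> 'a \<Rightarrow> 'b::{banach, second_countable_topology}"
    and F :: "nat \<Rightarrow> 'a \<Rightarrow> 'c::{banach, second_countable_topology}"
  assumes lim: "(\<lambda>n. \<integral>x. norm (w n x - v x) \<partial>M) \<longlonglongrightarrow> 0"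
    and w: "\<And>n. integrable M (w n)" "integrable M v" and F: "\<And>n. integrable M (F n)" "integrable M G"
    and le: "\<And>n x. norm (F n x - G x) \<le> B * norm (w n x - v x)"
  shows "(\<lambda>n. integral\<^sup>L M (F n)) \<longlonglongrightarrow> integral\<^sup>L M G"
proof -
  have B: "(\<lambda>n. B * (\<integral>x. norm (w n x - v x) \<partial>M)) \<longlonglongrightarrow> 0"
    using tendsto_mult_left[OF lim, of B] by simp
  have "\<forall>\<^sub>F n in sequentially. norm (integral\<^sup>L M (F n) - integral\<^sup>L M G) \<le> B * (\<integral>x. norm (w n x - v x) \<partial>M)"
  proof (intro always_eventually allI)
    fix n
    have "norm (integral\<^sup>L M (F n) - integral\<^sup>L M G) = norm (\<integral>x. F n x - G x \<partial>M)"
      using F by simp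
    also have "\<dots> \<le> (\<integral>x. norm (F n x - G x) \<partial>M)" by (rule integral_norm_bound)
    also have "\<dots> \<le> (\<integral>x. B * norm (w n x - v x) \<partial>M)"
      using F w le by (intro integral_mono) auto
    finally show "norm (integral\<^sup>L M (F n) - integral\<^sup>L M G) \<le> B * (\<integral>x. norm (w n x - v x) \<partial>M)" by simp
  qed
  from Lim_null_comparison[OF this B] show ?thesis by (simp flip: Lim_null)
qed

section \<open>Coercivity and the direct method\<close>

context phi_growth
begin

text \<open>Superlinear growth with slope \<open>1 / \<epsilon>\<close> bounds the gradient part.
  For the function part, \<open>0 \<le> (\<epsilon> * s - 1)\<^sup>2\<close> trades \<open>s\<close>
  for \<open>\<epsilon> * (s\<^sup>2 / 2) + 1 / (2 * \<epsilon>)\<close>. The three summands of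
  \<open>b\<close> come from the shift by \<open>f\<close>, from this square and from the growth
  constant.\<close>

lemma density_coercive:
  assumes "0 < \<epsilon>"
  shows "\<exists>b. integrable M b \<and> (AE x in M. \<forall>w. norm w \<le> \<epsilon> * density x w + b x)"
proof -
  obtain T where T: "AE x in M. \<forall>t\<ge>0. (1 / \<epsilon>) * t \<le> \<phi> x t + T"
    using superlinear[of "1 / \<epsilon>"] assms by auto
  define b where "b x = \<bar>f x\<bar> + 1 / (2 * \<epsilon>) + \<epsilon> * T" for x
  have "integrable M b" using f_facts by (simp add: b_def[abs_def])
  moreover have "AE x in M. \<forall>w. norm w \<le> \<epsilon> * density x w + b x"
    using T
  proof eventually_elim
    case (elim x)
    show ?case
    proof
      fix w :: "real \<times> 'a"
      define s t where "s = \<bar>fst w - f x\<bar>" and "t = norm (snd w)"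
      have "norm w \<le> \<bar>fst w\<bar> + t"
        using norm_Pair_le[of "fst w" "snd w"] by (simp add: t_def)
      then have 1: "norm w \<le> \<bar>f x\<bar> + s + t" by (simp add: s_def)
      have "(1 / \<epsilon>) * t \<le> \<phi> x t + T" using elim by (simp add: t_def)
      then have "\<epsilon> * ((1 / \<epsilon>) * t) \<le> \<epsilon> * (\<phi> x t + T)" using assms by (intro mult_left_mono) auto
      then have 2: "t \<le> \<epsilon> * \<phi> x t + \<epsilon> * T" using assms by (simp add: distrib_left)
      have "0 \<le> (\<epsilon> * s - 1)\<^sup>2 / (2 * \<epsilon>)" using assms by simp
      also have "\<dots> = \<epsilon> * (s\<^sup>2 / 2) + 1 / (2 * \<epsilon>) - s"
        using assms by (simp add: power2_eq_square field_simps)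
      finally have 3: "s \<le> \<epsilon> * (s\<^sup>2 / 2) + 1 / (2 * \<epsilon>)" by simp
      have "\<epsilon> * density x w = \<epsilon> * (s\<^sup>2 / 2) + \<epsilon> * \<phi> x t"
        by (simp add: density_def s_def t_def distrib_left)
      with 1 2 3 show "norm w \<le> \<epsilon> * density x w + b x" unfolding b_def by linarith
    qed
  qed
  ultimately show ?thesis by blast
qed

lemma density_convex:
  "density x ((1/2) *\<^sub>R (a + b)) \<le> (density x a + density x b) / 2"
proof -
  have "(fst ((1/2) *\<^sub>R (a + b)) - f x)\<^sup>2 \<le> ((fst a - f x)\<^sup>2 + (fst b - f x)\<^sup>2) / 2"
  proof -
    have "0 \<le> (fst a - fst b)\<^sup>2" by simp
    then show ?thesis by (simp add: power2_eq_square field_simps)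
  qed
  moreover have "\<phi> x (norm (snd ((1/2) *\<^sub>R (a + b)))) \<le> (\<phi> x (norm (snd a)) + \<phi> x (norm (snd b))) / 2"
    using phi_norm_convex[of "1/2" x "snd a" "snd b"] by (simp add: scaleR_add_right)
  ultimately show ?thesis by (simp add: density_def field_simps)
qed

lemma density_measurable:
  assumes [measurable]: "w \<in> borel_measurable M"
  shows "(\<lambda>x. density x (w x)) \<in> borel_measurable M"
proof -
  have [measurable]: "(\<lambda>x. fst (w x)) \<in> borel_measurable M" "(\<lambda>x. snd (w x)) \<in> borel_measurable M"
    by (auto intro!: measurable_compose[OF assms] borel_measurable_continuous_onI continuous_intros)
  have "(\<lambda>x. \<phi> x (norm (snd (w x)))) \<in> borel_measurable M"
    by (rule phi_norm_measurable) measurable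
  then show ?thesis unfolding density_def using f_facts(1) by measurable
qed

lemma density_tendsto:
  assumes "(\<lambda>n. p n) \<longlonglongrightarrow> w"
  shows "(\<lambda>n. density x (p n)) \<longlonglongrightarrow> density x w"
proof -
  have "(\<lambda>n. \<phi> x (norm (snd (p n)))) \<longlonglongrightarrow> \<phi> x (norm (snd w))"
    by (rule continuous_on_tendsto_compose[OF continuous_phi_norm tendsto_snd[OF assms]]) auto
  then show ?thesis unfolding density_def by (intro tendsto_intros assms) auto
qed

text \<open>A minimizing sequence need not converge almost everywhere, since \<phi> may have affine
  pieces. Therefore the sequence is chosen in two stages: \<open>P n\<close> collects
  near-minimizers of the energy, and within \<open>P n\<close> the integral of
  \<open>bracket\<close> is nearly minimized. Fatou's lemma gives lower semicontinuity along the
  limit; coercivity upgrades the convergence to \<open>L1\<close>, which the identity defining the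
  weak gradient needs.\<close>

lemma exists_energy_minimizer:
  obtains u g where "adm u g" "\<And>v h. adm v h \<Longrightarrow> energy u g \<le> energy v h"
proof -
  define E where "E w = energy (\<lambda>x. fst (w x)) (\<lambda>x. snd (w x))" for w
  define A where "A = {w. adm (\<lambda>x. fst (w x)) (\<lambda>x. snd (w x))}"
  define I where "I = Inf (E ` A)"
  define P where "P n = {w \<in> A. E w < I + 1 / real (Suc n)}" for n
  have E: "E w = (\<integral>x. density x (w x) \<partial>M)" for w by (simp add: E_def energy_def)
  have bdd: "bdd_below (E ` A)" by (intro bdd_belowI2[of _ 0]) (simp add: E_def energy_nonneg)
  have "(\<lambda>x. (0, 0)) \<in> A" by (simp add: A_def adm_zero)
  then have ne: "A \<noteq> {}" by blast
  have I: "I \<le> E w" if "w \<in> A" for w unfolding I_def using that bdd by (intro cInf_lower) auto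
  have A: "w \<in> borel_measurable M" "integrable M (\<lambda>x. density x (w x))" if "w \<in> A" for w
  proof -
    have adm: "adm (\<lambda>x. fst (w x)) (\<lambda>x. snd (w x))" using that by (simp add: A_def)
    show "integrable M (\<lambda>x. density x (w x))" using admD(9)[OF adm] by simp
    show "w \<in> borel_measurable M"
      using borel_measurable_Pair[OF admD(1,2)[OF adm]] by simp
  qed
  obtain b where b: "integrable M b" "AE x in M. \<forall>w. norm w \<le> 1 * density x w + b x"
    using density_coercive[of 1] by auto
  \<comment> \<open>Pointwise \<open>bracket w \<le> 1 + norm w \<le> 1 + b x + density x w\<close>,
    and the energies in \<open>P 0\<close> lie below \<open>I + 1\<close>.\<close>
  define B where "B = (\<integral>x. 1 + b x \<partial>M) + I + 1"
  have P0: "P n \<subseteq> P 0" for n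
  proof -
    have "1 / real (Suc n) \<le> 1" by simp
    then have "E w < I + 1" if "E w < I + 1 / real (Suc n)" for w using that by linarith
    then show ?thesis by (auto simp: P_def)
  qed
  have bracket: "integrable M (\<lambda>x. bracket (w x))" "(\<integral>x. bracket (w x) \<partial>M) \<le> B" if w: "w \<in> P 0" for w
  proof -
    have wA: "w \<in> A" "E w < I + 1" using w by (auto simp: P_def)
    note [measurable] = A(1)[OF wA(1)]
    have int: "integrable M (\<lambda>x. (1 + b x) + density x (w x))" using A[OF wA(1)] b by simp
    have le: "AE x in M. bracket (w x) \<le> (1 + b x) + density x (w x)"
      using b(2)
    proof eventually_elim
      case (elim x)
      then have "norm (w x) \<le> 1 * density x (w x) + b x" by blast
      with bracket_bounds(3)[of "w x"] show ?case by linarith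
    qed
    show *: "integrable M (\<lambda>x. bracket (w x))"
    proof (rule Bochner_Integration.integrable_bound[OF int])
      show "AE x in M. norm (bracket (w x)) \<le> norm (1 + b x + density x (w x))"
        using le
      proof eventually_elim
        case (elim x)
        with bracket_bounds(1)[of "w x"] show ?case by simp
      qed
    qed measurable
    have "(\<integral>x. bracket (w x) \<partial>M) \<le> (\<integral>x. (1 + b x) + density x (w x) \<partial>M)"
      by (rule integral_mono_AE[OF * int le])
    also have "\<dots> = (\<integral>x. 1 + b x \<partial>M) + E w"
      using A[OF wA(1)] b by (simp add: E)
    finally show "(\<integral>x. bracket (w x) \<partial>M) \<le> B" using wA by (simp add: B_def)
  qed
  obtain p r w where p: "\<And>n. p n \<in> P n" and r: "strict_mono (r :: nat \<Rightarrow> nat)"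
    and w: "w \<in> borel_measurable M" and lim: "AE x in M. (\<lambda>k. p (r k) x) \<longlonglongrightarrow> w x"
  proof (rule bracket_near_minimizers[of P M B])
    fix p r w
    assume "\<And>n. p n \<in> P n" "strict_mono (r :: nat \<Rightarrow> nat)" "w \<in> borel_measurable M"
      "AE x in M. (\<lambda>k. p (r k) x) \<longlonglongrightarrow> w x"
    then show thesis by (rule that)
  next
    show "P n \<noteq> {}" for n
      using cInf_lessD[of "E ` A" "I + 1 / real (Suc n)"] ne by (auto simp: P_def I_def)
    show "P (Suc n) \<subseteq> P n" for n
    proof -
      have "1 / real (Suc (Suc n)) \<le> 1 / real (Suc n)" by (simp add: field_simps)
      then show ?thesis by (auto simp: P_def)
    qed
    show "(\<lambda>x. (1/2) *\<^sub>R (a x + b x)) \<in> P n" if a: "a \<in> P n" and b: "b \<in> P n" for n a b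
    proof -
      have ab: "a \<in> A" "b \<in> A" "E a < I + 1 / real (Suc n)" "E b < I + 1 / real (Suc n)"
        using a b by (auto simp: P_def)
      have "adm (\<lambda>x. 1/2 * fst (a x) + 1/2 * fst (b x)) (\<lambda>x. (1/2) *\<^sub>R snd (a x) + (1/2) *\<^sub>R snd (b x))"
        using ab by (intro adm_add) (auto simp: A_def)
      then have m: "(\<lambda>x. (1/2) *\<^sub>R (a x + b x)) \<in> A"
        by (simp add: A_def scaleR_add_right distrib_left)
      have "E (\<lambda>x. (1/2) *\<^sub>R (a x + b x)) \<le> (\<integral>x. (density x (a x) + density x (b x)) / 2 \<partial>M)"
        unfolding E using A(2)[OF m] A(2)[OF ab(1)] A(2)[OF ab(2)]
        by (intro integral_mono density_convex) auto
      also have "\<dots> = E a / 2 + E b / 2"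
        using A(2)[OF ab(1)] A(2)[OF ab(2)] by (simp add: E add_divide_distrib)
      finally show ?thesis using m ab by (simp add: P_def)
    qed
    show "a \<in> borel_measurable M" if "a \<in> P 0" for a using A that by (auto simp: P_def)
  qed (use bracket in auto)
  define a where "a n x = density x (p (r n) x)" for n x
  have pA: "p n \<in> A" "E (p n) \<le> I + 1 / real (Suc n)" for n using p[of n] by (auto simp: P_def)
  have a: "integrable M (a n)" "0 \<le> a n x" "integral\<^sup>L M (a n) \<le> I + 1 / real (Suc (r n))" for n x
    using A(2)[OF pA(1)] pA(2)[of "r n"] by (auto simp: a_def[abs_def] density_nonneg E)
  have c: "integrable M (\<lambda>x. density x (w x))" "(\<integral>x. density x (w x) \<partial>M) \<le> I"
  proof -
    have b': "(\<lambda>n. I + 1 / real (Suc (r n))) \<longlonglongrightarrow> I"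
      using LIMSEQ_subseq_LIMSEQ[OF tendsto_add[OF tendsto_const LIMSEQ_Suc[OF lim_1_over_n]] r, of I]
      by (simp add: o_def)
    have lim': "AE x in M. (\<lambda>n. a n x) \<longlonglongrightarrow> density x (w x)"
      using lim unfolding a_def by eventually_elim (rule density_tendsto)
    show "integrable M (\<lambda>x. density x (w x))" "(\<integral>x. density x (w x) \<partial>M) \<le> I"
      by (rule Fatou_limit[OF a(1,2,3) b' lim' density_measurable[OF w] density_nonneg])+
  qed
  have L1: "\<And>n. integrable M (p (r n))" "integrable M w" "(\<lambda>n. \<integral>x. norm (p (r n) x - w x) \<partial>M) \<longlonglongrightarrow> 0"
  proof -
    have B1: "integral\<^sup>L M (a n) \<le> I + 1" for n
    proof -
      have "1 / real (Suc (r n)) \<le> 1" by simp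
      with a(3)[of n] show ?thesis by linarith
    qed
    have coercive: "\<exists>b. integrable M b \<and> (AE x in M. (\<forall>n. norm (p (r n) x) \<le> \<epsilon> * a n x + b x)
        \<and> norm (w x) \<le> \<epsilon> * density x (w x) + b x)" if \<epsilon>: "0 < \<epsilon>" for \<epsilon>
    proof -
      obtain b where b: "integrable M b" "AE x in M. \<forall>w. norm w \<le> \<epsilon> * density x w + b x"
        using density_coercive[OF \<epsilon>] by auto
      have "AE x in M. (\<forall>n. norm (p (r n) x) \<le> \<epsilon> * a n x + b x)
        \<and> norm (w x) \<le> \<epsilon> * density x (w x) + b x"
        using b(2)
      proof eventually_elim
        case (elim x)
        then show ?case unfolding a_def by blast
      qed
      with b(1) show ?thesis by blast
    qed
    have c2: "(\<integral>x. density x (w x) \<partial>M) \<le> I + 1" using c(2) by simp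
    note * = L1_limit_of_coercive_bound[OF A(1)[OF pA(1)] w lim a(1) B1 a(2) c(1) c2 density_nonneg coercive]
    show "\<And>n. integrable M (p (r n))" "integrable M w" "(\<lambda>n. \<integral>x. norm (p (r n) x - w x) \<partial>M) \<longlonglongrightarrow> 0"
      using * by auto
  qed
  define u g where "u x = fst (w x)" and "g x = snd (w x)" for x
  have int: "integrable M u" "integrable M g"
    using L1(2) by (auto simp: u_def[abs_def] g_def[abs_def]
        intro: integrable_bounded_linear[OF bounded_linear_fst] integrable_bounded_linear[OF bounded_linear_snd])
  have [measurable]: "u \<in> borel_measurable M" "g \<in> borel_measurable M" using int by auto
  have wug: "w x = (u x, g x)" for x by (simp add: u_def g_def)
  have "has_weak_gradient \<Omega> u g"
    unfolding has_weak_gradient_def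
  proof (intro conjI ballI)
    show loc: "locally_integrable \<Omega> u" "locally_integrable \<Omega> g"
      using int open_dom by (auto intro: integrable_imp_locally_integrable)
    fix \<psi> assume \<psi>: "\<psi> \<in> test_functions \<Omega>"
    obtain K B where B: "\<And>x. \<bar>\<psi> x\<bar> \<le> B" "\<And>x. norm (grad \<psi> x) \<le> B"
      using test_function_facts[OF \<psi>] by metis
    have proj: "norm (fst y) \<le> norm y" "norm (snd y) \<le> norm y" for y :: "real \<times> 'a"
      using norm_fst_le[of "fst y" "snd y"] norm_snd_le[of "snd y" "fst y"] by auto
    have adm: "adm (\<lambda>x. fst (p (r n) x)) (\<lambda>x. snd (p (r n) x))" for n
      using pA(1) by (simp add: A_def)
    have wg: "has_weak_gradient \<Omega> (\<lambda>x. fst (p (r n) x)) (\<lambda>x. snd (p (r n) x))" for n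
      using admD(7)[OF adm] .
    have 1: "(\<lambda>n. \<integral>x. fst (p (r n) x) *\<^sub>R grad \<psi> x \<partial>M) \<longlonglongrightarrow> (\<integral>x. u x *\<^sub>R grad \<psi> x \<partial>M)"
    proof (rule tendsto_integral_dominated_L1[OF L1(3,1,2), where B = B])
      show "integrable M (\<lambda>x. u x *\<^sub>R grad \<psi> x)"
        by (rule integrable_mult_grad_test[OF loc(1) open_dom \<psi>])
      show "integrable M (\<lambda>x. fst (p (r n) x) *\<^sub>R grad \<psi> x)" for n
        using wg open_dom \<psi> by (intro integrable_mult_grad_test) (auto simp: has_weak_gradient_def)
      show "norm (fst (p (r n) x) *\<^sub>R grad \<psi> x - u x *\<^sub>R grad \<psi> x) \<le> B * norm (p (r n) x - w x)" for n x
      proof -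
        have "norm (fst (p (r n) x) *\<^sub>R grad \<psi> x - u x *\<^sub>R grad \<psi> x)
            = norm (fst (p (r n) x - w x)) * norm (grad \<psi> x)"
          by (simp add: wug flip: scaleR_diff_left)
        also have "\<dots> \<le> norm (p (r n) x - w x) * B"
          using B(2)[of x] by (intro mult_mono proj) auto
        finally show ?thesis by (simp add: mult.commute)
      qed
    qed
    have 2: "(\<lambda>n. \<integral>x. \<psi> x *\<^sub>R snd (p (r n) x) \<partial>M) \<longlonglongrightarrow> (\<integral>x. \<psi> x *\<^sub>R g x \<partial>M)"
    proof (rule tendsto_integral_dominated_L1[OF L1(3,1,2), where B = B])
      show "integrable M (\<lambda>x. \<psi> x *\<^sub>R g x)"
        by (rule integrable_test_mult[OF loc(2) open_dom \<psi>])
      show "integrable M (\<lambda>x. \<psi> x *\<^sub>R snd (p (r n) x))" for n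
        using wg open_dom \<psi> by (intro integrable_test_mult) (auto simp: has_weak_gradient_def)
      show "norm (\<psi> x *\<^sub>R snd (p (r n) x) - \<psi> x *\<^sub>R g x) \<le> B * norm (p (r n) x - w x)" for n x
      proof -
        have "norm (\<psi> x *\<^sub>R snd (p (r n) x) - \<psi> x *\<^sub>R g x)
            = \<bar>\<psi> x\<bar> * norm (snd (p (r n) x - w x))"
          by (simp add: wug flip: scaleR_diff_right)
        also have "\<dots> \<le> B * norm (p (r n) x - w x)"
          using B(1)[of x] by (intro mult_mono proj) auto
        finally show ?thesis .
      qed
    qed
    have "(\<integral>x. fst (p (r n) x) *\<^sub>R grad \<psi> x \<partial>M) = - (\<integral>x. \<psi> x *\<^sub>R snd (p (r n) x) \<partial>M)" for n
      using wg \<psi> by (simp add: has_weak_gradient_def)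
    with 1 tendsto_minus[OF 2] show "(\<integral>x. u x *\<^sub>R grad \<psi> x \<partial>M) = - (\<integral>x. \<psi> x *\<^sub>R g x \<partial>M)"
      by (simp add: LIMSEQ_unique)
  qed
  moreover have "integrable M (\<lambda>x. (u x)\<^sup>2)"
  proof -
    have "integrable M (\<lambda>x. (u x - f x)\<^sup>2)"
    proof (rule Bochner_Integration.integrable_bound)
      show "integrable M (\<lambda>x. 2 * density x (w x))" using c(1) by simp
      show "(\<lambda>x. (u x - f x)\<^sup>2) \<in> borel_measurable M" using f_facts(1) by measurable
      show "AE x in M. norm ((u x - f x)\<^sup>2) \<le> norm (2 * density x (w x))"
        by (intro AE_I2) (simp add: density_def u_def phi_nonneg)
    qed
    from integrable_square_add(2)[OF _ this f_facts(1,2)] show ?thesis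
      using f_facts(1) by simp
  qed
  moreover have "integrable M (\<lambda>x. \<phi> x (norm (g x)))"
  proof (rule Bochner_Integration.integrable_bound[OF c(1)])
    show "(\<lambda>x. \<phi> x (norm (g x))) \<in> borel_measurable M" by (rule phi_norm_measurable) measurable
    show "AE x in M. norm (\<phi> x (norm (g x))) \<le> norm (density x (w x))"
      by (intro AE_I2) (simp add: density_def g_def phi_nonneg)
  qed
  ultimately have adm: "adm u g" using int by (simp add: adm_def)
  show thesis
  proof (rule that[OF adm])
    fix v h assume "adm v h"
    then have "(\<lambda>x. (v x, h x)) \<in> A" by (simp add: A_def)
    from I[OF this] have "I \<le> energy v h" by (simp add: E_def)
    moreover have "energy u g \<le> I" using c(2) by (simp add: energy_def wug)
    ultimately show "energy u g \<le> energy v h" by simp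
  qed
qed

end

section \<open>The Euler--Lagrange relation\<close>

text \<open>The squared norm is a quadratic polynomial in the parameter, hence monotone near
  \<open>0\<close>; the sign of \<open>z \<bullet> y\<close> decides the direction. In the second
  case the bound by \<open>norm z\<close> is recorded because increasing sequences of slopes will
  need an upper bound.\<close>

lemma eventually_monotone_norm_segment:
  fixes z y :: "'b::real_inner"
  obtains N where "\<And>n. N \<le> n \<Longrightarrow> norm (z + inverse (real (Suc (Suc n))) *\<^sub>R y) \<le> norm (z + inverse (real (Suc n)) *\<^sub>R y)"
  | N where "\<And>n. N \<le> n \<Longrightarrow> norm (z + inverse (real (Suc n)) *\<^sub>R y) \<le> norm (z + inverse (real (Suc (Suc n))) *\<^sub>R y)"
    "\<And>n. N \<le> n \<Longrightarrow> norm (z + inverse (real (Suc n)) *\<^sub>R y) \<le> norm z"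
proof -
  define \<theta> where "\<theta> s = (norm (z + s *\<^sub>R y))\<^sup>2" for s :: real
  have \<theta>: "\<theta> s = z \<bullet> z + 2 * s * (z \<bullet> y) + s * s * (y \<bullet> y)" for s
    unfolding \<theta>_def power2_norm_eq_inner
    by (simp add: inner_add_left inner_add_right inner_commute[of y z] algebra_simps)
  have diff: "\<theta> s - \<theta> t = (s - t) * (2 * (z \<bullet> y) + (s + t) * (y \<bullet> y))" for s t
    unfolding \<theta> by (simp add: algebra_simps)
  have le: "norm (z + s *\<^sub>R y) \<le> norm (z + t *\<^sub>R y)" if "\<theta> s - \<theta> t \<le> 0" for s t
  proof (rule power2_le_imp_le)
    show "(norm (z + s *\<^sub>R y))\<^sup>2 \<le> (norm (z + t *\<^sub>R y))\<^sup>2"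
      using that unfolding \<theta>_def by linarith
  qed simp
  have dec: "inverse (real (Suc (Suc n))) \<le> inverse (real (Suc n))" for n by simp
  show thesis
  proof (cases "0 \<le> z \<bullet> y")
    case True
    have "norm (z + inverse (real (Suc (Suc n))) *\<^sub>R y) \<le> norm (z + inverse (real (Suc n)) *\<^sub>R y)" for n
    proof (rule le)
      show "\<theta> (inverse (real (Suc (Suc n)))) - \<theta> (inverse (real (Suc n))) \<le> 0"
        unfolding diff using True dec[of n] by (intro mult_nonpos_nonneg add_nonneg_nonneg) auto
    qed
    then show thesis using that(1)[of 0] by blast
  next
    case False
    then have neg: "z \<bullet> y < 0" and yy: "0 < y \<bullet> y" by auto
    \<comment> \<open>This is the vertex of the quadratic; before it the norm decreases.\<close>
    then have "0 < - (z \<bullet> y) / (y \<bullet> y)" by (intro divide_pos_pos) auto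
    then obtain N where N: "inverse (real (Suc N)) < - (z \<bullet> y) / (y \<bullet> y)"
      by (rule reals_Archimedean[THEN exE])
    have small: "s * (y \<bullet> y) \<le> - (z \<bullet> y)" if "s \<le> inverse (real (Suc N))" for s
    proof -
      have "s < - (z \<bullet> y) / (y \<bullet> y)" using N that by (rule le_less_trans[rotated])
      then show ?thesis using pos_less_divide_eq[OF yy, of s "- (z \<bullet> y)"] by simp
    qed
    have N_le: "inverse (real (Suc n)) \<le> inverse (real (Suc N))" if "N \<le> n" for n
      using that by simp
    have key: "norm (z + s *\<^sub>R y) \<le> norm (z + t *\<^sub>R y)"
      if st: "t \<le> s" "s \<le> inverse (real (Suc N))" for s t
    proof (rule le)
      have "s * (y \<bullet> y) \<le> - (z \<bullet> y)" "t * (y \<bullet> y) \<le> - (z \<bullet> y)"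
        using st by (auto intro: small)
      then have "2 * (z \<bullet> y) + (s + t) * (y \<bullet> y) \<le> 0" by (simp add: distrib_right)
      then show "\<theta> s - \<theta> t \<le> 0"
        unfolding diff using st by (intro mult_nonneg_nonpos) auto
    qed
    show thesis
    proof (rule that(2)[of N])
      fix n assume "N \<le> n"
      then show "norm (z + inverse (real (Suc n)) *\<^sub>R y) \<le> norm (z + inverse (real (Suc (Suc n))) *\<^sub>R y)"
        using dec N_le by (intro key) auto
      show "norm (z + inverse (real (Suc n)) *\<^sub>R y) \<le> norm z"
        using key[of 0 "inverse (real (Suc n))"] N_le[OF \<open>N \<le> n\<close>] by simp
    qed
  qed
qed

text \<open>The right slope may jump at \<open>norm z\<close>, so continuity cannot be invoked, and
  the limit may differ from the slope at \<open>norm z\<close>. Monotone norms give monotone slopes,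
  which are bounded below by \<open>0\<close> or above by the slope at
  \<open>norm z\<close>.\<close>

lemma right_slope_segment_convergent:
  fixes z y :: "'b::real_inner"
  assumes h: "convex_on {0..} h" "mono_on {0..} h"
  shows "convergent (\<lambda>n. right_slope h (norm (z + inverse (real (Suc n)) *\<^sub>R y)))"
proof -
  define q where "q n = right_slope h (norm (z + inverse (real (Suc n)) *\<^sub>R y))" for n
  have q0: "0 \<le> q n" for n unfolding q_def by (rule right_slope(1)[OF h]) simp
  have "convergent q"
  proof (rule eventually_monotone_norm_segment[of z y])
    fix N assume le: "\<And>n. N \<le> n \<Longrightarrow> norm (z + inverse (real (Suc (Suc n))) *\<^sub>R y) \<le> norm (z + inverse (real (Suc n)) *\<^sub>R y)"
    have "decseq (\<lambda>n. q (n + N))"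
      unfolding decseq_Suc_iff q_def using le[of "_ + N"] by (auto intro!: right_slope_mono[OF h])
    from decseq_convergent[OF this, of 0] q0
    obtain L where "(\<lambda>n. q (n + N)) \<longlonglongrightarrow> L" by blast
    then have "convergent (\<lambda>n. q (n + N))" by (auto simp: convergent_def)
    then show ?thesis by (subst (asm) convergent_ignore_initial_segment)
  next
    fix N assume le: "\<And>n. N \<le> n \<Longrightarrow> norm (z + inverse (real (Suc n)) *\<^sub>R y) \<le> norm (z + inverse (real (Suc (Suc n))) *\<^sub>R y)"
     and bd: "\<And>n. N \<le> n \<Longrightarrow> norm (z + inverse (real (Suc n)) *\<^sub>R y) \<le> norm z"
    have "incseq (\<lambda>n. q (n + N))"
      unfolding incseq_Suc_iff q_def using le[of "_ + N"] by (auto intro!: right_slope_mono[OF h])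
    moreover have "q (n + N) \<le> right_slope h (norm z)" for n
      unfolding q_def using bd[of "n + N"] by (intro right_slope_mono[OF h]) auto
    ultimately obtain L where "(\<lambda>n. q (n + N)) \<longlonglongrightarrow> L"
      using incseq_convergent[of "\<lambda>n. q (n + N)"] by blast
    then have "convergent (\<lambda>n. q (n + N))" by (auto simp: convergent_def)
    then show ?thesis by (subst (asm) convergent_ignore_initial_segment)
  qed
  then show ?thesis by (simp add: q_def[abs_def])
qed

text \<open>The direction converges too: at \<open>z = 0\<close> it is constantly
  \<open>sgn y\<close>, elsewhere \<open>sgn\<close> is continuous.\<close>

lemma right_slope_sgn_convergent:
  fixes z y :: "'b::real_inner"
  assumes h: "convex_on {0..} h" "mono_on {0..} h"
  shows "convergent (\<lambda>n. right_slope h (norm (z + inverse (real (Suc n)) *\<^sub>R y)) *\<^sub>R sgn (z + inverse (real (Suc n)) *\<^sub>R y))"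
proof -
  have "convergent (\<lambda>n. sgn (z + inverse (real (Suc n)) *\<^sub>R y))"
  proof (cases "z = 0")
    case True
    have "sgn (inverse (real (Suc n)) *\<^sub>R y) = sgn y" for n
      by (simp add: sgn_scaleR)
    with True show ?thesis by (simp add: convergent_const)
  next
    case False
    have "(\<lambda>n. z + inverse (real (Suc n)) *\<^sub>R y) \<longlonglongrightarrow> z + 0 *\<^sub>R y"
      by (intro tendsto_intros LIMSEQ_inverse_real_of_nat)
    then have "(\<lambda>n. sgn (z + inverse (real (Suc n)) *\<^sub>R y)) \<longlonglongrightarrow> sgn z"
      using False by (intro tendsto_sgn) auto
    then show ?thesis by (auto simp: convergent_def)
  qed
  with right_slope_segment_convergent[OF h, of z y] show ?thesis
    by (auto simp: convergent_def intro: tendsto_scaleR)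
qed

section \<open>Subgradients of the integrand and a measurable selection\<close>

context phi_growth
begin

definition subgrad :: "'a \<Rightarrow> 'a \<Rightarrow> 'a \<Rightarrow> bool" where
  "subgrad x z p \<longleftrightarrow> (\<forall>w. \<phi> x (norm z) + p \<bullet> (w - z) \<le> \<phi> x (norm w))"

text \<open>Test the subgradient inequality at distance \<open>t\<close> from \<open>z\<close> in
  the direction of \<open>p\<close>. The right side is free of \<open>p\<close>; it is the source of
  all majorants below.\<close>

lemma subgrad_bound:
  assumes "subgrad x z p" "0 \<le> t"
  shows "norm p * t \<le> \<phi> x (norm z + t)"
proof (cases "p = 0")
  case False
  define y where "y = (t / norm p) *\<^sub>R p"
  have y: "p \<bullet> y = norm p * t" "norm y = t"
    using False assms(2) by (auto simp: y_def dot_square_norm power2_eq_square)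
  have "\<phi> x (norm z) + p \<bullet> y \<le> \<phi> x (norm (z + y))"
    using assms(1)[unfolded subgrad_def, rule_format, of "z + y"] by simp
  also have "\<dots> \<le> \<phi> x (norm z + t)"
    using norm_triangle_ineq[of z y] y by (intro phi_le) auto
  finally show ?thesis using phi_nonneg[of "norm z" x] y by simp
qed (use assms(2) in \<open>simp add: phi_nonneg\<close>)

lemma subgrad_convex:
  assumes "subgrad x z p" "subgrad x z q" "0 \<le> t" "t \<le> 1"
  shows "subgrad x z ((1 - t) *\<^sub>R p + t *\<^sub>R q)"
  unfolding subgrad_def
proof
  fix w
  have "(1 - t) * (\<phi> x (norm z) + p \<bullet> (w - z)) + t * (\<phi> x (norm z) + q \<bullet> (w - z))
      \<le> (1 - t) * \<phi> x (norm w) + t * \<phi> x (norm w)"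
    using assms by (intro add_mono mult_left_mono) (auto simp: subgrad_def)
  then show "\<phi> x (norm z) + ((1 - t) *\<^sub>R p + t *\<^sub>R q) \<bullet> (w - z) \<le> \<phi> x (norm w)"
    by (simp add: inner_add_left algebra_simps)
qed

lemma subgrad_closed:
  assumes p: "p \<longlonglongrightarrow> q" and z: "z \<longlonglongrightarrow> y" and sub: "\<And>n. subgrad x (z n) (p n)"
  shows "subgrad x y q"
  unfolding subgrad_def
proof
  fix w
  have "(\<lambda>n. \<phi> x (norm (z n))) \<longlonglongrightarrow> \<phi> x (norm y)"
    by (rule continuous_on_tendsto_compose[OF continuous_phi_norm z]) auto
  then have "(\<lambda>n. \<phi> x (norm (z n)) + p n \<bullet> (w - z n)) \<longlonglongrightarrow> \<phi> x (norm y) + q \<bullet> (w - y)"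
    by (intro tendsto_intros p z)
  then show "\<phi> x (norm y) + q \<bullet> (w - y) \<le> \<phi> x (norm w)"
    using sub by (intro LIMSEQ_le_const2) (auto simp: subgrad_def)
qed

text \<open>A canonical subgradient. At \<open>z = 0\<close> it is \<open>0\<close>, as
  \<open>sgn 0 = 0\<close>, and this is a subgradient there because \<phi> is smallest at
  \<open>0\<close>.\<close>

definition selection :: "'a \<Rightarrow> 'a \<Rightarrow> 'a" where
  "selection x z = right_slope (\<phi> x) (norm z) *\<^sub>R sgn z"

lemma subgrad_selection: "subgrad x z (selection x z)"
  unfolding subgrad_def
proof
  fix w
  define D where "D = right_slope (\<phi> x) (norm z)"
  have D: "0 \<le> D" unfolding D_def by (rule right_slope(1)[OF phi_convex phi_mono]) simp
  have "sgn z \<bullet> w \<le> norm (sgn z) * norm w" by (rule norm_cauchy_schwarz)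
  also have "\<dots> \<le> 1 * norm w" by (intro mult_right_mono) (auto simp: norm_sgn)
  finally have "sgn z \<bullet> w \<le> norm w" by simp
  moreover have "sgn z \<bullet> z = norm z"
    by (cases "z = 0") (auto simp: sgn_div_norm dot_square_norm power2_eq_square)
  ultimately have "sgn z \<bullet> (w - z) \<le> norm w - norm z" by (simp add: inner_diff_right)
  then have "selection x z \<bullet> (w - z) \<le> D * (norm w - norm z)"
    using D by (simp add: selection_def D_def[symmetric] mult_left_mono)
  with right_slope(2)[OF phi_convex phi_mono, of "norm z" "norm w" x]
  show "\<phi> x (norm z) + selection x z \<bullet> (w - z) \<le> \<phi> x (norm w)" by (simp add: D_def)
qed

lemma selection_measurable:
  assumes [measurable]: "v \<in> borel_measurable M"
  shows "(\<lambda>x. selection x (v x)) \<in> borel_measurable M"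
proof -
  have [measurable]: "(\<lambda>x. \<phi> x (norm (v x) + inverse (real (Suc n)))) \<in> borel_measurable M"
    "(\<lambda>x. \<phi> x (norm (v x))) \<in> borel_measurable M" for n
    by (rule phi_comp_measurable; simp)+
  have "(\<lambda>x. right_slope (\<phi> x) (norm (v x))) \<in> borel_measurable M"
    unfolding right_slope_def by measurable
  then show ?thesis unfolding selection_def sgn_div_norm by measurable
qed

lemma integrable_subgrad_bound:
  assumes g: "g \<in> borel_measurable M" "integrable M (\<lambda>x. \<phi> x (norm (g x)))"
    and h: "h \<in> borel_measurable M" "integrable M (\<lambda>x. \<phi> x (norm (h x)))"
    and p: "p \<in> borel_measurable M" "AE x in M. subgrad x (g x) (p x)"
  shows "AE x in M. \<bar>p x \<bullet> h x\<bar> \<le> \<phi> x (norm (g x) + norm (h x))"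
    and "integrable M (\<lambda>x. p x \<bullet> h x)"
proof -
  show 1: "AE x in M. \<bar>p x \<bullet> h x\<bar> \<le> \<phi> x (norm (g x) + norm (h x))"
    using p(2)
  proof eventually_elim
    case (elim x)
    from subgrad_bound[OF this norm_ge_zero] Cauchy_Schwarz_ineq2[of "p x" "h x"]
    show ?case by (meson order_trans)
  qed
  show "integrable M (\<lambda>x. p x \<bullet> h x)"
  proof (rule Bochner_Integration.integrable_bound[OF integrable_phi_add(1)[OF g h]])
    show "(\<lambda>x. p x \<bullet> h x) \<in> borel_measurable M" using p(1) h(1) by measurable
    show "AE x in M. norm (p x \<bullet> h x) \<le> norm (\<phi> x (norm (g x) + norm (h x)))"
      using 1 by eventually_elim (simp add: phi_nonneg)
  qed
qed

end

section \<open>First variation at a minimizer\<close>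

locale phi_minimizer = phi_growth +
  fixes u :: "'a \<Rightarrow> real" and g :: "'a \<Rightarrow> 'a"
  assumes adm_u: "adm u g" and minimal: "\<And>v h. adm v h \<Longrightarrow> energy u g \<le> energy v h"
begin

definition subgrad_fields :: "('a \<Rightarrow> 'a) set" where
  "subgrad_fields = {p \<in> borel_measurable M. AE x in M. subgrad x (g x) (p x)}"

text \<open>Its vanishing on all admissible pairs is the equation \<open>div p = u - f\<close>,
  tested against the whole primal space.\<close>

definition residual :: "('a \<Rightarrow> 'a) \<Rightarrow> ('a \<Rightarrow> real) \<times> ('a \<Rightarrow> 'a) \<Rightarrow> real" where
  "residual p i = (\<integral>x. p x \<bullet> snd i x \<partial>M) + (\<integral>x. (u x - f x) * fst i x \<partial>M)"

lemmas u_facts = admD[OF adm_u]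

lemma u_minus_f_measurable: "(\<lambda>x. u x - f x) \<in> borel_measurable M"
  using u_facts(1) f_facts(1) by measurable

lemma integrable_uf_mult: "adm v h \<Longrightarrow> integrable M (\<lambda>x. (u x - f x) * v x)"
  using u_minus_f_measurable u_facts(8) by (intro integrable_square_add(1)) (auto dest: admD)

lemma subgrad_fields_integrable:
  assumes "p \<in> subgrad_fields" "adm v h"
  shows "AE x in M. \<bar>p x \<bullet> h x\<bar> \<le> \<phi> x (norm (g x) + norm (h x))" "integrable M (\<lambda>x. p x \<bullet> h x)"
  using assms integrable_subgrad_bound[OF u_facts(2,6) admD(2,6)[OF assms(2)], of p]
  by (auto simp: subgrad_fields_def)

text \<open>The subgradient is taken at the shifted point \<open>g x + s *\<^sub>R h x\<close>,
  since only there does it bound the increase of \<phi> from above: \<open>\<phi> x (norm (g x + s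
  *\<^sub>R h x)) - \<phi> x (norm (g x)) \<le> s * (p x \<bullet> h x)\<close>. Minimality, divided
  by \<open>s\<close>, gives the claim.\<close>

lemma variation_inequality:
  assumes v: "adm v h" and s: "0 < s"
    and p: "p \<in> borel_measurable M" "AE x in M. subgrad x (g x + s *\<^sub>R h x) (p x)"
  shows "- (\<integral>x. (u x - f x) * v x \<partial>M) - s / 2 * (\<integral>x. (v x)\<^sup>2 \<partial>M) \<le> (\<integral>x. p x \<bullet> h x \<partial>M)"
proof -
  have us: "adm (\<lambda>x. u x + s * v x) (\<lambda>x. g x + s *\<^sub>R h x)"
    using adm_add[OF adm_u v, of 1 s] by simp
  note V = admD[OF v] and US = admD[OF us]
  have ph: "integrable M (\<lambda>x. p x \<bullet> h x)"
    using integrable_subgrad_bound(2)[OF US(2,6) V(2,6) p] .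
  have "energy u g \<le> energy (\<lambda>x. u x + s * v x) (\<lambda>x. g x + s *\<^sub>R h x)"
    by (rule minimal[OF us])
  then have 1: "0 \<le> ((\<integral>x. (u x + s * v x - f x)\<^sup>2 \<partial>M) - (\<integral>x. (u x - f x)\<^sup>2 \<partial>M)) / 2
      + ((\<integral>x. \<phi> x (norm (g x + s *\<^sub>R h x)) \<partial>M) - (\<integral>x. \<phi> x (norm (g x)) \<partial>M))"
    unfolding energy_eq[OF adm_u] energy_eq[OF us] by (simp add: field_simps)
  have "(\<integral>x. (u x + s * v x - f x)\<^sup>2 \<partial>M) - (\<integral>x. (u x - f x)\<^sup>2 \<partial>M)
      = (\<integral>x. (u x + s * v x - f x)\<^sup>2 - (u x - f x)\<^sup>2 \<partial>M)"
    using US(8) u_facts(8) by simp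
  also have "\<dots> = (\<integral>x. (2 * s) * ((u x - f x) * v x) + s\<^sup>2 * (v x)\<^sup>2 \<partial>M)"
    by (rule Bochner_Integration.integral_cong[OF refl]) (simp add: power2_eq_square algebra_simps)
  also have "\<dots> = (2 * s) * (\<integral>x. (u x - f x) * v x \<partial>M) + s\<^sup>2 * (\<integral>x. (v x)\<^sup>2 \<partial>M)"
    using integrable_uf_mult[OF v] V(5) by simp
  finally have 2: "(\<integral>x. (u x + s * v x - f x)\<^sup>2 \<partial>M) - (\<integral>x. (u x - f x)\<^sup>2 \<partial>M)
      = (2 * s) * (\<integral>x. (u x - f x) * v x \<partial>M) + s\<^sup>2 * (\<integral>x. (v x)\<^sup>2 \<partial>M)" .
  have "(\<integral>x. \<phi> x (norm (g x + s *\<^sub>R h x)) \<partial>M) - (\<integral>x. \<phi> x (norm (g x)) \<partial>M)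
      = (\<integral>x. \<phi> x (norm (g x + s *\<^sub>R h x)) - \<phi> x (norm (g x)) \<partial>M)"
    using US(6) u_facts(6) by simp
  also have "\<dots> \<le> (\<integral>x. s * (p x \<bullet> h x) \<partial>M)"
  proof (rule integral_mono_AE)
    show "AE x in M. \<phi> x (norm (g x + s *\<^sub>R h x)) - \<phi> x (norm (g x)) \<le> s * (p x \<bullet> h x)"
      using p(2)
    proof eventually_elim
      case (elim x)
      then have "\<phi> x (norm (g x + s *\<^sub>R h x)) + p x \<bullet> (g x - (g x + s *\<^sub>R h x)) \<le> \<phi> x (norm (g x))"
        unfolding subgrad_def by blast
      then show ?case by simp
    qed
  qed (use US(6) u_facts(6) ph in auto)
  also have "\<dots> = s * (\<integral>x. p x \<bullet> h x \<partial>M)" by simp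
  finally have 3: "(\<integral>x. \<phi> x (norm (g x + s *\<^sub>R h x)) \<partial>M) - (\<integral>x. \<phi> x (norm (g x)) \<partial>M)
      \<le> s * (\<integral>x. p x \<bullet> h x \<partial>M)" .
  define a b c where "a = (\<integral>x. (u x - f x) * v x \<partial>M)" and "b = (\<integral>x. (v x)\<^sup>2 \<partial>M)"
    and "c = (\<integral>x. p x \<bullet> h x \<partial>M)"
  have "0 \<le> (2 * s * a + s\<^sup>2 * b) / 2 + s * c"
    using order_trans[OF 1 add_left_mono[OF 3]] unfolding 2 a_def b_def c_def .
  also have "\<dots> = s * (a + s / 2 * b + c)"
    by (simp add: power2_eq_square field_simps)
  finally have "0 \<le> a + s / 2 * b + c" using s by (simp add: zero_le_mult_iff)
  then show ?thesis unfolding a_def b_def c_def by linarith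
qed

text \<open>As \<open>s\<close> decreases to \<open>0\<close>, the fixed selection of subgradients at \<open>g x + s *\<^sub>R h x\<close> converges: near \<open>s = 0\<close>
  the norm is monotone in \<open>s\<close>, and hence so is the right slope. The limit is a measurable subgradient
  at \<open>g x\<close>, and it realizes the directional derivative along \<open>h\<close>.\<close>

lemma exists_subgradient_ge:
  assumes v: "adm v h"
  shows "\<exists>p\<in>subgrad_fields. 0 \<le> residual p (v, h)"
proof -
  define s where "s n = inverse (real (Suc n))" for n
  define z where "z n x = g x + s n *\<^sub>R h x" for n x
  define \<sigma> where "\<sigma> n x = selection x (z n x)" for n x
  define p where "p x = lim (\<lambda>n. \<sigma> n x)" for x
  note V = admD[OF v]
  note [measurable] = V(2) u_facts(2)
  have s: "0 < s n" "s n \<le> 1" for n by (auto simp: s_def field_simps)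
  have s0: "s \<longlonglongrightarrow> 0" unfolding s_def by (rule LIMSEQ_inverse_real_of_nat)
  have zm: "z n \<in> borel_measurable M" for n unfolding z_def by measurable
  have \<sigma>m [measurable]: "\<sigma> n \<in> borel_measurable M" for n
    unfolding \<sigma>_def by (rule selection_measurable[OF zm])
  have pm: "p \<in> borel_measurable M" unfolding p_def by measurable
  have \<sigma>p: "(\<lambda>n. \<sigma> n x) \<longlonglongrightarrow> p x" for x
    using right_slope_sgn_convergent[OF phi_convex phi_mono, of x "g x" "h x"]
    unfolding p_def \<sigma>_def selection_def z_def s_def by (simp add: convergent_LIMSEQ_iff)
  have zg: "(\<lambda>n. z n x) \<longlonglongrightarrow> g x" for x
  proof -
    have "(\<lambda>n. z n x) \<longlonglongrightarrow> g x + 0 *\<^sub>R h x" unfolding z_def by (intro tendsto_intros s0)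
    then show ?thesis by simp
  qed
  have sub: "subgrad x (z n x) (\<sigma> n x)" for n x unfolding \<sigma>_def by (rule subgrad_selection)
  have "subgrad x (g x) (p x)" for x by (rule subgrad_closed[OF \<sigma>p zg sub])
  then have pS: "p \<in> subgrad_fields" using pm by (simp add: subgrad_fields_def)
  have "(\<lambda>n. \<integral>x. \<sigma> n x \<bullet> h x \<partial>M) \<longlonglongrightarrow> (\<integral>x. p x \<bullet> h x \<partial>M)"
  proof (rule integral_dominated_convergence)
    show "(\<lambda>x. p x \<bullet> h x) \<in> borel_measurable M" using pm by measurable
    show "(\<lambda>x. \<sigma> n x \<bullet> h x) \<in> borel_measurable M" for n by measurable
    \<comment> \<open>One \<open>h\<close> comes from the shift of the base point by at most
      \<open>h\<close>, the other from the test direction.\<close>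
    have "integrable M (\<lambda>x. \<phi> x (norm (g x) + norm (2 *\<^sub>R h x)))"
    proof (rule integrable_phi_add(1)[OF u_facts(2,6)])
      show "(\<lambda>x. 2 *\<^sub>R h x) \<in> borel_measurable M" by measurable
      show "integrable M (\<lambda>x. \<phi> x (norm (2 *\<^sub>R h x)))"
        using integrable_phi_scale[OF V(2,6), of 2] by simp
    qed
    then show "integrable M (\<lambda>x. \<phi> x (norm (g x) + 2 * norm (h x)))" by simp
    show "AE x in M. (\<lambda>n. \<sigma> n x \<bullet> h x) \<longlonglongrightarrow> p x \<bullet> h x"
      by (intro AE_I2 tendsto_intros \<sigma>p)
    show "AE x in M. norm (\<sigma> n x \<bullet> h x) \<le> \<phi> x (norm (g x) + 2 * norm (h x))" for n
    proof (rule AE_I2)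
      fix x
      have "norm (\<sigma> n x \<bullet> h x) \<le> norm (\<sigma> n x) * norm (h x)" using Cauchy_Schwarz_ineq2 by simp
      also have "\<dots> \<le> \<phi> x (norm (z n x) + norm (h x))" by (rule subgrad_bound[OF sub norm_ge_zero])
      also have "\<dots> \<le> \<phi> x (norm (g x) + 2 * norm (h x))"
      proof (rule phi_le)
        have "norm (z n x) \<le> norm (g x) + s n * norm (h x)"
          using norm_triangle_ineq[of "g x" "s n *\<^sub>R h x"] s(1)[of n] by (simp add: z_def)
        moreover have "s n * norm (h x) \<le> 1 * norm (h x)" using s by (intro mult_right_mono) auto
        ultimately show "norm (z n x) + norm (h x) \<le> norm (g x) + 2 * norm (h x)" by linarith
      qed simp
      finally show "norm (\<sigma> n x \<bullet> h x) \<le> \<phi> x (norm (g x) + 2 * norm (h x))" .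
    qed
  qed
  moreover have "- (\<integral>x. (u x - f x) * v x \<partial>M) - s n / 2 * (\<integral>x. (v x)\<^sup>2 \<partial>M) \<le> (\<integral>x. \<sigma> n x \<bullet> h x \<partial>M)" for n
    using sub by (intro variation_inequality[OF v s(1)] \<sigma>m) (simp add: z_def)
  moreover have "(\<lambda>n. - (\<integral>x. (u x - f x) * v x \<partial>M) - s n / 2 * (\<integral>x. (v x)\<^sup>2 \<partial>M))
      \<longlonglongrightarrow> - (\<integral>x. (u x - f x) * v x \<partial>M) - 0 / 2 * (\<integral>x. (v x)\<^sup>2 \<partial>M)"
    by (intro tendsto_intros s0) auto
  ultimately have "- (\<integral>x. (u x - f x) * v x \<partial>M) - 0 / 2 * (\<integral>x. (v x)\<^sup>2 \<partial>M) \<le> (\<integral>x. p x \<bullet> h x \<partial>M)"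
    by (intro LIMSEQ_le[of _ _ "\<lambda>n. \<integral>x. \<sigma> n x \<bullet> h x \<partial>M"]) auto
  then have "0 \<le> residual p (v, h)" by (simp add: residual_def)
  with pS show ?thesis by blast
qed

end

text \<open>If the least sum of squares were positive, its near-minimizer \<open>p\<close> would give weights \<open>q i = - c p i\<close>;
  moving from \<open>p\<close> a little towards the element supplied by \<open>sep\<close> would then decrease that sum.\<close>

lemma approximate_solution_finite_system:
  fixes c :: "'s \<Rightarrow> 'i \<Rightarrow> real"
  assumes F: "finite F" and ne: "S \<noteq> {}" and \<delta>: "0 < \<delta>"
    and conv: "\<And>p q t. p \<in> S \<Longrightarrow> q \<in> S \<Longrightarrow> 0 \<le> t \<Longrightarrow> t \<le> 1 \<Longrightarrow>
      \<exists>r\<in>S. \<forall>i\<in>F. c r i = (1 - t) * c p i + t * c q i"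
    and bound: "\<And>p i. p \<in> S \<Longrightarrow> i \<in> F \<Longrightarrow> \<bar>c p i\<bar> \<le> R i"
    and sep: "\<And>q. \<exists>p\<in>S. 0 \<le> (\<Sum>i\<in>F. q i * c p i)"
  shows "\<exists>p\<in>S. \<forall>i\<in>F. \<bar>c p i\<bar> \<le> \<delta>"
proof (rule ccontr)
  assume contra: "\<not> (\<exists>p\<in>S. \<forall>i\<in>F. \<bar>c p i\<bar> \<le> \<delta>)"
  define N where "N p = (\<Sum>i\<in>F. (c p i)\<^sup>2)" for p
  define D where "D = Inf (N ` S)"
  define K where "K = (\<Sum>i\<in>F. (R i)\<^sup>2)"
  have K0: "0 \<le> K" unfolding K_def by (simp add: sum_nonneg)
  have bdd: "bdd_below (N ` S)" by (intro bdd_belowI2[of _ 0]) (simp add: N_def sum_nonneg)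
  have D_le: "D \<le> N p" if "p \<in> S" for p unfolding D_def using that bdd by (intro cInf_lower) auto
  have "\<delta>\<^sup>2 \<le> N p" if p: "p \<in> S" for p
  proof -
    obtain i where i: "i \<in> F" "\<delta> < \<bar>c p i\<bar>" using contra p by (meson not_le)
    then have "\<delta>\<^sup>2 \<le> (c p i)\<^sup>2" using \<delta> by (simp add: abs_le_square_iff[symmetric])
    also have "\<dots> \<le> N p" unfolding N_def using F i(1) by (intro member_le_sum) auto
    finally show ?thesis .
  qed
  then have "\<delta>\<^sup>2 \<le> D" unfolding D_def using ne by (intro cInf_greatest) auto
  then have D0: "0 < D" using \<delta> by (smt (verit) zero_less_power)
  \<comment> \<open>What matters is \<open>t * K < (2 - t) * D\<close>: the decrease linear in
    \<open>t\<close> must outweigh the quadratic term bounded through \<open>K\<close>.\<close>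
  define t where "t = D / (D + K + 1)"
  have t: "0 < t" "t \<le> 1" using D0 K0 by (auto simp: t_def)
  have "t * K < D"
  proof -
    have "D * K < D * (D + K + 1)" using D0 K0 by (intro mult_strict_left_mono) auto
    then show ?thesis using D0 K0 by (simp add: t_def pos_divide_less_eq)
  qed
  also have "D \<le> (2 - t) * D" using D0 t mult_right_mono[of 1 "2 - t" D] by simp
  finally have gap: "t * K < (2 - t) * D" .
  \<comment> \<open>Chosen so that \<open>(1 - t)\<^sup>2 * D + \<epsilon> + t\<^sup>2 * K\<close>
    equals \<open>D\<close>. The cross term has the right sign by the choice of
    \<open>q\<close>.\<close>
  define \<epsilon> where "\<epsilon> = t * ((2 - t) * D - t * K)"
  have \<epsilon>: "0 < \<epsilon>" using gap t by (simp add: \<epsilon>_def)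
  obtain p where p: "p \<in> S" "N p < D + \<epsilon>"
    using cInf_lessD[of "N ` S" "D + \<epsilon>"] ne \<epsilon> by (auto simp: D_def)
  obtain q where q: "q \<in> S" "0 \<le> (\<Sum>i\<in>F. - c p i * c q i)" using sep[of "\<lambda>i. - c p i"] by blast
  obtain r where r: "r \<in> S" "\<And>i. i \<in> F \<Longrightarrow> c r i = (1 - t) * c p i + t * c q i"
    using conv[OF p(1) q(1), of t] t by auto
  have "N q \<le> K" unfolding N_def K_def
    using bound[OF q(1)] by (intro sum_mono) (auto intro: abs_le_square_iff[THEN iffD1] order_trans[OF _ abs_ge_self])
  have "N r = (\<Sum>i\<in>F. (1 - t)\<^sup>2 * (c p i)\<^sup>2 + 2 * t * (1 - t) * (c p i * c q i) + t\<^sup>2 * (c q i)\<^sup>2)"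
    unfolding N_def by (rule sum.cong) (simp_all add: r(2) power2_eq_square algebra_simps)
  also have "\<dots> = (1 - t)\<^sup>2 * N p + 2 * t * (1 - t) * (\<Sum>i\<in>F. c p i * c q i) + t\<^sup>2 * N q"
    by (simp add: N_def sum.distrib sum_distrib_left)
  also have "\<dots> \<le> (1 - t)\<^sup>2 * N p + 0 + t\<^sup>2 * K"
    using q(2) t \<open>N q \<le> K\<close>
    by (intro add_mono order_refl mult_left_mono mult_nonneg_nonpos) (auto simp: sum_negf)
  also have "\<dots> < (1 - t)\<^sup>2 * D + \<epsilon> + t\<^sup>2 * K"
  proof -
    have "(1 - t)\<^sup>2 \<le> 1" using t by (simp add: power_le_one)
    have "(1 - t)\<^sup>2 * N p \<le> (1 - t)\<^sup>2 * D + (1 - t)\<^sup>2 * (N p - D)" by (simp add: algebra_simps)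
    also have "(1 - t)\<^sup>2 * (N p - D) \<le> 1 * (N p - D)"
      using D_le[OF p(1)] \<open>(1 - t)\<^sup>2 \<le> 1\<close> by (intro mult_right_mono) auto
    finally show ?thesis using p(2) by simp
  qed
  also have "\<dots> = D"
    by (simp add: \<epsilon>_def power2_eq_square algebra_simps)
  finally show False using D_le[OF r(1)] by simp
qed

section \<open>From finite systems of tested equations to all of them\<close>

context phi_minimizer
begin

definition adm_pairs :: "(('a \<Rightarrow> real) \<times> ('a \<Rightarrow> 'a)) set" where
  "adm_pairs = {i. adm (fst i) (snd i)}"

lemma adm_sum:
  assumes "finite F" "F \<subseteq> adm_pairs"
  shows "adm (\<lambda>x. \<Sum>i\<in>F. q i * fst i x) (\<lambda>x. \<Sum>i\<in>F. q i *\<^sub>R snd i x)"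
  using assms
proof (induction F)
  case empty
  then show ?case by (simp add: adm_zero)
next
  case (insert i F)
  then have "adm (fst i) (snd i)" by (simp add: adm_pairs_def)
  from adm_add[OF this insert.IH, of "q i" 1] insert show ?case by simp
qed

lemma residual_sum:
  assumes F: "finite F" "F \<subseteq> adm_pairs" and p: "p \<in> subgrad_fields"
  shows "residual p (\<lambda>x. \<Sum>i\<in>F. q i * fst i x, \<lambda>x. \<Sum>i\<in>F. q i *\<^sub>R snd i x) = (\<Sum>i\<in>F. q i * residual p i)"
proof -
  have int: "integrable M (\<lambda>x. p x \<bullet> snd i x)" "integrable M (\<lambda>x. (u x - f x) * fst i x)" if "i \<in> F" for i
    using subgrad_fields_integrable(2)[OF p] integrable_uf_mult F that by (auto simp: adm_pairs_def)
  have "(\<integral>x. p x \<bullet> (\<Sum>i\<in>F. q i *\<^sub>R snd i x) \<partial>M) = (\<integral>x. (\<Sum>i\<in>F. q i * (p x \<bullet> snd i x)) \<partial>M)"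
    by (simp add: inner_sum_right)
  also have "\<dots> = (\<Sum>i\<in>F. q i * (\<integral>x. p x \<bullet> snd i x \<partial>M))"
    using int by (subst Bochner_Integration.integral_sum) auto
  finally have 1: "(\<integral>x. p x \<bullet> (\<Sum>i\<in>F. q i *\<^sub>R snd i x) \<partial>M) = (\<Sum>i\<in>F. q i * (\<integral>x. p x \<bullet> snd i x \<partial>M))" .
  have "(\<integral>x. (u x - f x) * (\<Sum>i\<in>F. q i * fst i x) \<partial>M) = (\<integral>x. (\<Sum>i\<in>F. q i * ((u x - f x) * fst i x)) \<partial>M)"
    by (simp add: sum_distrib_left ac_simps)
  also have "\<dots> = (\<Sum>i\<in>F. q i * (\<integral>x. (u x - f x) * fst i x \<partial>M))"
    using int by (subst Bochner_Integration.integral_sum) auto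
  finally show ?thesis
    using 1 by (simp add: residual_def sum.distrib distrib_left)
qed

lemma subgrad_fields_convex:
  assumes "p \<in> subgrad_fields" "q \<in> subgrad_fields" "0 \<le> t" "t \<le> 1"
  shows "(\<lambda>x. (1 - t) *\<^sub>R p x + t *\<^sub>R q x) \<in> subgrad_fields"
proof -
  have [measurable]: "p \<in> borel_measurable M" "q \<in> borel_measurable M" using assms by (auto simp: subgrad_fields_def)
  have "AE x in M. subgrad x (g x) (p x)" "AE x in M. subgrad x (g x) (q x)" using assms by (auto simp: subgrad_fields_def)
  then have "AE x in M. subgrad x (g x) ((1 - t) *\<^sub>R p x + t *\<^sub>R q x)"
    by eventually_elim (intro subgrad_convex assms)
  then show ?thesis by (simp add: subgrad_fields_def)
qed

lemma residual_convex:
  assumes p: "p \<in> subgrad_fields" "q \<in> subgrad_fields" and i: "i \<in> adm_pairs"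
  shows "residual (\<lambda>x. (1 - t) *\<^sub>R p x + t *\<^sub>R q x) i = (1 - t) * residual p i + t * residual q i"
proof -
  have "integrable M (\<lambda>x. p x \<bullet> snd i x)" "integrable M (\<lambda>x. q x \<bullet> snd i x)"
    using subgrad_fields_integrable(2) p i by (auto simp: adm_pairs_def)
  then have "(\<integral>x. ((1 - t) *\<^sub>R p x + t *\<^sub>R q x) \<bullet> snd i x \<partial>M)
      = (1 - t) * (\<integral>x. p x \<bullet> snd i x \<partial>M) + t * (\<integral>x. q x \<bullet> snd i x \<partial>M)"
    by (simp add: inner_add_left)
  then show ?thesis by (simp add: residual_def algebra_simps)
qed

lemma residual_bound:
  assumes p: "p \<in> subgrad_fields" and i: "i \<in> adm_pairs"
  shows "\<bar>residual p i\<bar> \<le> (\<integral>x. \<phi> x (norm (g x) + norm (snd i x)) \<partial>M) + \<bar>\<integral>x. (u x - f x) * fst i x \<partial>M\<bar>"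
proof -
  have adm: "adm (fst i) (snd i)" using i by (simp add: adm_pairs_def)
  note V = admD[OF adm]
  note I = subgrad_fields_integrable[OF p adm]
  have "\<bar>\<integral>x. p x \<bullet> snd i x \<partial>M\<bar> \<le> (\<integral>x. \<bar>p x \<bullet> snd i x\<bar> \<partial>M)" by (rule integral_abs_bound)
  also have "\<dots> \<le> (\<integral>x. \<phi> x (norm (g x) + norm (snd i x)) \<partial>M)"
    by (rule integral_mono_AE[OF _ integrable_phi_add(1)[OF u_facts(2,6) V(2,6)] I(1)]) (use I(2) in simp)
  finally show ?thesis unfolding residual_def by linarith
qed

lemma subgrad_fields_nonempty: "subgrad_fields \<noteq> {}"
  using selection_measurable[OF u_facts(2)] subgrad_selection by (auto simp: subgrad_fields_def)

text \<open>A weighted sum of residuals is the residual of the combined direction, which is again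
  admissible; the selection found for that single direction supplies the separation
  hypothesis.\<close>

lemma approximate_Euler_Lagrange:
  assumes F: "finite F" "F \<subseteq> adm_pairs" and "0 < \<delta>"
  shows "\<exists>p\<in>subgrad_fields. \<forall>i\<in>F. \<bar>residual p i\<bar> \<le> \<delta>"
proof (rule approximate_solution_finite_system[OF F(1) subgrad_fields_nonempty \<open>0 < \<delta>\<close>])
  show "\<exists>r\<in>subgrad_fields. \<forall>i\<in>F. residual r i = (1 - t) * residual p i + t * residual q i"
    if "p \<in> subgrad_fields" "q \<in> subgrad_fields" "0 \<le> t" "t \<le> 1" for p q t
    using F by (intro bexI[OF _ subgrad_fields_convex[OF that]] ballI residual_convex that(1,2)) auto
  show "\<bar>residual p i\<bar> \<le> (\<integral>x. \<phi> x (norm (g x) + norm (snd i x)) \<partial>M) + \<bar>\<integral>x. (u x - f x) * fst i x \<partial>M\<bar>"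
    if "p \<in> subgrad_fields" "i \<in> F" for p i
    using that F by (intro residual_bound) auto
  show "\<exists>p\<in>subgrad_fields. 0 \<le> (\<Sum>i\<in>F. q i * residual p i)" for q
    using exists_subgradient_ge[OF adm_sum[OF F], of q] residual_sum[OF F, of _ q] by force
qed

text \<open>With step length \<open>1\<close>, \<open>subgrad_bound\<close> places every selection
  below \<open>\<phi> x (norm (g x) + 1)\<close>, which is integrable by doubling and the
  integrability of \<phi> at constants.\<close>

lemma subgrad_fields_bracket:
  obtains B where "\<And>p. p \<in> subgrad_fields \<Longrightarrow> integrable M (\<lambda>x. bracket (p x))" "\<And>p. p \<in> subgrad_fields \<Longrightarrow> (\<integral>x. bracket (p x) \<partial>M) \<le> B"
    "\<And>p. p \<in> subgrad_fields \<Longrightarrow> integrable M p"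
proof -
  define b where "b x = 1 + \<phi> x (norm (g x) + norm (1::real))" for x
  have "integrable M (\<lambda>x. \<phi> x (norm (g x) + 1))"
  proof (rule Bochner_Integration.integrable_bound)
    show "integrable M (\<lambda>x. \<phi> x (2 * norm (g x)) + \<phi> x (2 * 1))"
      using integrable_phi_scale[OF u_facts(2,6), of 2] phi_int[of "2 * 1"] by simp
    show "(\<lambda>x. \<phi> x (norm (g x) + 1)) \<in> borel_measurable M"
      using u_facts(2) by (intro phi_comp_measurable) auto
    have "\<phi> x (norm (g x) + 1) \<le> \<phi> x (2 * norm (g x)) + \<phi> x (2 * 1)" for x
      by (rule phi_add) auto
    then show "AE x in M. norm (\<phi> x (norm (g x) + 1)) \<le> norm (\<phi> x (2 * norm (g x)) + \<phi> x (2 * 1))"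
      by (simp add: phi_nonneg)
  qed
  then have b: "integrable M b" by (simp add: b_def[abs_def])
  have nb: "AE x in M. norm (p x) \<le> b x - 1" if "p \<in> subgrad_fields" for p
  proof -
    have "AE x in M. subgrad x (g x) (p x)" using that by (simp add: subgrad_fields_def)
    then show ?thesis
    proof eventually_elim
      case (elim x)
      from subgrad_bound[OF this, of 1] show ?case by (simp add: b_def)
    qed
  qed
  have m: "p \<in> borel_measurable M" if "p \<in> subgrad_fields" for p using that by (simp add: subgrad_fields_def)
  have int: "integrable M (\<lambda>x. bracket (p x))" if "p \<in> subgrad_fields" for p
  proof (rule Bochner_Integration.integrable_bound[OF b])
    show "(\<lambda>x. bracket (p x)) \<in> borel_measurable M" using m[OF that] by measurable
    show "AE x in M. norm (bracket (p x)) \<le> norm (b x)"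
      using nb[OF that]
    proof eventually_elim
      case (elim x)
      with bracket_bounds(1,3)[of "p x"] show ?case by simp
    qed
  qed
  show thesis
  proof (rule that)
    fix p assume p: "p \<in> subgrad_fields"
    show "integrable M (\<lambda>x. bracket (p x))" by (rule int[OF p])
    show "(\<integral>x. bracket (p x) \<partial>M) \<le> integral\<^sup>L M b"
    proof (rule integral_mono_AE[OF int[OF p] b])
      show "AE x in M. bracket (p x) \<le> b x"
        using nb[OF p]
      proof eventually_elim
        case (elim x)
        with bracket_bounds(3)[of "p x"] show ?case by simp
      qed
    qed
    show "integrable M p"
    proof (rule Bochner_Integration.integrable_bound[OF b m[OF p]])
      show "AE x in M. norm (p x) \<le> norm (b x)"
        using nb[OF p] by eventually_elim simp
    qed
  qed
qed

text \<open>The products \<open>p n x \<bullet> snd i x\<close> share one majorant, so almost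
  everywhere convergence is enough for every residual.\<close>

lemma subgrad_fields_closed:
  assumes p: "\<And>n. p n \<in> subgrad_fields" and q: "q \<in> borel_measurable M" and lim: "AE x in M. (\<lambda>n. p n x) \<longlonglongrightarrow> q x"
  shows "q \<in> subgrad_fields" "i \<in> adm_pairs \<Longrightarrow> (\<lambda>n. residual (p n) i) \<longlonglongrightarrow> residual q i"
proof -
  have "AE x in M. \<forall>n. subgrad x (g x) (p n x)"
    using p by (auto simp: subgrad_fields_def AE_all_countable)
  with lim have "AE x in M. subgrad x (g x) (q x)"
  proof eventually_elim
    case (elim x)
    then show ?case by (intro subgrad_closed[of "\<lambda>n. p n x" "q x" "\<lambda>n. g x"]) auto
  qed
  with q show "q \<in> subgrad_fields" by (simp add: subgrad_fields_def)
  show "(\<lambda>n. residual (p n) i) \<longlonglongrightarrow> residual q i" if "i \<in> adm_pairs"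
  proof -
    have adm: "adm (fst i) (snd i)" using that by (simp add: adm_pairs_def)
    note V = admD[OF adm]
    note [measurable] = V(2) q
    have [measurable]: "p n \<in> borel_measurable M" for n using p by (simp add: subgrad_fields_def)
    have "(\<lambda>n. \<integral>x. p n x \<bullet> snd i x \<partial>M) \<longlonglongrightarrow> (\<integral>x. q x \<bullet> snd i x \<partial>M)"
    proof (rule integral_dominated_convergence[OF _ _ integrable_phi_add(1)[OF u_facts(2,6) V(2,6)]])
      show "AE x in M. (\<lambda>n. p n x \<bullet> snd i x) \<longlonglongrightarrow> q x \<bullet> snd i x"
        using lim by eventually_elim (intro tendsto_intros)
      show "AE x in M. norm (p n x \<bullet> snd i x) \<le> \<phi> x (norm (g x) + norm (snd i x))" for n
        using subgrad_fields_integrable(1)[OF p adm] by simp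
    qed measurable
    then show ?thesis unfolding residual_def by (intro tendsto_intros)
  qed
qed

text \<open>Finitely many equations are solvable up to an error. For the whole space, take near-minimizers of
  \<open>\<integral> bracket (p x)\<close> along a sequence of finite systems whose minimal values approach the supremum over
  all finite systems. Adding one further equation cannot raise that supremum, so near-minimizers of the
  enlarged systems have the same limit, which therefore solves that equation too.\<close>

theorem Euler_Lagrange:
  obtains p where "p \<in> subgrad_fields" "integrable M p"
    "\<And>v h. adm v h \<Longrightarrow> (\<integral>x. p x \<bullet> h x \<partial>M) = - (\<integral>x. (u x - f x) * v x \<partial>M)"
proof -
  obtain B where int: "\<And>p. p \<in> subgrad_fields \<Longrightarrow> integrable M (\<lambda>x. bracket (p x))"
    and B: "\<And>p. p \<in> subgrad_fields \<Longrightarrow> (\<integral>x. bracket (p x) \<partial>M) \<le> B" and int1: "\<And>p. p \<in> subgrad_fields \<Longrightarrow> integrable M p"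
    using subgrad_fields_bracket by blast
  have m: "p \<in> borel_measurable M" if "p \<in> subgrad_fields" for p using that by (simp add: subgrad_fields_def)
  define J where "J p = (\<integral>x. bracket (p x) \<partial>M)" for p :: "'a \<Rightarrow> 'a"
  define Q where "Q F n = {p \<in> subgrad_fields. \<forall>i\<in>F. \<bar>residual p i\<bar> \<le> 1 / real (Suc n)}" for F n
  define jj where "jj F n = Inf (J ` Q F n)" for F n
  define \<F> where "\<F> = {F. finite F \<and> F \<subseteq> adm_pairs}"
  have Q_ne: "Q F n \<noteq> {}" if "F \<in> \<F>" for F n
    using approximate_Euler_Lagrange[of F "1 / real (Suc n)"] that by (auto simp: Q_def \<F>_def)
  have Q_S: "Q F n \<subseteq> subgrad_fields" for F n by (auto simp: Q_def)
  have Q_mono: "Q F' n' \<subseteq> Q F n" if "F \<subseteq> F'" "n \<le> n'" for F F' n n'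
  proof -
    have "1 / real (Suc n') \<le> 1 / real (Suc n)" using that(2) by (intro frac_le) auto
    then show ?thesis using that(1) unfolding Q_def by (auto intro: order_trans)
  qed
  have mid: "(\<lambda>x. (1/2) *\<^sub>R (a x + b x)) \<in> Q F n" if F: "F \<in> \<F>" and a: "a \<in> Q F n" and b: "b \<in> Q F n" for a b F n
  proof -
    have eq: "(\<lambda>x. (1/2) *\<^sub>R (a x + b x)) = (\<lambda>x. (1 - 1/2) *\<^sub>R a x + (1/2) *\<^sub>R b x)"
      by (simp add: scaleR_add_right)
    have subgrad_fields: "a \<in> subgrad_fields" "b \<in> subgrad_fields" using a b Q_S by auto
    have "\<bar>residual (\<lambda>x. (1/2) *\<^sub>R (a x + b x)) i\<bar> \<le> 1 / real (Suc n)" if i: "i \<in> F" for i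
    proof -
      have "i \<in> adm_pairs" using i F by (auto simp: \<F>_def)
      then have "residual (\<lambda>x. (1/2) *\<^sub>R (a x + b x)) i = (1 - 1/2) * residual a i + 1/2 * residual b i"
        unfolding eq by (intro residual_convex subgrad_fields)
      moreover have "\<bar>residual a i\<bar> \<le> 1 / real (Suc n)" "\<bar>residual b i\<bar> \<le> 1 / real (Suc n)"
        using a b i by (auto simp: Q_def)
      ultimately show ?thesis by argo
    qed
    then show ?thesis
      using subgrad_fields_convex[OF subgrad_fields, of "1/2"] unfolding Q_def eq by auto
  qed
  have J0: "0 \<le> J a" for a
    unfolding J_def using bracket_bounds(1) by (intro Bochner_Integration.integral_nonneg) (rule order_trans[OF zero_le_one])
  then have bdd: "bdd_below (J ` Q F n)" for F n by (intro bdd_belowI2[of _ 0])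
  have jj_le: "jj F n \<le> J a" if "a \<in> Q F n" for F n a
    unfolding jj_def using that bdd by (intro cInf_lower) auto
  have jj_mono: "jj F n \<le> jj F' n'" if "F \<subseteq> F'" "n \<le> n'" "F' \<in> \<F>" for F F' n n'
    unfolding jj_def using Q_ne[OF that(3)] Q_mono[OF that(1,2)] bdd by (intro cInf_superset_mono image_mono) auto
  have jj_B: "jj F n \<le> B" if F: "F \<in> \<F>" for F n
  proof -
    obtain a where "a \<in> Q F n" using Q_ne[OF F] by blast
    with jj_le[OF this] B[of a] Q_S[of F n] show ?thesis by (auto simp: J_def)
  qed
  \<comment> \<open>Finite because every selection costs at most \<open>B\<close>, whatever the
    system.\<close>
  define s where "s = Sup (case_prod jj ` (\<F> \<times> UNIV))"
  have bdd': "bdd_above (case_prod jj ` (\<F> \<times> UNIV))"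
    using jj_B by (intro bdd_aboveI2[of _ _ B]) auto
  have jj_s: "jj F n \<le> s" if "F \<in> \<F>" for F n
    unfolding s_def using that bdd' by (intro cSup_upper) force+
  have "{} \<in> \<F>" by (simp add: \<F>_def)
  have "\<exists>F n. F \<in> \<F> \<and> s - 1 / real (Suc k) < jj F n" for k
    using less_cSupD[of "case_prod jj ` (\<F> \<times> UNIV)" "s - 1 / real (Suc k)"] \<open>{} \<in> \<F>\<close>
    by (force simp: s_def)
  then obtain F n where F: "\<And>k. F k \<in> \<F>" "\<And>k. s - 1 / real (Suc k) < jj (F k) (n k)" by metis
  \<comment> \<open>Unions and sums make systems and tolerances monotone while each system stays
    finite. The summand \<open>k\<close> in \<open>n'\<close> forces the tolerances to
    \<open>0\<close>.\<close>
  define F' where "F' k = (\<Union>i\<le>k. F i)" for k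
  define n' where "n' k = (\<Sum>i\<le>k. n i) + k" for k
  have F': "F' k \<in> \<F>" for k using F(1) by (auto simp: F'_def \<F>_def)
  have F'_mono: "F' k \<subseteq> F' (Suc k)" for k unfolding F'_def by (intro UN_mono) auto
  have n'_mono: "n' k \<le> n' (Suc k)" for k by (simp add: n'_def)
  have low: "s - 1 / real (Suc k) < jj (F' k) (n' k)" for k
  proof -
    have "n k \<le> n' k" using member_le_sum[of k "{..k}" n] by (simp add: n'_def trans_le_add1)
    moreover have "F k \<subseteq> F' k" by (auto simp: F'_def)
    ultimately show ?thesis using F(2)[of k] jj_mono[OF _ _ F'] by (meson less_le_trans)
  qed
  define P where "P k = Q (F' k) (n' k)" for k
  obtain p r w where p: "\<And>k. p k \<in> P k" "\<And>k. J (p k) < Inf (J ` P k) + 1 / real (Suc k)"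
    and r: "strict_mono (r :: nat \<Rightarrow> nat)" and w: "w \<in> borel_measurable M"
    and lim: "AE x in M. (\<lambda>k. p (r k) x) \<longlonglongrightarrow> w x"
  proof (rule bracket_near_minimizers[of P M B])
    fix p r w
    assume "\<And>n. p n \<in> P n" "\<And>k. (\<integral>x. bracket (p k x) \<partial>M) < Inf ((\<lambda>a. \<integral>x. bracket (a x) \<partial>M) ` P k) + 1 / real (Suc k)"
      "strict_mono (r :: nat \<Rightarrow> nat)" "w \<in> borel_measurable M"
      "AE x in M. (\<lambda>k. p (r k) x) \<longlonglongrightarrow> w x"
    then show thesis by (intro that[of p r w]) (auto simp: J_def[abs_def])
  next
    show "P k \<noteq> {}" for k unfolding P_def by (rule Q_ne[OF F'])
    show "P (Suc k) \<subseteq> P k" for k unfolding P_def by (rule Q_mono[OF F'_mono n'_mono])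
    show "(\<lambda>x. (1/2) *\<^sub>R (a x + b x)) \<in> P k" if "a \<in> P k" "b \<in> P k" for k a b
      using that unfolding P_def by (rule mid[OF F'])
  next
    fix a assume "a \<in> P 0"
    then have a: "a \<in> subgrad_fields" using Q_S by (auto simp: P_def)
    show "a \<in> borel_measurable M" "integrable M (\<lambda>x. bracket (a x))" "(\<integral>x. bracket (a x) \<partial>M) \<le> B"
      using m[OF a] int[OF a] B[OF a] by auto
  qed
  have pS: "p k \<in> subgrad_fields" for k using p(1)[of k] Q_S by (auto simp: P_def)
  have wS: "w \<in> subgrad_fields" by (rule subgrad_fields_closed(1)[OF pS w lim])
  have res: "residual w i = 0" if i: "i \<in> adm_pairs" for i
  proof -
    have insF: "insert i (F' k) \<in> \<F>" for k using F'[of k] i by (auto simp: \<F>_def)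
    \<comment> \<open>The enlarged system is also finite, so its minimal cost does not exceed
      \<open>s\<close>.\<close>
    have "\<exists>a\<in>Q (insert i (F' k)) (n' k). J a < s + 1 / real (Suc k)" for k
    proof -
      have "Inf (J ` Q (insert i (F' k)) (n' k)) < s + 1 / real (Suc k)"
        using jj_s[OF insF, of k "n' k"] unfolding jj_def by (rule le_less_trans) simp
      then show ?thesis using cInf_lessD[of "J ` Q (insert i (F' k)) (n' k)"] Q_ne[OF insF] by blast
    qed
    then obtain q where q: "\<And>k. q k \<in> Q (insert i (F' k)) (n' k)" "\<And>k. J (q k) < s + 1 / real (Suc k)" by metis
    have qP: "q k \<in> P k" for k using q(1)[of k] Q_mono[of "F' k" "insert i (F' k)" "n' k" "n' k"] by (auto simp: P_def)
    have qS: "q k \<in> subgrad_fields" for k using q(1)[of k] Q_S by auto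
    define G where "G k = (\<integral>x. bracket_gap (p k x) (q k x) \<partial>M)" for k
    have G0: "0 \<le> G k" for k unfolding G_def by (intro Bochner_Integration.integral_nonneg bracket_gap_lower_bound)
    \<comment> \<open>Both ends cost less than \<open>s + 1 / real (Suc k)\<close>. Their midpoint
      still solves the smaller system, whose minimal cost exceeds
      \<open>s - 1 / real (Suc k)\<close>.\<close>
    have G_le: "G k \<le> 2 * (1 / real (Suc k))" for k
    proof -
      have "(\<lambda>x. (1/2) *\<^sub>R (p k x + q k x)) \<in> Q (F' k) (n' k)"
        using mid[OF F'] p(1) qP unfolding P_def by blast
      from jj_le[OF this] low[of k] have "s - 1 / real (Suc k) < J (\<lambda>x. (1/2) *\<^sub>R (p k x + q k x))" by linarith
      moreover have "J (p k) < s + 1 / real (Suc k)"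
        using p(2)[of k] jj_s[OF F', of k "n' k"] by (simp add: P_def jj_def)
      moreover have "G k = (J (p k) + J (q k)) / 2 - J (\<lambda>x. (1/2) *\<^sub>R (p k x + q k x))"
        unfolding G_def J_def using m int pS qS by (intro integral_bracket_gap) auto
      ultimately show ?thesis using q(2)[of k] by argo
    qed
    have "(\<lambda>k. 2 * (1 / real (Suc k))) \<longlonglongrightarrow> 2 * 0"
      by (intro tendsto_intros LIMSEQ_Suc[OF lim_1_over_n])
    then have "G \<longlonglongrightarrow> 0"
      using G0 G_le by (intro tendsto_sandwich[of "\<lambda>_. 0" G _ "\<lambda>k. 2 * (1 / real (Suc k))"]) auto
    then have "(\<lambda>k. G (r k)) \<longlonglongrightarrow> 0" using LIMSEQ_subseq_LIMSEQ[OF _ r, of G 0] by (simp add: o_def)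
    then obtain r' where r': "strict_mono (r' :: nat \<Rightarrow> nat)"
      "AE x in M. (\<lambda>k. p (r (r' k)) x - q (r (r' k)) x) \<longlonglongrightarrow> 0"
      using gap_null_AE_subsequence[of "\<lambda>k. p (r k)" M "\<lambda>k. q (r k)" B] m int B pS qS unfolding G_def by blast
    have "AE x in M. (\<lambda>k. q (r (r' k)) x) \<longlonglongrightarrow> w x"
      using lim r'(2)
    proof eventually_elim
      case (elim x)
      have "(\<lambda>k. p (r (r' k)) x) \<longlonglongrightarrow> w x"
        using LIMSEQ_subseq_LIMSEQ[OF elim(1) r'(1)] by (simp add: o_def)
      from tendsto_diff[OF this elim(2)] show ?case by simp
    qed
    from subgrad_fields_closed(2)[OF qS w this i] have "(\<lambda>k. residual (q (r (r' k))) i) \<longlonglongrightarrow> residual w i" .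
    moreover have "(\<lambda>k. residual (q (r (r' k))) i) \<longlonglongrightarrow> 0"
    proof (rule Lim_null_comparison)
      show "(\<lambda>k. 1 / real (Suc k)) \<longlonglongrightarrow> 0" by (rule LIMSEQ_Suc[OF lim_1_over_n])
      show "\<forall>\<^sub>F k in sequentially. norm (residual (q (r (r' k))) i) \<le> 1 / real (Suc k)"
      proof (intro always_eventually allI)
        fix k
        have "k \<le> r (r' k)" using seq_suble[OF r'(1), of k] seq_suble[OF r, of "r' k"] by (rule order_trans)
        also have "\<dots> \<le> n' (r (r' k))" by (simp add: n'_def)
        finally have "1 / real (Suc (n' (r (r' k)))) \<le> 1 / real (Suc k)" by (intro frac_le) auto
        moreover have "\<bar>residual (q (r (r' k))) i\<bar> \<le> 1 / real (Suc (n' (r (r' k))))"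
          using q(1)[of "r (r' k)"] by (auto simp: Q_def)
        ultimately show "norm (residual (q (r (r' k))) i) \<le> 1 / real (Suc k)" by simp
      qed
    qed
    ultimately show ?thesis by (rule LIMSEQ_unique)
  qed
  show thesis
  proof (rule that[OF wS int1[OF wS]])
    fix v h assume "adm v h"
    then show "(\<integral>x. w x \<bullet> h x \<partial>M) = - (\<integral>x. (u x - f x) * v x \<partial>M)"
      using res[of "(v, h)"] by (simp add: adm_pairs_def residual_def)
  qed
qed

end

section \<open>The conjugate and the equality case of Young's inequality\<close>

context phi_growth
begin

lemma conjugate_ge: "0 \<le> t \<Longrightarrow> ereal (s * t - \<phi> x t) \<le> conjugate \<phi> x s"
  unfolding conjugate_def by (rule SUP_upper) simp

lemma conjugate_nonneg: "0 \<le> conjugate \<phi> x s"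
  using conjugate_ge[of 0 s x] by (simp add: phi_0 zero_ereal_def)

lemma Young_inequality: "ereal (p \<bullet> z - \<phi> x (norm z)) \<le> conjugate \<phi> x (norm p)"
proof -
  have "ereal (p \<bullet> z - \<phi> x (norm z)) \<le> ereal (norm p * norm z - \<phi> x (norm z))"
    using norm_cauchy_schwarz[of p z] by simp
  also have "\<dots> \<le> conjugate \<phi> x (norm p)" by (rule conjugate_ge) simp
  finally show ?thesis .
qed

text \<open>The equality case of Young's inequality. A radial conjugate suffices because testing
  along \<open>t *\<^sub>R sgn p\<close> turns the inner product into
  \<open>norm p * t\<close>.\<close>

lemma subgrad_iff_conjugate_le:
  "subgrad x z p \<longleftrightarrow> conjugate \<phi> x (norm p) \<le> ereal (p \<bullet> z - \<phi> x (norm z))"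
proof
  assume sub: "subgrad x z p"
  show "conjugate \<phi> x (norm p) \<le> ereal (p \<bullet> z - \<phi> x (norm z))"
    unfolding conjugate_def
  proof (rule SUP_least)
    fix t :: real assume "t \<in> {0..}"
    then have t: "0 \<le> t" by simp
    have "\<phi> x (norm z) + p \<bullet> (t *\<^sub>R sgn p - z) \<le> \<phi> x (norm (t *\<^sub>R sgn p))"
      using sub unfolding subgrad_def by blast
    \<comment> \<open>Only an inequality: for \<open>p = 0\<close> the tested vector is
      \<open>0\<close>, not of norm \<open>t\<close>.\<close>
    also have "\<dots> \<le> \<phi> x t"
      using t by (intro phi_le) (auto simp: norm_sgn)
    also have "p \<bullet> (t *\<^sub>R sgn p - z) = norm p * t - p \<bullet> z"
      by (cases "p = 0") (auto simp: sgn_div_norm inner_diff_right dot_square_norm power2_eq_square)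
    finally show "ereal (norm p * t - \<phi> x t) \<le> ereal (p \<bullet> z - \<phi> x (norm z))" by simp
  qed
next
  assume le: "conjugate \<phi> x (norm p) \<le> ereal (p \<bullet> z - \<phi> x (norm z))"
  show "subgrad x z p"
    unfolding subgrad_def
  proof
    fix w
    from order_trans[OF Young_inequality[of p w x] le]
    show "\<phi> x (norm z) + p \<bullet> (w - z) \<le> \<phi> x (norm w)" by (simp add: inner_diff_right)
  qed
qed

text \<open>Continuity of \<phi> makes a countable supremum suffice, from which measurability of the
  conjugate follows.\<close>

lemma conjugate_eq_SUP_rationals:
  "conjugate \<phi> x s = (SUP q\<in>\<rat> \<inter> {0..}. ereal (s * q - \<phi> x q))"
proof (rule antisym)
  show "(SUP q\<in>\<rat> \<inter> {0..}. ereal (s * q - \<phi> x q)) \<le> conjugate \<phi> x s"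
    by (intro SUP_least conjugate_ge) auto
  show "conjugate \<phi> x s \<le> (SUP q\<in>\<rat> \<inter> {0..}. ereal (s * q - \<phi> x q))"
    unfolding conjugate_def
  proof (rule SUP_least)
    fix t :: real assume "t \<in> {0..}"
    then have t: "0 \<le> t" by simp
    show "ereal (s * t - \<phi> x t) \<le> (SUP q\<in>\<rat> \<inter> {0..}. ereal (s * q - \<phi> x q))" (is "_ \<le> ?R")
    proof (rule ereal_le_epsilon2)
      fix e :: real assume e: "0 < e"
      have "continuous_on {0..} (\<lambda>t. s * t - \<phi> x t)" by (intro continuous_intros phi_cont)
      then have "((\<lambda>t. s * t - \<phi> x t) \<longlongrightarrow> s * t - \<phi> x t) (at t within {0..})"
        using t by (simp add: continuous_on_def)
      then have "\<forall>\<^sub>F y in at t within {0..}. s * t - \<phi> x t - e < s * y - \<phi> x y"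
        using e by (intro order_tendstoD) auto
      then obtain d where d: "0 < d" "\<And>y. 0 \<le> y \<Longrightarrow> y \<noteq> t \<Longrightarrow> dist y t < d \<Longrightarrow>
          s * t - \<phi> x t - e < s * y - \<phi> x y"
        by (auto simp: eventually_at)
      obtain q where q: "q \<in> \<rat>" "t < q" "q < t + d"
        using Rats_dense_in_real[of t "t + d"] d(1) by auto
      then have "s * t - \<phi> x t - e < s * q - \<phi> x q" using t by (intro d) (auto simp: dist_real_def)
      then have "ereal (s * t - \<phi> x t) \<le> ereal (s * q - \<phi> x q) + ereal e" by simp
      also have "\<dots> \<le> ?R + ereal e"
        using q t by (intro add_right_mono SUP_upper) auto
      finally show "ereal (s * t - \<phi> x t) \<le> ?R + ereal e" .
    qed
  qed
qed

lemma conjugate_measurable: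
  assumes [measurable]: "s \<in> borel_measurable M"
  shows "(\<lambda>x. e2ennreal (conjugate \<phi> x (s x))) \<in> borel_measurable M"
proof -
  have "(\<lambda>x. ereal (s x * q - \<phi> x q)) \<in> borel_measurable M" if "q \<in> \<rat> \<inter> {0..}" for q
  proof -
    have [measurable]: "(\<lambda>x. \<phi> x q) \<in> borel_measurable M" using that by (intro phi_meas) auto
    show ?thesis by measurable
  qed
  then have "(\<lambda>x. conjugate \<phi> x (s x)) \<in> borel_measurable M"
    unfolding conjugate_eq_SUP_rationals
    by (intro borel_measurable_SUP countable_Int1 countable_rat)
  then show ?thesis by (rule measurable_compose[OF _ measurable_e2ennreal])
qed

section \<open>The duality gap\<close>

lemma K_space_divergence:
  assumes "p \<in> K_space \<Omega> \<phi>"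
  shows "weak_divergence \<Omega> p \<in> borel_measurable M" "integrable M (\<lambda>x. (weak_divergence \<Omega> p x)\<^sup>2)"
proof -
  obtain d where d: "d \<in> L2 \<Omega>" "has_weak_divergence \<Omega> p d" using assms by (auto simp: K_space_def)
  have AE: "AE x in M. weak_divergence \<Omega> p x = d x" by (rule weak_divergence_eq_AE[OF open_dom d(2)])
  have dm: "d \<in> borel_measurable M" "integrable M (\<lambda>x. (d x)\<^sup>2)" using d(1) by (auto simp: L2_def)
  show m: "weak_divergence \<Omega> p \<in> borel_measurable M"
  proof (rule borel_measurable_lebesgue_on_AE[OF dom_sets dm(1)])
    show "AE x in M. d x = weak_divergence \<Omega> p x" using AE by eventually_elim simp
  qed
  have "AE x in M. (weak_divergence \<Omega> p x)\<^sup>2 = (d x)\<^sup>2" using AE by eventually_elim simp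
  from integrable_cong_AE[OF _ _ this] show "integrable M (\<lambda>x. (weak_divergence \<Omega> p x)\<^sup>2)"
    using m dm by simp
qed

lemma dual_infinite: "conj_modular \<Omega> \<phi> p = \<infinity> \<Longrightarrow> dual \<Omega> \<phi> f p = - \<infinity>"
  by (simp add: dual_def)

text \<open>A finite conjugate modular makes the conjugate finite almost everywhere, and
  \<open>k\<close> is its real-valued version. It also gives integrability of
  \<open>p x \<bullet> weak_gradient \<Omega> v x\<close> directly from Young's inequality, so the
  integrals may be split and recombined.\<close>

lemma duality_gap:
  assumes p: "p \<in> K_space \<Omega> \<phi>" and fin: "conj_modular \<Omega> \<phi> p < \<infinity>"
    and v: "v \<in> X_space \<Omega> \<phi>"
  obtains k D where "integrable M k" "AE x in M. conjugate \<phi> x (norm (p x)) = ereal (k x)"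
    "dual \<Omega> \<phi> f p = ereal D"
    "integrable M (\<lambda>x. (v x - f x - weak_divergence \<Omega> p x)\<^sup>2)"
    "integrable M (\<lambda>x. \<phi> x (norm (weak_gradient \<Omega> v x)) + k x - p x \<bullet> weak_gradient \<Omega> v x)"
    "AE x in M. 0 \<le> \<phi> x (norm (weak_gradient \<Omega> v x)) + k x - p x \<bullet> weak_gradient \<Omega> v x"
    "energy v (weak_gradient \<Omega> v) - D
        = (\<integral>x. (v x - f x - weak_divergence \<Omega> p x)\<^sup>2 \<partial>M) / 2
          + (\<integral>x. \<phi> x (norm (weak_gradient \<Omega> v x)) + k x - p x \<bullet> weak_gradient \<Omega> v x \<partial>M)"
proof -
  define d where "d = weak_divergence \<Omega> p"
  have pm [measurable]: "p \<in> borel_measurable M" using p by (auto simp: K_space_def L_conj_def)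
  have dm [measurable]: "d \<in> borel_measurable M" and d2: "integrable M (\<lambda>x. (d x)\<^sup>2)"
    using K_space_divergence[OF p] by (auto simp: d_def)
  define e where "e x = e2ennreal (conjugate \<phi> x (norm (p x)))" for x
  have [measurable]: "e \<in> borel_measurable M" unfolding e_def by (rule conjugate_measurable) simp
  have cm: "conj_modular \<Omega> \<phi> p = (\<integral>\<^sup>+x. e x \<partial>M)" by (simp add: conj_modular_def e_def)
  define k where "k x = enn2real (e x)" for x
  have [measurable]: "k \<in> borel_measurable M" unfolding k_def by measurable
  have "AE x in M. e x \<noteq> \<infinity>"
    using fin cm by (intro nn_integral_PInf_AE) auto
  then have ek: "AE x in M. e x = ennreal (k x)"
    by eventually_elim (simp add: k_def less_top[symmetric])
  have k0: "0 \<le> k x" for x by (simp add: k_def)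
  have "(\<integral>\<^sup>+x. e x \<partial>M) = (\<integral>\<^sup>+x. ennreal (k x) \<partial>M)" by (rule nn_integral_cong_AE[OF ek])
  then have kint: "integrable M k"
    using fin cm k0 by (intro integrableI_nonneg) (auto simp: k_def)
  then have cmk: "conj_modular \<Omega> \<phi> p = ennreal (\<integral>x. k x \<partial>M)"
    using cm k0 \<open>(\<integral>\<^sup>+x. e x \<partial>M) = (\<integral>\<^sup>+x. ennreal (k x) \<partial>M)\<close> by (simp add: nn_integral_eq_integral)
  have ck: "AE x in M. conjugate \<phi> x (norm (p x)) = ereal (k x)"
    using ek
  proof eventually_elim
    case (elim x)
    have "conjugate \<phi> x (norm (p x)) = enn2ereal (e x)"
      unfolding e_def by (rule enn2ereal_e2ennreal[symmetric, OF conjugate_nonneg])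
    also have "\<dots> = ereal (k x)" using elim k0 by (simp add: enn2ereal_ennreal)
    finally show ?case .
  qed
  define D where "D = - (1/2) * (\<integral>x. (d x)\<^sup>2 \<partial>M) - (\<integral>x. f x * d x \<partial>M) - (\<integral>x. k x \<partial>M)"
  have dual: "dual \<Omega> \<phi> f p = ereal D"
    using k0 by (simp add: dual_def D_def norm_L2_def cmk enn2ereal_ennreal Bochner_Integration.integral_nonneg flip: d_def)
  define h where "h = weak_gradient \<Omega> v"
  have adm: "adm v h" using v by (simp add: X_space_iff h_def)
  note V = admD[OF adm]
  note [measurable] = V(1,2) f_facts(1)
  have Young: "p x \<bullet> y \<le> k x + \<phi> x (norm y)" if "conjugate \<phi> x (norm (p x)) = ereal (k x)" for x y
    using Young_inequality[of "p x" y x] that by simp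
  have ph: "integrable M (\<lambda>x. p x \<bullet> h x)"
  proof (rule Bochner_Integration.integrable_bound)
    show "integrable M (\<lambda>x. k x + \<phi> x (norm (h x)))" using kint V(6) by simp
    show "AE x in M. norm (p x \<bullet> h x) \<le> norm (k x + \<phi> x (norm (h x)))"
      using ck
    proof eventually_elim
      case (elim x)
      \<comment> \<open>Young's inequality bounds from above only; \<open>- h x\<close> has the same
        norm and supplies the bound from below.\<close>
      from Young[OF elim, of "h x"] Young[OF elim, of "- h x"] show ?case by simp
    qed
  qed measurable
  have vf2: "integrable M (\<lambda>x. (v x - f x)\<^sup>2)" by (rule V(8))
  have vd: "integrable M (\<lambda>x. v x * d x)" using V(5) d2 by (intro integrable_square_add(1)) auto
  have fd: "integrable M (\<lambda>x. f x * d x)" using f_facts(2) d2 by (intro integrable_square_add(1)) auto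
  have eq: "(v x - f x - d x)\<^sup>2 = (v x - f x)\<^sup>2 - 2 * (v x * d x) + 2 * (f x * d x) + (d x)\<^sup>2" for x
    by (simp add: power2_eq_square algebra_simps)
  have sq: "integrable M (\<lambda>x. (v x - f x - d x)\<^sup>2)" unfolding eq using vf2 vd fd d2 by simp
  have sqi: "(\<integral>x. (v x - f x - d x)\<^sup>2 \<partial>M)
      = (\<integral>x. (v x - f x)\<^sup>2 \<partial>M) - 2 * (\<integral>x. v x * d x \<partial>M) + 2 * (\<integral>x. f x * d x \<partial>M) + (\<integral>x. (d x)\<^sup>2 \<partial>M)"
    unfolding eq using vf2 vd fd d2 by simp
  have br: "integrable M (\<lambda>x. \<phi> x (norm (h x)) + k x - p x \<bullet> h x)" using V(6) kint ph by simp
  have bri: "(\<integral>x. \<phi> x (norm (h x)) + k x - p x \<bullet> h x \<partial>M)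
      = (\<integral>x. \<phi> x (norm (h x)) \<partial>M) + (\<integral>x. k x \<partial>M) - (\<integral>x. p x \<bullet> h x \<partial>M)"
    using V(6) kint ph by simp
  have nn: "AE x in M. 0 \<le> \<phi> x (norm (h x)) + k x - p x \<bullet> h x"
    using ck
  proof eventually_elim
    case (elim x)
    from Young[OF this, of "h x"] show ?case by simp
  qed
  \<comment> \<open>The integration by parts built into \<open>K_space\<close>; it cancels the mixed
    term of \<open>v\<close> and \<open>d\<close> in the expanded square.\<close>
  have "(\<integral>x. p x \<bullet> h x \<partial>M) = - (\<integral>x. v x * d x \<partial>M)"
    using p v by (simp add: K_space_def h_def d_def mult.commute)
  then have "energy v h - D = (\<integral>x. (v x - f x - d x)\<^sup>2 \<partial>M) / 2
        + (\<integral>x. \<phi> x (norm (h x)) + k x - p x \<bullet> h x \<partial>M)"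
    unfolding energy_eq[OF adm] D_def sqi bri by (simp add: field_simps)
  with sq br nn show thesis
    unfolding h_def d_def by (intro that[OF kint ck dual])
qed

lemma weak_duality:
  assumes p: "p \<in> K_space \<Omega> \<phi>" and v: "v \<in> X_space \<Omega> \<phi>"
  shows "dual \<Omega> \<phi> f p \<le> ereal (energy v (weak_gradient \<Omega> v))"
proof (cases "conj_modular \<Omega> \<phi> p = \<infinity>")
  case False
  then have "conj_modular \<Omega> \<phi> p < \<infinity>" by (simp add: less_top)
  from duality_gap[OF p this v] obtain k D where D: "dual \<Omega> \<phi> f p = ereal D"
    and nn: "AE x in M. 0 \<le> \<phi> x (norm (weak_gradient \<Omega> v x)) + k x - p x \<bullet> weak_gradient \<Omega> v x"
    and gap: "energy v (weak_gradient \<Omega> v) - D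
        = (\<integral>x. (v x - f x - weak_divergence \<Omega> p x)\<^sup>2 \<partial>M) / 2
          + (\<integral>x. \<phi> x (norm (weak_gradient \<Omega> v x)) + k x - p x \<bullet> weak_gradient \<Omega> v x \<partial>M)"
    by blast
  have "0 \<le> (\<integral>x. (v x - f x - weak_divergence \<Omega> p x)\<^sup>2 \<partial>M)"
    by (rule Bochner_Integration.integral_nonneg) simp
  moreover have "0 \<le> (\<integral>x. \<phi> x (norm (weak_gradient \<Omega> v x)) + k x - p x \<bullet> weak_gradient \<Omega> v x \<partial>M)"
    by (rule integral_nonneg_AE[OF nn])
  ultimately have "0 \<le> energy v (weak_gradient \<Omega> v) - D"
    unfolding gap by (intro add_nonneg_nonneg) auto
  then show ?thesis using D by simp
qed (simp add: dual_infinite)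

section \<open>Strong duality and the extremality relations\<close>

definition energy_minimizer :: "('a \<Rightarrow> real) \<Rightarrow> bool" where
  "energy_minimizer u \<longleftrightarrow> u \<in> X_space \<Omega> \<phi> \<and>
     (\<forall>v\<in>X_space \<Omega> \<phi>. energy u (weak_gradient \<Omega> u) \<le> energy v (weak_gradient \<Omega> v))"

lemma primal_minimizer_iff: "primal_minimizer \<Omega> \<phi> f u \<longleftrightarrow> energy_minimizer u"
  unfolding primal_minimizer_def energy_minimizer_def
  by (auto simp: primal_eq energy_nonneg)

lemma energy_weak_gradient:
  assumes "adm v h"
  shows "energy v (weak_gradient \<Omega> v) = energy v h"
  using adm_imp_X[OF assms] by (intro energy_cong_AE assms) (auto simp: X_space_iff)

lemma exists_minimizer: "\<exists>u. energy_minimizer u"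
proof -
  obtain u g where u: "adm u g" "\<And>v h. adm v h \<Longrightarrow> energy u g \<le> energy v h"
    using exists_energy_minimizer by blast
  then have "energy_minimizer u"
    unfolding energy_minimizer_def energy_weak_gradient[OF u(1)]
    using adm_imp_X[OF u(1)] by (auto simp: X_space_iff)
  then show ?thesis by blast
qed

text \<open>The Euler-Lagrange field closes the gap. Testing it with test functions identifies its
  divergence as \<open>u - f\<close>, testing it with the primal space places it in
  \<open>K_space\<close>, and the subgradient property removes the pointwise gap.\<close>

lemma strong_duality:
  assumes u: "energy_minimizer u"
  obtains p where "p \<in> K_space \<Omega> \<phi>" "dual \<Omega> \<phi> f p = ereal (energy u (weak_gradient \<Omega> u))"
proof -
  define g where "g = weak_gradient \<Omega> u"
  have uX: "u \<in> X_space \<Omega> \<phi>" using u by (simp add: energy_minimizer_def)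
  interpret phi_minimizer \<Omega> \<phi> f C u g
  proof
    show "adm u g" using uX by (simp add: X_space_iff g_def)
    fix v h assume v: "adm v h"
    then have "energy u g \<le> energy v (weak_gradient \<Omega> v)"
      using u adm_imp_X[OF v] by (simp add: energy_minimizer_def g_def)
    then show "energy u g \<le> energy v h" by (simp add: energy_weak_gradient[OF v])
  qed
  obtain p where p: "p \<in> subgrad_fields" "integrable M p"
    "\<And>v h. adm v h \<Longrightarrow> (\<integral>x. p x \<bullet> h x \<partial>M) = - (\<integral>x. (u x - f x) * v x \<partial>M)"
    using Euler_Lagrange by blast
  have pm: "p \<in> borel_measurable M" and sub: "AE x in M. subgrad x (g x) (p x)" using p(1) by (auto simp: subgrad_fields_def)
  have conj: "AE x in M. conjugate \<phi> x (norm (p x)) \<le> ereal (p x \<bullet> g x - \<phi> x (norm (g x)))"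
    using sub by (simp add: subgrad_iff_conjugate_le)
  \<comment> \<open>At a subgradient the conjugate is at most
    \<open>p x \<bullet> g x - \<phi> x (norm (g x))\<close>, and both terms are integrable.\<close>
  have fin: "conj_modular \<Omega> \<phi> p < \<infinity>"
  proof -
    have int: "integrable M (\<lambda>x. \<bar>p x \<bullet> g x - \<phi> x (norm (g x))\<bar>)"
      using subgrad_fields_integrable(2)[OF p(1) adm_u] u_facts(6) by auto
    have "conj_modular \<Omega> \<phi> p \<le> (\<integral>\<^sup>+x. ennreal \<bar>p x \<bullet> g x - \<phi> x (norm (g x))\<bar> \<partial>M)"
      unfolding conj_modular_def
    proof (rule nn_integral_mono_AE)
      show "AE x in M. e2ennreal (conjugate \<phi> x (norm (p x))) \<le> ennreal \<bar>p x \<bullet> g x - \<phi> x (norm (g x))\<bar>"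
        using conj
      proof eventually_elim
        case (elim x)
        then have "conjugate \<phi> x (norm (p x)) \<le> ereal \<bar>p x \<bullet> g x - \<phi> x (norm (g x))\<bar>"
          by (rule order_trans) simp
        then have "e2ennreal (conjugate \<phi> x (norm (p x))) \<le> e2ennreal (ereal \<bar>p x \<bullet> g x - \<phi> x (norm (g x))\<bar>)"
          by (rule e2ennreal_mono)
        then show ?case unfolding e2ennreal_ereal .
      qed
    qed
    also have "\<dots> < \<infinity>" using int by (subst nn_integral_eq_integral) auto
    finally show ?thesis .
  qed
  have div: "has_weak_divergence \<Omega> p (\<lambda>x. u x - f x)"
    unfolding has_weak_divergence_def
  proof (intro conjI ballI)
    show "locally_integrable \<Omega> p" by (rule integrable_imp_locally_integrable[OF p(2) open_dom])
    show "locally_integrable \<Omega> (\<lambda>x. u x - f x)"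
      using u_facts(3) f_facts(3) by (intro integrable_imp_locally_integrable open_dom) auto
    fix \<psi> assume "\<psi> \<in> test_functions \<Omega>"
    from p(3)[OF adm_test_function[OF this]]
    show "(\<integral>x. p x \<bullet> grad \<psi> x \<partial>M) = - (\<integral>x. (u x - f x) * \<psi> x \<partial>M)" .
  qed
  have div_AE: "AE x in M. weak_divergence \<Omega> p x = u x - f x"
    by (rule weak_divergence_eq_AE[OF open_dom div])
  have divm: "weak_divergence \<Omega> p \<in> borel_measurable M"
  proof (rule borel_measurable_lebesgue_on_AE[OF dom_sets u_minus_f_measurable])
    show "AE x in M. u x - f x = weak_divergence \<Omega> p x" using div_AE by eventually_elim simp
  qed
  have pK: "p \<in> K_space \<Omega> \<phi>"
    unfolding K_space_def
  proof (intro CollectI conjI ballI)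
    show "p \<in> L_conj \<Omega> \<phi>"
      using pm fin unfolding L_conj_def by (auto intro!: exI[of _ 1])
    show "\<exists>d\<in>L2 \<Omega>. has_weak_divergence \<Omega> p d"
      using div u_minus_f_measurable u_facts(8) by (intro bexI[of _ "\<lambda>x. u x - f x"]) (auto simp: L2_def)
    fix v assume "v \<in> X_space \<Omega> \<phi>"
    then have v: "adm v (weak_gradient \<Omega> v)" by (simp add: X_space_iff)
    have "(\<integral>x. weak_divergence \<Omega> p x * v x \<partial>M) = (\<integral>x. (u x - f x) * v x \<partial>M)"
    proof (rule integral_cong_AE)
      show "(\<lambda>x. weak_divergence \<Omega> p x * v x) \<in> borel_measurable M"
        "(\<lambda>x. (u x - f x) * v x) \<in> borel_measurable M"
        using divm u_minus_f_measurable admD(1)[OF v] by auto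
      show "AE x in M. weak_divergence \<Omega> p x * v x = (u x - f x) * v x"
        using div_AE by eventually_elim simp
    qed
    with p(3)[OF v] show "(\<integral>x. p x \<bullet> weak_gradient \<Omega> v x \<partial>M) = - (\<integral>x. weak_divergence \<Omega> p x * v x \<partial>M)" by simp
  qed
  obtain k D where k: "AE x in M. conjugate \<phi> x (norm (p x)) = ereal (k x)" and D: "dual \<Omega> \<phi> f p = ereal D"
    and nn: "AE x in M. 0 \<le> \<phi> x (norm (g x)) + k x - p x \<bullet> g x"
    and gap: "energy u g - D = (\<integral>x. (u x - f x - weak_divergence \<Omega> p x)\<^sup>2 \<partial>M) / 2
          + (\<integral>x. \<phi> x (norm (g x)) + k x - p x \<bullet> g x \<partial>M)"
    using duality_gap[OF pK fin uX, folded g_def] by blast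
  have "(\<integral>x. (u x - f x - weak_divergence \<Omega> p x)\<^sup>2 \<partial>M) = 0"
    by (rule integral_eq_zero_AE) (use div_AE in eventually_elim, simp)
  moreover have "(\<integral>x. \<phi> x (norm (g x)) + k x - p x \<bullet> g x \<partial>M) = 0"
  proof (rule integral_eq_zero_AE)
    show "AE x in M. \<phi> x (norm (g x)) + k x - p x \<bullet> g x = 0"
      using k conj nn by eventually_elim simp
  qed
  ultimately have "D = energy u g" using gap by simp
  with D pK show thesis by (intro that[of p]) (auto simp: g_def)
qed

theorem exists_dual_maximizer: "\<exists>p. dual_maximizer \<Omega> \<phi> f p"
proof -
  obtain u where u: "energy_minimizer u" using exists_minimizer by blast
  obtain p where "p \<in> K_space \<Omega> \<phi>" "dual \<Omega> \<phi> f p = ereal (energy u (weak_gradient \<Omega> u))"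
    using strong_duality[OF u] by blast
  then have "dual_maximizer \<Omega> \<phi> f p"
    using weak_duality u by (auto simp: dual_maximizer_def energy_minimizer_def)
  then show ?thesis by blast
qed

text \<open>A maximizer may differ from the field constructed before; equality of the two optimal
  values alone makes both nonnegative parts of its gap vanish.\<close>

theorem extremality_relations:
  assumes u: "energy_minimizer u" and max: "dual_maximizer \<Omega> \<phi> f p"
  shows "AE x in M. weak_divergence \<Omega> p x = u x - f x"
    and "AE x in M. subgrad x (weak_gradient \<Omega> u x) (p x)"
proof -
  define g where "g = weak_gradient \<Omega> u"
  have uX: "u \<in> X_space \<Omega> \<phi>" using u by (simp add: energy_minimizer_def)
  have pK: "p \<in> K_space \<Omega> \<phi>" using max by (simp add: dual_maximizer_def)
  obtain p0 where "p0 \<in> K_space \<Omega> \<phi>" "dual \<Omega> \<phi> f p0 = ereal (energy u g)"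
    using strong_duality[OF u] unfolding g_def by blast
  then have ge: "ereal (energy u g) \<le> dual \<Omega> \<phi> f p" using max by (metis dual_maximizer_def)
  then have "conj_modular \<Omega> \<phi> p \<noteq> \<infinity>" using dual_infinite[of p] by auto
  then have fin: "conj_modular \<Omega> \<phi> p < \<infinity>" by (simp add: less_top)
  obtain k D where k: "AE x in M. conjugate \<phi> x (norm (p x)) = ereal (k x)" and D: "dual \<Omega> \<phi> f p = ereal D"
    and int: "integrable M (\<lambda>x. (u x - f x - weak_divergence \<Omega> p x)\<^sup>2)"
      "integrable M (\<lambda>x. \<phi> x (norm (g x)) + k x - p x \<bullet> g x)"
    and nn: "AE x in M. 0 \<le> \<phi> x (norm (g x)) + k x - p x \<bullet> g x"
    and gap: "energy u g - D = (\<integral>x. (u x - f x - weak_divergence \<Omega> p x)\<^sup>2 \<partial>M) / 2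
          + (\<integral>x. \<phi> x (norm (g x)) + k x - p x \<bullet> g x \<partial>M)"
    using duality_gap[OF pK fin uX, folded g_def] by blast
  have 1: "0 \<le> (\<integral>x. (u x - f x - weak_divergence \<Omega> p x)\<^sup>2 \<partial>M)"
    by (rule Bochner_Integration.integral_nonneg) simp
  have 2: "0 \<le> (\<integral>x. \<phi> x (norm (g x)) + k x - p x \<bullet> g x \<partial>M)" by (rule integral_nonneg_AE[OF nn])
  have "energy u g - D \<le> 0" using ge D by simp
  then have zero: "(\<integral>x. (u x - f x - weak_divergence \<Omega> p x)\<^sup>2 \<partial>M) = 0"
    "(\<integral>x. \<phi> x (norm (g x)) + k x - p x \<bullet> g x \<partial>M) = 0"
    using gap 1 2 by linarith+
  have "AE x in M. (u x - f x - weak_divergence \<Omega> p x)\<^sup>2 = 0"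
    using integral_nonneg_eq_0_iff_AE[OF int(1)] zero(1) by simp
  then show "AE x in M. weak_divergence \<Omega> p x = u x - f x" by eventually_elim simp
  have "AE x in M. \<phi> x (norm (g x)) + k x - p x \<bullet> g x = 0"
    using integral_nonneg_eq_0_iff_AE[OF int(2) nn] zero(2) by simp
  with k show "AE x in M. subgrad x (weak_gradient \<Omega> u x) (p x)"
  proof eventually_elim
    case (elim x)
    then show ?case by (simp add: subgrad_iff_conjugate_le g_def)
  qed
qed

text \<open>Testing at a vector of the same norm in the direction of \<open>p\<close> forces
  equality in the Cauchy-Schwarz inequality, so \<open>p\<close> is a nonnegative multiple of
  \<open>z\<close>. Testing along the ray through \<open>z\<close> gives the one-dimensional
  subgradient inequality.\<close>

lemma subgrad_radial:
  assumes sub: "subgrad x z p" and z: "z \<noteq> 0"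
  shows "p = ((p \<bullet> z) / norm z) *\<^sub>R (z /\<^sub>R norm z)"
    and "(p \<bullet> z) / norm z \<in> subdifferential {0..} (\<phi> x) (norm z)"
proof -
  have ineq: "\<phi> x (norm z) + p \<bullet> (w - z) \<le> \<phi> x (norm w)" for w using sub by (simp add: subgrad_def)
  have "norm p * norm z \<le> p \<bullet> z"
  proof (cases "p = 0")
    case False
    then have "\<phi> x (norm z) + (norm z * norm p - p \<bullet> z) \<le> \<phi> x (norm z)"
      using ineq[of "(norm z / norm p) *\<^sub>R p"] by (simp add: inner_diff_right dot_square_norm power2_eq_square)
    then show ?thesis by (simp add: mult.commute)
  qed simp
  then have "p \<bullet> z = norm p * norm z" using norm_cauchy_schwarz[of p z] by simp
  then have "norm p *\<^sub>R z = norm z *\<^sub>R p" by (simp add: norm_cauchy_schwarz_eq)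
  then have "p = (norm p / norm z) *\<^sub>R z"
    using z by (metis divide_inverse mult.commute scaleR_scaleR scaleR_one left_inverse norm_eq_zero)
  moreover have "(p \<bullet> z) / norm z = norm p" using \<open>p \<bullet> z = norm p * norm z\<close> z by simp
  ultimately show "p = ((p \<bullet> z) / norm z) *\<^sub>R (z /\<^sub>R norm z)"
    by (simp add: divide_inverse)
  show "(p \<bullet> z) / norm z \<in> subdifferential {0..} (\<phi> x) (norm z)"
    unfolding subdifferential_def
  proof (intro CollectI conjI ballI)
    fix t :: real assume "t \<in> {0..}"
    then have "norm ((t / norm z) *\<^sub>R z) = t" using z by simp
    moreover have "p \<bullet> ((t / norm z) *\<^sub>R z - z) = (p \<bullet> z) / norm z * (t - norm z)"
      using z by (simp add: inner_diff_right field_simps)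
    ultimately show "\<phi> x (norm z) + ((p \<bullet> z) / norm z) \<bullet> (t - norm z) \<le> \<phi> x t"
      using ineq[of "(t / norm z) *\<^sub>R z"] by simp
  qed simp
qed

end

section \<open>The theorem\<close>

text \<open>Allows \<phi> to be redefined on a null set; the spaces and functionals then agree as
  sets and functions, not just almost everywhere.\<close>

lemma functionals_cong_AE:
  fixes \<Omega> :: "'a::euclidean_space set"
  assumes "AE x in lebesgue_on \<Omega>. \<phi> x = \<psi> x"
  shows "X_space \<Omega> \<phi> = X_space \<Omega> \<psi>" "K_space \<Omega> \<phi> = K_space \<Omega> \<psi>"
    "primal \<Omega> \<phi> = primal \<Omega> \<psi>" "dual \<Omega> \<phi> = dual \<Omega> \<psi>"
proof -
  have m: "modular \<Omega> \<phi> = modular \<Omega> \<psi>"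
  proof
    fix v :: "'a \<Rightarrow> 'a"
    have "AE x in lebesgue_on \<Omega>. ennreal (\<phi> x (norm (v x))) = ennreal (\<psi> x (norm (v x)))"
      using assms by eventually_elim simp
    then show "modular \<Omega> \<phi> v = modular \<Omega> \<psi> v"
      unfolding modular_def by (rule nn_integral_cong_AE)
  qed
  have c: "conj_modular \<Omega> \<phi> = conj_modular \<Omega> \<psi>"
  proof
    fix v :: "'a \<Rightarrow> 'a"
    have "AE x in lebesgue_on \<Omega>. e2ennreal (conjugate \<phi> x (norm (v x))) = e2ennreal (conjugate \<psi> x (norm (v x)))"
      using assms by eventually_elim (simp add: conjugate_def)
    then show "conj_modular \<Omega> \<phi> v = conj_modular \<Omega> \<psi> v"
      unfolding conj_modular_def by (rule nn_integral_cong_AE)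
  qed
  show X: "X_space \<Omega> \<phi> = X_space \<Omega> \<psi>" by (simp add: X_space_def m)
  show "K_space \<Omega> \<phi> = K_space \<Omega> \<psi>" by (simp add: K_space_def L_conj_def X c)
  show "primal \<Omega> \<phi> = primal \<Omega> \<psi>" "dual \<Omega> \<phi> = dual \<Omega> \<psi>"
    by (simp_all add: primal_def dual_def m c fun_eq_iff)
qed

lemma essinf_le_AE:
  assumes "m < essinf M h"
  shows "AE x in M. m \<le> h x"
proof -
  have "AE x in M. - h x \<le> esssup M (\<lambda>x. - h x)" by (rule esssup_AE)
  then show ?thesis
  proof eventually_elim
    case (elim x)
    have "m < - esssup M (\<lambda>x. - h x)" using assms by (simp add: essinf_def)
    also have "\<dots> \<le> h x" using elim by (simp add: ereal_uminus_le_reorder)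
    finally show ?case by simp
  qed
qed

text \<open>A single \<open>T\<close> with \<open>m * T \<le> \<phi> x T\<close> suffices, so only
  one exceptional null set arises although the bound holds for all \<open>t\<close>. Beyond
  \<open>T\<close>, convexity and \<open>\<phi> x 0 = 0\<close> propagate the inequality; below
  \<open>T\<close> the constant \<open>m * T\<close> absorbs it.\<close>

lemma superlinear_lower_bound:
  assumes conv: "AE x in M. convex_on {0..} (\<phi> x) \<and> mono_on {0..} (\<phi> x) \<and> continuous_on {0..} (\<phi> x) \<and> \<phi> x 0 = 0"
    and lim: "((\<lambda>t. essinf M (\<lambda>x. ereal (\<phi> x t / t))) \<longlongrightarrow> \<infinity>) at_top" and m: "0 < m"
  shows "\<exists>T. AE x in M. \<forall>t\<ge>0. m * t \<le> \<phi> x t + T"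
proof -
  have "\<forall>\<^sub>F t in at_top. ereal m < essinf M (\<lambda>x. ereal (\<phi> x t / t))"
    using lim by (rule order_tendstoD) simp
  then have "\<forall>\<^sub>F t in at_top. ereal m < essinf M (\<lambda>x. ereal (\<phi> x t / t)) \<and> 0 < t"
    using eventually_gt_at_top[of 0] by eventually_elim simp
  then obtain T where T: "ereal m < essinf M (\<lambda>x. ereal (\<phi> x T / T))" "0 < T"
    unfolding eventually_at_top_linorder by blast
  have "AE x in M. \<forall>t\<ge>0. m * t \<le> \<phi> x t + m * T"
    using essinf_le_AE[OF T(1)] conv
  proof eventually_elim
    case (elim x)
    then have mT: "m * T \<le> \<phi> x T" using T(2) by (simp add: pos_le_divide_eq)
    show ?case
    proof (intro allI impI)
      fix t :: real assume t: "0 \<le> t"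
      have nonneg: "0 \<le> \<phi> x t" using elim t by (metis atLeast_iff mono_onD order_refl)
      show "m * t \<le> \<phi> x t + m * T"
      proof (cases "t \<le> T")
        case True
        then have "m * t \<le> m * T" using m by (intro mult_left_mono) auto
        with nonneg show ?thesis by simp
      next
        case False
        define s where "s = T / t"
        have s: "0 < s" "s \<le> 1" "s * t = T" using False T(2) by (auto simp: s_def)
        have "\<phi> x ((1 - s) *\<^sub>R 0 + s *\<^sub>R t) \<le> (1 - s) * \<phi> x 0 + s * \<phi> x t"
          using elim s t by (intro convex_onD[of "{0..}"]) auto
        then have "m * (s * t) \<le> s * \<phi> x t" using elim mT s by simp
        then have "s * (m * t) \<le> s * \<phi> x t" by (simp add: mult.left_commute)
        then have "m * t \<le> \<phi> x t" using s by simp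
        then show ?thesis using m T(2) by (simp add: add_increasing2)
      qed
    qed
  qed
  then show ?thesis by blast
qed

theorem proposition3p10:
  fixes \<Omega> :: "(real ^ 'n) set"
    and \<phi> :: "real ^ 'n \<Rightarrow> real \<Rightarrow> real"
    and f :: "real ^ 'n \<Rightarrow> real"
  assumes "bounded \<Omega>" and "lipschitz_domain \<Omega>"
    and "f \<in> L2 \<Omega>"
    and "\<And>x t. x \<in> \<Omega> \<Longrightarrow> 0 \<le> t \<Longrightarrow> 0 \<le> \<phi> x t"
    and "\<And>t. 0 \<le> t \<Longrightarrow> (\<lambda>x. \<phi> x t) \<in> borel_measurable (lebesgue_on \<Omega>)"
    and "AE x in lebesgue_on \<Omega>. convex_on {0..} (\<phi> x) \<and> mono_on {0..} (\<phi> x) \<and>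
           continuous_on {0..} (\<phi> x) \<and> \<phi> x 0 = 0"
    and "\<And>t. 0 \<le> t \<Longrightarrow> integrable (lebesgue_on \<Omega>) (\<lambda>x. \<phi> x t)"
    and "\<exists>C. AE x in lebesgue_on \<Omega>. \<forall>t\<ge>0. \<phi> x (2 * t) \<le> C * \<phi> x t"
    and "((\<lambda>t. essinf (lebesgue_on \<Omega>) (\<lambda>x. ereal (\<phi> x t / t))) \<longlongrightarrow> \<infinity>) at_top"
  shows "(\<exists>p. dual_maximizer \<Omega> \<phi> f p) \<and>
    (\<forall>u p. primal_minimizer \<Omega> \<phi> f u \<and> dual_maximizer \<Omega> \<phi> f p \<longrightarrow>
      (AE x in lebesgue_on \<Omega>. weak_divergence \<Omega> p x = u x - f x) \<and>
      (AE x in lebesgue_on \<Omega>.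
         p x \<in> subdifferential UNIV (\<lambda>z. \<phi> x (norm z)) (weak_gradient \<Omega> u x)) \<and>
      (\<exists>a. AE x in lebesgue_on \<Omega>. weak_gradient \<Omega> u x \<noteq> 0 \<longrightarrow>
         a x \<in> subdifferential {0..} (\<phi> x) (norm (weak_gradient \<Omega> u x)) \<and>
         p x = a x *\<^sub>R (weak_gradient \<Omega> u x /\<^sub>R norm (weak_gradient \<Omega> u x))))"
proof -
  obtain C where C: "AE x in lebesgue_on \<Omega>. \<forall>t\<ge>0. \<phi> x (2 * t) \<le> C * \<phi> x t" using assms(8) by blast
  \<comment> \<open>Membership in \<Omega> is included because nonnegativity of \<phi> is assumed
    there only. At all other points \<phi> will be replaced by \<open>0\<close>, which satisfies
    every pointwise condition.\<close>
  define good where "good x \<longleftrightarrow> x \<in> \<Omega> \<and> (convex_on {0..} (\<phi> x) \<and> mono_on {0..} (\<phi> x) \<and>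
           continuous_on {0..} (\<phi> x) \<and> \<phi> x 0 = 0) \<and> (\<forall>t\<ge>0. \<phi> x (2 * t) \<le> C * \<phi> x t)" for x
  have good: "AE x in lebesgue_on \<Omega>. good x"
    using assms(6) C AE_space by eventually_elim (simp add: good_def)
  define \<psi> where "\<psi> x t = (if good x then \<phi> x t else 0)" for x t
  have eq: "AE x in lebesgue_on \<Omega>. \<phi> x = \<psi> x" using good by eventually_elim (simp add: \<psi>_def fun_eq_iff)
  have "open \<Omega>" using assms(2) by (simp add: lipschitz_domain_def)
  have \<psi>_meas: "(\<lambda>x. \<psi> x t) \<in> borel_measurable (lebesgue_on \<Omega>)" if "0 \<le> t" for t
  proof (rule borel_measurable_lebesgue_on_AE)
    show "\<Omega> \<in> sets lebesgue" using \<open>open \<Omega>\<close> by auto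
    show "(\<lambda>x. \<phi> x t) \<in> borel_measurable (lebesgue_on \<Omega>)" using that by (rule assms(5))
    show "AE x in lebesgue_on \<Omega>. \<phi> x t = \<psi> x t" using eq by eventually_elim simp
  qed
  \<comment> \<open>The constant \<open>C\<close> could be negative; since \<phi> is nonnegative,
    passing to its absolute value keeps the doubling inequality.\<close>
  interpret phi_growth \<Omega> \<psi> f "\<bar>C\<bar>"
  proof
    fix x t
    show "convex_on {0..} (\<psi> x)" "mono_on {0..} (\<psi> x)" "continuous_on {0..} (\<psi> x)" "\<psi> x 0 = 0"
    proof -
      have "\<psi> x = (if good x then \<phi> x else (\<lambda>t. 0))" by (simp add: \<psi>_def fun_eq_iff)
      then show "convex_on {0..} (\<psi> x)" "mono_on {0..} (\<psi> x)" "continuous_on {0..} (\<psi> x)" "\<psi> x 0 = 0"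
        by (cases "good x"; simp add: good_def convex_on_const mono_onI)+
    qed
    show "\<psi> x (2 * t) \<le> \<bar>C\<bar> * \<psi> x t" if "0 \<le> t"
    proof (cases "good x")
      case True
      then have "\<phi> x (2 * t) \<le> C * \<phi> x t" "0 \<le> \<phi> x t"
        using that assms(4) by (auto simp: good_def)
      moreover from this(2) have "C * \<phi> x t \<le> \<bar>C\<bar> * \<phi> x t" by (intro mult_right_mono) auto
      ultimately show ?thesis using True by (simp add: \<psi>_def)
    qed (simp add: \<psi>_def)
  next
    fix t :: real assume t: "0 \<le> t"
    show "(\<lambda>x. \<psi> x t) \<in> borel_measurable (lebesgue_on \<Omega>)" by (rule \<psi>_meas[OF t])
    have "AE x in lebesgue_on \<Omega>. \<phi> x t = \<psi> x t" using eq by eventually_elim simp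
    from integrable_cong_AE[OF assms(5)[OF t] \<psi>_meas[OF t] this]
    show "integrable (lebesgue_on \<Omega>) (\<lambda>x. \<psi> x t)" using assms(7)[OF t] by simp
  next
    fix m :: real assume "0 < m"
    from superlinear_lower_bound[OF assms(6,9) this]
    obtain T where "AE x in lebesgue_on \<Omega>. \<forall>t\<ge>0. m * t \<le> \<phi> x t + T" by blast
    with eq have "AE x in lebesgue_on \<Omega>. \<forall>t\<ge>0. m * t \<le> \<psi> x t + T" by eventually_elim simp
    then show "\<exists>T. AE x in lebesgue_on \<Omega>. \<forall>t\<ge>0. m * t \<le> \<psi> x t + T" ..
  qed (use assms \<open>open \<Omega>\<close> in auto)
  note cong = functionals_cong_AE[OF eq]
  have max_eq: "dual_maximizer \<Omega> \<phi> f = dual_maximizer \<Omega> \<psi> f"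
    by (simp add: dual_maximizer_def cong fun_eq_iff)
  have min_eq: "primal_minimizer \<Omega> \<phi> f u \<longleftrightarrow> energy_minimizer u" for u
    unfolding primal_minimizer_iff[symmetric] by (simp add: primal_minimizer_def cong)
  show ?thesis
    unfolding max_eq min_eq
  proof (intro conjI allI impI exists_dual_maximizer)
    fix u p
    assume up: "energy_minimizer u \<and> dual_maximizer \<Omega> \<psi> f p"
    then have ext: "AE x in M. weak_divergence \<Omega> p x = u x - f x"
      "AE x in M. subgrad x (weak_gradient \<Omega> u x) (p x)"
      using extremality_relations by blast+
    show "AE x in M. weak_divergence \<Omega> p x = u x - f x" by (rule ext(1))
    show "AE x in M. p x \<in> subdifferential UNIV (\<lambda>z. \<phi> x (norm z)) (weak_gradient \<Omega> u x)"
      using ext(2) eq by eventually_elim (simp add: subgrad_def subdifferential_def)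
    \<comment> \<open>The component of \<open>p\<close> along the gradient, hence a globally defined
      function; where the gradient vanishes it is \<open>0\<close> by the convention for
      division.\<close>
    let ?a = "\<lambda>x. (p x \<bullet> weak_gradient \<Omega> u x) / norm (weak_gradient \<Omega> u x)"
    have "AE x in M. weak_gradient \<Omega> u x \<noteq> 0 \<longrightarrow>
         ?a x \<in> subdifferential {0..} (\<phi> x) (norm (weak_gradient \<Omega> u x)) \<and>
         p x = ?a x *\<^sub>R (weak_gradient \<Omega> u x /\<^sub>R norm (weak_gradient \<Omega> u x))"
      using ext(2) eq
    proof eventually_elim
      case (elim x)
      show ?case
        unfolding elim(2) by (intro impI conjI subgrad_radial[OF elim(1)])
    qed
    then show "\<exists>a. AE x in M. weak_gradient \<Omega> u x \<noteq> 0 \<longrightarrow>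
         a x \<in> subdifferential {0..} (\<phi> x) (norm (weak_gradient \<Omega> u x)) \<and>
         p x = a x *\<^sub>R (weak_gradient \<Omega> u x /\<^sub>R norm (weak_gradient \<Omega> u x))"
      by (rule exI[of _ ?a])
  qed
qed

end
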